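(* Let $\mathbb K=\mathbb R$ or $\mathbb K=\mathbb Q_p$ for some prime $p$. There exists a complete abelian topological group $G$ such that the set $N_{\mathbb K}(G)$ of all closed normal subgroups $N\subseteq G$ for which $G/N$ is a $\mathbb K$-Lie group is not a filter basis.
   Context: All topological groups are Hausdorff. A $\mathbb K$-Lie group is a finite-dimensional analytic Lie group over $\mathbb K$, identified with its underlying topological group. A set $\mathcal F$ of subsets of $G$ containing the identity is a filter basis if it is non-empty and for all $M,N\in\mathcal F$ there is $P\in\mathcal F$ with $P\subseteq M\cap N$. *)

theory Defs
  imports "HOL-Analysis.Analysis" "HOL-Algebra.QuotRing" "HOL-Algebra.Coset"
    "HOL-Computational_Algebra.Primes"
begin

section \<open>Valued fields: the reals and the p-adic numbers\<close>

record 'k valued_field = "'k ring" +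
  absval :: "'k \<Rightarrow> real"

definition real_valued_field :: "real valued_field" where
  "real_valued_field =
     \<lparr>carrier = UNIV, monoid.mult = (*), one = 1, zero = 0, add = (+), absval = abs\<rparr>"

definition padic_abs :: "nat \<Rightarrow> rat \<Rightarrow> real" where
  "padic_abs p x =
     (if x = 0 then 0
      else case quotient_of x of (a, b) \<Rightarrow>
        real p powi (int (multiplicity (int p) b) - int (multiplicity (int p) a)))"

text \<open>
  The field of p-adic numbers is the completion of the rationals with respect to the p-adic
  absolute value: Cauchy sequences modulo null sequences. Its elements are thus cosets, that is,
  sets of rational sequences.
\<close>

definition padic_cauchy_ring :: "nat \<Rightarrow> (nat \<Rightarrow> rat) ring" where
  "padic_cauchy_ring p =
     \<lparr>carrier = {x. \<forall>\<epsilon>>0. \<exists>M. \<forall>m\<ge>M. \<forall>n\<ge>M. padic_abs p (x m - x n) < \<epsilon>},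
      monoid.mult = (\<lambda>x y n. x n * y n), one = (\<lambda>n. 1),
      zero = (\<lambda>n. 0), add = (\<lambda>x y n. x n + y n)\<rparr>"

definition padic_null_ideal :: "nat \<Rightarrow> (nat \<Rightarrow> rat) set" where
  "padic_null_ideal p = {x. (\<lambda>n. padic_abs p (x n)) \<longlonglongrightarrow> 0}"

definition padic_field :: "nat \<Rightarrow> (nat \<Rightarrow> rat) set valued_field" where
  "padic_field p =
     ring.extend (padic_cauchy_ring p Quot padic_null_ideal p)
       (valued_field.fields
         (\<lambda>X. THE r. \<forall>x\<in>X. (\<lambda>n. padic_abs p (x n)) \<longlonglongrightarrow> r))"

lemma padic_field_sel:
  "carrier (padic_field p) = a_rcosets\<^bsub>padic_cauchy_ring p\<^esub> (padic_null_ideal p)"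
  "monoid.mult (padic_field p) = rcoset_mult (padic_cauchy_ring p) (padic_null_ideal p)"
  "one (padic_field p) = padic_null_ideal p +>\<^bsub>padic_cauchy_ring p\<^esub> \<one>\<^bsub>padic_cauchy_ring p\<^esub>"
  "zero (padic_field p) = padic_null_ideal p"
  "add (padic_field p) = set_add (padic_cauchy_ring p)"
  "absval (padic_field p) X = (THE r. \<forall>x\<in>X. (\<lambda>n. padic_abs p (x n)) \<longlonglongrightarrow> r)"
  by (simp_all add: padic_field_def FactRing_def ring.defs valued_field.defs)

text \<open>
  The distance is cut off outside the carrier so that it can be an instance of
  \<^locale>\<open>Metric_space\<close>, whose axioms on symmetry and positivity are not relativised.
\<close>

definition field_dist :: "('k, 'b) valued_field_scheme \<Rightarrow> 'k \<Rightarrow> 'k \<Rightarrow> real" where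
  "field_dist K x y =
     (if x \<in> carrier K \<and> y \<in> carrier K then absval K (x \<ominus>\<^bsub>K\<^esub> y) else 0)"

definition field_topology :: "('k, 'b) valued_field_scheme \<Rightarrow> 'k topology" where
  "field_topology K = Metric_space.mtopology (carrier K) (field_dist K)"

section \<open>Analytic maps\<close>

text \<open>The space \<open>K\<^sup>n\<close>; its points are the extensional functions on \<open>{..<n}\<close>.\<close>

definition affine_space :: "('k, 'b) valued_field_scheme \<Rightarrow> nat \<Rightarrow> (nat \<Rightarrow> 'k) topology" where
  "affine_space K n = product_topology (\<lambda>_. field_topology K) {..<n}"

definition multi_indices :: "nat \<Rightarrow> (nat \<Rightarrow> nat) set" where
  "multi_indices n = {\<alpha>. \<forall>i\<ge>n. \<alpha> i = 0}"

definition power_series_term ::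
    "('k, 'b) valued_field_scheme \<Rightarrow> nat \<Rightarrow> ((nat \<Rightarrow> nat) \<Rightarrow> 'k) \<Rightarrow> (nat \<Rightarrow> 'k) \<Rightarrow> (nat \<Rightarrow> 'k) \<Rightarrow>
     (nat \<Rightarrow> nat) \<Rightarrow> 'k" where
  "power_series_term K n c a x \<alpha> =
     c \<alpha> \<otimes>\<^bsub>K\<^esub> finprod K (\<lambda>i. (x i \<ominus>\<^bsub>K\<^esub> a i) [^]\<^bsub>K\<^esub> \<alpha> i) {..<n}"

text \<open>
  Near \<open>a\<close>, the function \<open>f\<close> is the sum of a power series in \<open>n\<close> variables that converges
  absolutely on a polydisc of positive radius. Absoluteness is no restriction: convergence on some
  polydisc implies absolute convergence on a smaller one, over the reals and the p-adic numbers.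
\<close>

definition analytic_at_point ::
    "('k, 'b) valued_field_scheme \<Rightarrow> nat \<Rightarrow> (nat \<Rightarrow> 'k) set \<Rightarrow> ((nat \<Rightarrow> 'k) \<Rightarrow> 'k) \<Rightarrow>
     (nat \<Rightarrow> 'k) \<Rightarrow> bool" where
  "analytic_at_point K n D f a \<longleftrightarrow>
     (\<exists>c r. r > 0 \<and> (\<forall>\<alpha>\<in>multi_indices n. c \<alpha> \<in> carrier K) \<and>
       (\<lambda>\<alpha>. absval K (c \<alpha>) * r ^ (\<Sum>i<n. \<alpha> i)) summable_on multi_indices n \<and>
       (\<forall>x\<in>D. (\<forall>i<n. field_dist K (x i) (a i) < r) \<longrightarrow>
          limitin (field_topology K) (\<lambda>F. finsum K (power_series_term K n c a x) F) (f x)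
            (finite_subsets_at_top (multi_indices n))))"

definition analytic_map ::
    "('k, 'b) valued_field_scheme \<Rightarrow> nat \<Rightarrow> nat \<Rightarrow> (nat \<Rightarrow> 'k) set \<Rightarrow>
     ((nat \<Rightarrow> 'k) \<Rightarrow> (nat \<Rightarrow> 'k)) \<Rightarrow> bool" where
  "analytic_map K m k D f \<longleftrightarrow>
     openin (affine_space K m) D \<and> f \<in> D \<rightarrow> topspace (affine_space K k) \<and>
     (\<forall>a\<in>D. \<forall>j<k. analytic_at_point K m D (\<lambda>x. f x j) a)"

section \<open>Analytic manifolds and Lie groups\<close>

type_synonym ('a, 'k) chart = "'a set \<times> ('a \<Rightarrow> nat \<Rightarrow> 'k)"

definition chart_on ::
    "('k, 'b) valued_field_scheme \<Rightarrow> nat \<Rightarrow> 'a topology \<Rightarrow> ('a, 'k) chart \<Rightarrow> bool" where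
  "chart_on K n T = (\<lambda>(U, \<phi>).
     openin T U \<and> openin (affine_space K n) (\<phi> ` U) \<and>
     homeomorphic_map (subtopology T U) (subtopology (affine_space K n) (\<phi> ` U)) \<phi>)"

definition analytic_atlas ::
    "('k, 'b) valued_field_scheme \<Rightarrow> nat \<Rightarrow> 'a topology \<Rightarrow> ('a, 'k) chart set \<Rightarrow> bool" where
  "analytic_atlas K n T A \<longleftrightarrow>
     (\<forall>C\<in>A. chart_on K n T C) \<and> (\<Union>(U, \<phi>)\<in>A. U) = topspace T \<and>
     (\<forall>(U, \<phi>)\<in>A. \<forall>(V, \<psi>)\<in>A.
        analytic_map K n n (\<phi> ` (U \<inter> V)) (\<lambda>x. \<psi> (inv_into U \<phi> x)))"

locale topological_group = group G for G (structure) +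
  fixes T :: "'a topology"
  assumes topspace_eq: "topspace T = carrier G"
    and continuous_mult: "continuous_map (prod_topology T T) T (\<lambda>(x, y). x \<otimes> y)"
    and continuous_inv: "continuous_map T T (\<lambda>x. inv x)"
    and Hausdorff: "Hausdorff_space T"

text \<open>
  Multiplication and inversion read in charts. A point of \<open>K\<^sup>n \<times> K\<^sup>n\<close> is a point
  \<open>z\<close> of \<open>K\<^sup>n\<^sup>+\<^sup>n\<close>, whose two halves are \<open>first_half n z\<close> and \<open>second_half n z\<close>.
\<close>

definition first_half :: "nat \<Rightarrow> (nat \<Rightarrow> 'k) \<Rightarrow> (nat \<Rightarrow> 'k)" where
  "first_half n z = (\<lambda>i\<in>{..<n}. z i)"

definition second_half :: "nat \<Rightarrow> (nat \<Rightarrow> 'k) \<Rightarrow> (nat \<Rightarrow> 'k)" where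
  "second_half n z = (\<lambda>i\<in>{..<n}. z (n + i))"

definition analytic_mult_in_charts ::
    "('k, 'b) valued_field_scheme \<Rightarrow> nat \<Rightarrow> ('a, 'c) monoid_scheme \<Rightarrow>
     ('a, 'k) chart \<Rightarrow> ('a, 'k) chart \<Rightarrow> ('a, 'k) chart \<Rightarrow> bool" where
  "analytic_mult_in_charts K n G = (\<lambda>(U, \<phi>) (V, \<psi>) (W, \<theta>).
     let \<mu> = (\<lambda>z. inv_into U \<phi> (first_half n z) \<otimes>\<^bsub>G\<^esub> inv_into V \<psi> (second_half n z))
     in analytic_map K (n + n) n
          {z \<in> topspace (affine_space K (n + n)).
             first_half n z \<in> \<phi> ` U \<and> second_half n z \<in> \<psi> ` V \<and> \<mu> z \<in> W}
          (\<lambda>z. \<theta> (\<mu> z)))"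

definition analytic_inv_in_charts ::
    "('k, 'b) valued_field_scheme \<Rightarrow> nat \<Rightarrow> ('a, 'c) monoid_scheme \<Rightarrow>
     ('a, 'k) chart \<Rightarrow> ('a, 'k) chart \<Rightarrow> bool" where
  "analytic_inv_in_charts K n G = (\<lambda>(U, \<phi>) (V, \<psi>).
     analytic_map K n n {x \<in> \<phi> ` U. inv\<^bsub>G\<^esub> (inv_into U \<phi> x) \<in> V}
       (\<lambda>x. \<psi> (inv\<^bsub>G\<^esub> (inv_into U \<phi> x))))"

definition lie_group ::
    "('k, 'b) valued_field_scheme \<Rightarrow> ('a, 'c) monoid_scheme \<Rightarrow> 'a topology \<Rightarrow> bool" where
  "lie_group K G T \<longleftrightarrow>
     topological_group G T \<and>
     (\<exists>n (A :: ('a, 'k) chart set). analytic_atlas K n T A \<and>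
        (\<forall>C\<in>A. \<forall>D\<in>A. \<forall>E\<in>A. analytic_mult_in_charts K n G C D E) \<and>
        (\<forall>C\<in>A. \<forall>D\<in>A. analytic_inv_in_charts K n G C D))"

section \<open>Complete groups, quotients and filter bases\<close>

text \<open>
  Completeness with respect to the left uniform structure, which is the only group uniformity
  in the abelian case.
\<close>

definition cauchy_group_filter ::
    "('a, 'c) monoid_scheme \<Rightarrow> 'a topology \<Rightarrow> 'a filter \<Rightarrow> bool" where
  "cauchy_group_filter G T F \<longleftrightarrow>
     F \<noteq> bot \<and> eventually (\<lambda>x. x \<in> carrier G) F \<and>
     (\<forall>U. openin T U \<and> \<one>\<^bsub>G\<^esub> \<in> U \<longrightarrow>
        eventually (\<lambda>(x, y). inv\<^bsub>G\<^esub> x \<otimes>\<^bsub>G\<^esub> y \<in> U) (F \<times>\<^sub>F F))"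

definition complete_group :: "('a, 'c) monoid_scheme \<Rightarrow> 'a topology \<Rightarrow> bool" where
  "complete_group G T \<longleftrightarrow>
     (\<forall>F. cauchy_group_filter G T F \<longrightarrow> (\<exists>l. limitin T (\<lambda>x. x) l F))"

definition quotient_topology ::
    "('a, 'c) monoid_scheme \<Rightarrow> 'a topology \<Rightarrow> 'a set \<Rightarrow> 'a set topology" where
  "quotient_topology G T N =
     topology (\<lambda>\<V>. \<V> \<subseteq> carrier (G Mod N) \<and> openin T (\<Union>\<V>))"

lemma (in topological_group) openin_quotient_topology:
  assumes "subgroup N G"
  shows "openin (quotient_topology G T N) \<V> \<longleftrightarrow> \<V> \<subseteq> carrier (G Mod N) \<and> openin T (\<Union>\<V>)"
proof -
  have disj: "X = Y" if "X \<in> rcosets N" "Y \<in> rcosets N" "x \<in> X" "x \<in> Y" for X Y x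
    using rcos_disjoint[OF assms] that by (auto simp: pairwise_def disjnt_def)
  have "\<Union>(\<V> \<inter> \<W>) = \<Union>\<V> \<inter> \<Union>\<W>" if "\<V> \<subseteq> rcosets N" "\<W> \<subseteq> rcosets N" for \<V> \<W>
    using that disj by blast
  moreover have "\<Union>(\<Union>\<K>) = (\<Union>\<V>\<in>\<K>. \<Union>\<V>)" for \<K> :: "'a set set set"
    by blast
  ultimately have "istopology (\<lambda>\<V>. \<V> \<subseteq> carrier (G Mod N) \<and> openin T (\<Union>\<V>))"
    unfolding istopology_def FactGroup_def by (auto simp del: Union_iff)
  then show ?thesis
    by (simp add: quotient_topology_def)
qed

definition lie_quotient_kernels ::
    "('k, 'b) valued_field_scheme \<Rightarrow> ('a, 'c) monoid_scheme \<Rightarrow> 'a topology \<Rightarrow> 'a set set" where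
  "lie_quotient_kernels K G T =
     {N. N \<lhd> G \<and> closedin T N \<and> lie_group K (G Mod N) (quotient_topology G T N)}"

lemma lie_quotient_kernels_subset:
  assumes "N \<in> lie_quotient_kernels K G T"
  shows "N \<subseteq> carrier G" "\<one>\<^bsub>G\<^esub> \<in> N"
  using assms normal_imp_subgroup[of N G]
  by (auto simp: lie_quotient_kernels_def subgroup.one_closed dest: subgroup.subset)

text \<open>
  To be applied to sets of subsets of a group that contain the identity, which is the case for
  \<^const>\<open>lie_quotient_kernels\<close> by the lemma above.
\<close>

definition filter_basis :: "'a set set \<Rightarrow> bool" where
  "filter_basis \<F> \<longleftrightarrow> \<F> \<noteq> {} \<and> (\<forall>M\<in>\<F>. \<forall>N\<in>\<F>. \<exists>P\<in>\<F>. P \<subseteq> M \<inter> N)"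

end

theory Submission
  imports Defs
begin

text \<open>
  Let \<open>G\<close> be the group of integer sequences \<open>x\<close> with \<open>\<bar>x\<^sub>n\<bar> = O(n + 1)\<close>, with the topology of the norm
  \<open>sup\<^sub>n \<bar>x\<^sub>n\<bar> / (n + 1)\<close>. It is complete, but no neighbourhood of \<open>0\<close> is precompact, as the elements
  \<open>\<lfloor>\<epsilon> (n + 1)\<rfloor> e\<^sub>n\<close> are uniformly separated. Put \<open>\<beta> = 1/2\<close> over the reals and \<open>\<beta> = p\<close> over the
  p-adic numbers. The homomorphisms \<open>f x = \<Sum> x\<^sub>n \<beta>\<^sup>n\<close> and \<open>g x = f x - h x\<close>, where
  \<open>h x = \<Sum> x\<^sub>n \<beta>\<^sup>k\<close> with \<open>k = (n + 1)\<^sup>2\<close>, are continuous and open: a small scalar is expanded in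
  digits of bounded size, using late positions only, where bounded digits have small norm.
  Hence the quotients by the kernels of \<open>f\<close> and \<open>g\<close> are isomorphic to open subgroups of the scalars and
  thus Lie groups. On the intersection of the kernels \<open>h\<close> vanishes; but \<open>h\<close> is so lacunary that its
  first nonzero term dominates as long as \<open>x\<close> has norm at most \<open>1\<close>, so the intersection is discrete.
  If \<open>G / P\<close> were a Lie group for some \<open>P\<close> inside the intersection, it would be locally compact, and
  since \<open>P\<close> is discrete, so would be \<open>G\<close>.
\<close>

section \<open>Quotients of topological groups\<close>

text \<open>The entries are integers, so with a bounded weight the group would be discrete. The
  weight n + 1 tends to infinity, so that digits of bounded size become small in late positions, yet
  it grows slowly enough for the sum of (n + 1) / 2 ^ n to converge, which makes the series
  continuous. The map h cannot serve as the second homomorphism: its coefficients drop by more than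
  the factor \<beta>, so one bounded digit per position does not keep up with the remainder and the
  digit argument for openness breaks down. Subtracting h from f leaves coefficients that are still
  essentially geometric, while f - g recovers h. The exponents (n + 1)^2 are sparse enough because
  the ratio of consecutive coefficients of h, of size |\<beta>| ^ (2 n + 3), beats the polynomial
  losses: an entry of absolute value at most n + 1 may be p-adically as small as 1 / (n + 1), but
  not smaller. Every P inside the intersection is excluded at once because discreteness passes to
  subgroups. The reals and the p-adic numbers enter only through the axioms of
  \<open>digit_ring\<close>.\<close>

lemma (in group) rcosets_eq_coset_of_element:
  assumes "subgroup N G" "X \<in> rcosets N" "x \<in> X"
  shows "X = N #> x" "x \<in> carrier G"
proof -
  obtain a where a: "a \<in> carrier G" "X = N #> a"
    using assms(2) unfolding RCOSETS_def by blast
  show "X = N #> x"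
    using repr_independence[of x N a] a assms by simp
  show "x \<in> carrier G"
    using a assms(3) r_coset_subset_G[OF subgroup.subset[OF assms(1)]] by blast
qed

lemma (in group) rcosets_nonempty:
  assumes "subgroup N G" "X \<in> rcosets N"
  shows "\<exists>x. x \<in> X"
  using assms rcos_self unfolding RCOSETS_def by blast

context topological_group
begin

lemma continuous_map_translation:
  assumes "a \<in> carrier G"
  shows "continuous_map T T (\<lambda>x. a \<otimes> x)"
proof -
  have "continuous_map T (prod_topology T T) (\<lambda>x. (a, x))"
    using assms topspace_eq by (auto simp: continuous_map_paired)
  from continuous_map_compose[OF this continuous_mult] show ?thesis
    by (simp add: comp_def)
qed

lemma openin_translate:
  assumes "a \<in> carrier G" "openin T U"
  shows "openin T ((\<lambda>x. a \<otimes> x) ` U)"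
proof -
  have U: "U \<subseteq> carrier G"
    using assms openin_subset topspace_eq by blast
  have "(\<lambda>x. a \<otimes> x) ` U = {x \<in> topspace T. inv a \<otimes> x \<in> U}"
  proof safe
    fix x assume "x \<in> topspace T" "inv a \<otimes> x \<in> U"
    then show "x \<in> (\<lambda>x. a \<otimes> x) ` U"
      using assms(1) by (intro image_eqI[of _ _ "inv a \<otimes> x"]) (auto simp: topspace_eq m_assoc[symmetric])
  next
    fix x assume x: "x \<in> U"
    then have "x \<in> carrier G" using U by blast
    then show "a \<otimes> x \<in> topspace T" "inv a \<otimes> (a \<otimes> x) \<in> U"
      using assms(1) x by (auto simp: topspace_eq m_assoc[symmetric])
  qed
  then show ?thesis
    using openin_continuous_map_preimage[OF continuous_map_translation assms(2)] assms(1) by auto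
qed

text \<open>The union of these cosets is the product set of \<open>N\<close> and \<open>U\<close>, a
  union of translates of \<open>U\<close>. This is the openness of the quotient map, the source of
  open sets in the quotient throughout.\<close>

lemma openin_cosets_meeting:
  assumes N: "subgroup N G" and U: "openin T U"
  shows "openin (quotient_topology G T N) {X \<in> rcosets N. X \<inter> U \<noteq> {}}"
proof -
  have UG: "U \<subseteq> carrier G"
    using openin_subset[OF U] topspace_eq by simp
  have NG: "N \<subseteq> carrier G"
    using N by (rule subgroup.subset)
  have "\<Union>{X \<in> rcosets N. X \<inter> U \<noteq> {}} = (\<Union>n\<in>N. (\<lambda>x. n \<otimes> x) ` U)"
  proof (intro equalityI subsetI)
    fix x assume "x \<in> \<Union>{X \<in> rcosets N. X \<inter> U \<noteq> {}}"
    then obtain X u where X: "X \<in> rcosets N" "u \<in> X" "u \<in> U" "x \<in> X"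
      by blast
    have "X = N #> u"
      using rcosets_eq_coset_of_element[OF N] X by blast
    then show "x \<in> (\<Union>n\<in>N. (\<lambda>x. n \<otimes> x) ` U)"
      using X by (auto simp: r_coset_def)
  next
    fix x assume "x \<in> (\<Union>n\<in>N. (\<lambda>x. n \<otimes> x) ` U)"
    then obtain n u where nu: "n \<in> N" "u \<in> U" and x: "x = n \<otimes> u"
      by blast
    then have u: "u \<in> carrier G" using UG by blast
    have "N #> u \<in> rcosets N" "n \<otimes> u \<in> N #> u"
      using u nu(1) unfolding RCOSETS_def r_coset_def by blast+
    moreover have "u \<in> N #> u" by (rule rcos_self[OF u N])
    ultimately show "x \<in> \<Union>{X \<in> rcosets N. X \<inter> U \<noteq> {}}"
      using nu x by blast
  qed
  moreover have "openin T (\<Union>n\<in>N. (\<lambda>x. n \<otimes> x) ` U)"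
    using openin_translate NG U by blast
  ultimately show ?thesis
    by (simp add: openin_quotient_topology[OF N] FactGroup_def)
qed

lemma topspace_quotient_topology:
  assumes "subgroup N G"
  shows "topspace (quotient_topology G T N) = rcosets N"
proof -
  have "\<Union>(rcosets N) = carrier G"
    using assms by (rule rcosets_part_G)
  then have "openin (quotient_topology G T N) (rcosets N)"
    using openin_topspace[of T] by (simp add: openin_quotient_topology[OF assms] FactGroup_def topspace_eq)
  moreover have "topspace (quotient_topology G T N) \<subseteq> rcosets N"
    using openin_topspace[of "quotient_topology G T N"]
    unfolding openin_quotient_topology[OF assms] by (auto simp: FactGroup_def)
  ultimately show ?thesis
    using openin_subset by blast
qed

text \<open>Multiplication descends because the quotient map is open: neighbourhoods
  \<open>A\<close>, \<open>B\<close> of representatives are pushed to the cosets meeting them.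
  Hausdorffness is left as a hypothesis; for the kernels below it is pulled back from the scalars
  along the chart.\<close>

lemma topological_group_quotient:
  assumes N: "N \<lhd> G" and H: "Hausdorff_space (quotient_topology G T N)"
  shows "topological_group (G Mod N) (quotient_topology G T N)"
proof -
  let ?Q = "quotient_topology G T N"
  interpret N: normal N G by (fact N)
  note sg = N.subgroup_axioms
  interpret Q: group "G Mod N" by (rule N.factorgroup_is_group)
  note top = topspace_quotient_topology[OF sg]
  note op = openin_quotient_topology[OF sg]
  have car: "carrier (G Mod N) = rcosets N" by (simp add: FactGroup_def)
  have mult: "X \<otimes>\<^bsub>G Mod N\<^esub> Y = X <#> Y" for X Y by (simp add: FactGroup_def)
  note coset = rcosets_eq_coset_of_element[OF sg] and ex = rcosets_nonempty[OF sg]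
  have self: "x \<in> N #> x" if "x \<in> carrier G" for x
    using rcos_self[OF that sg] .
  have cl: "N #> x \<in> rcosets N" if "x \<in> carrier G" for x
    using that unfolding RCOSETS_def by blast
  show ?thesis
  proof
    show "topspace ?Q = carrier (G Mod N)" by (simp add: top car)
    show "Hausdorff_space ?Q" by (fact H)
    show "continuous_map (prod_topology ?Q ?Q) ?Q (\<lambda>(X, Y). X \<otimes>\<^bsub>G Mod N\<^esub> Y)"
      unfolding continuous_map_def
    proof (intro conjI allI impI)
      show "(\<lambda>(X, Y). X \<otimes>\<^bsub>G Mod N\<^esub> Y) \<in> topspace (prod_topology ?Q ?Q) \<rightarrow> topspace ?Q"
        using Q.m_closed by (auto simp: top car)
      fix \<V> assume V: "openin ?Q \<V>"
      show "openin (prod_topology ?Q ?Q)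
              {z \<in> topspace (prod_topology ?Q ?Q). (case z of (X, Y) \<Rightarrow> X \<otimes>\<^bsub>G Mod N\<^esub> Y) \<in> \<V>}"
        unfolding openin_prod_topology_alt
      proof (intro allI impI)
        fix X Y
        assume "(X, Y) \<in> {z \<in> topspace (prod_topology ?Q ?Q). (case z of (X, Y) \<Rightarrow> X \<otimes>\<^bsub>G Mod N\<^esub> Y) \<in> \<V>}"
        then have X: "X \<in> rcosets N" and Y: "Y \<in> rcosets N" and XY: "X <#> Y \<in> \<V>"
          by (auto simp: top mult)
        obtain x y where x: "x \<in> X" and y: "y \<in> Y" using ex X Y by blast
        note x' = coset[OF X x] and y' = coset[OF Y y]
        have "X <#> Y = N #> (x \<otimes> y)"
          using N.rcos_sum x' y' by simp
        then have "x \<otimes> y \<in> \<Union>\<V>"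
          using self[of "x \<otimes> y"] x' y' XY by auto
        then have "(x, y) \<in> {z \<in> topspace (prod_topology T T). (case z of (x, y) \<Rightarrow> x \<otimes> y) \<in> \<Union>\<V>}"
          using x' y' by (auto simp: topspace_eq)
        moreover have "openin (prod_topology T T)
            {z \<in> topspace (prod_topology T T). (case z of (x, y) \<Rightarrow> x \<otimes> y) \<in> \<Union>\<V>}"
          using V op by (intro openin_continuous_map_preimage[OF continuous_mult]) auto
        ultimately have "\<exists>A B. openin T A \<and> openin T B \<and> x \<in> A \<and> y \<in> B \<and>
            A \<times> B \<subseteq> {z \<in> topspace (prod_topology T T). (case z of (x, y) \<Rightarrow> x \<otimes> y) \<in> \<Union>\<V>}"
          by (simp only: openin_prod_topology_alt)
        then obtain A B where AB: "openin T A" "openin T B" "x \<in> A" "y \<in> B"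
            "A \<times> B \<subseteq> {z \<in> topspace (prod_topology T T). (case z of (x, y) \<Rightarrow> x \<otimes> y) \<in> \<Union>\<V>}"
          by (elim exE conjE)
        let ?A = "{X \<in> rcosets N. X \<inter> A \<noteq> {}}" and ?B = "{X \<in> rcosets N. X \<inter> B \<noteq> {}}"
        have "X' <#> Y' \<in> \<V>" if X'Y': "X' \<in> ?A" "Y' \<in> ?B" for X' Y'
        proof -
          obtain a b where ab: "a \<in> X'" "a \<in> A" "b \<in> Y'" "b \<in> B" "X' \<in> rcosets N" "Y' \<in> rcosets N"
            using X'Y' by blast
          have a: "X' = N #> a" "a \<in> carrier G" and b: "Y' = N #> b" "b \<in> carrier G"
            using coset[of X' a] coset[of Y' b] ab by simp_all
          have "a \<otimes> b \<in> \<Union>\<V>" using subsetD[OF AB(5), of "(a, b)"] ab by simp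
          then obtain Z where Z: "Z \<in> \<V>" "a \<otimes> b \<in> Z" by (elim UnionE)
          then have "Z = N #> (a \<otimes> b)" using V op car coset(1)[of Z "a \<otimes> b"] by blast
          then show ?thesis using Z a b N.rcos_sum by simp
        qed
        moreover have "X \<in> ?A" "Y \<in> ?B" using X Y x y AB by auto
        ultimately show "\<exists>U V. openin ?Q U \<and> openin ?Q V \<and> X \<in> U \<and> Y \<in> V \<and> U \<times> V \<subseteq>
            {z \<in> topspace (prod_topology ?Q ?Q). (case z of (X, Y) \<Rightarrow> X \<otimes>\<^bsub>G Mod N\<^esub> Y) \<in> \<V>}"
          using openin_cosets_meeting[OF sg AB(1)] openin_cosets_meeting[OF sg AB(2)]
          by (intro exI[of _ ?A] exI[of _ ?B]) (auto simp: top mult)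
      qed
    qed
    show "continuous_map ?Q ?Q (\<lambda>X. inv\<^bsub>G Mod N\<^esub> X)"
      unfolding continuous_map_def
    proof (intro conjI allI impI)
      show "(\<lambda>X. inv\<^bsub>G Mod N\<^esub> X) \<in> topspace ?Q \<rightarrow> topspace ?Q"
        using Q.inv_closed by (auto simp: top car)
      fix \<V> assume V: "openin ?Q \<V>"
      let ?S = "{X \<in> topspace ?Q. inv\<^bsub>G Mod N\<^esub> X \<in> \<V>}"
      \<comment> \<open>A set of cosets is open exactly if its union is, so continuity of inversion
        on the quotient reduces to that of inversion on \<open>G\<close>.\<close>
      have "\<Union>?S = {x \<in> topspace T. inv x \<in> \<Union>\<V>}"
      proof safe
        fix x X assume X: "x \<in> X" "X \<in> topspace ?Q" "inv\<^bsub>G Mod N\<^esub> X \<in> \<V>"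
        then have x: "X = N #> x" "x \<in> carrier G" using coset top by auto
        then have "inv\<^bsub>G Mod N\<^esub> X = N #> inv x"
          using X by (simp add: N.inv_FactGroup car top N.rcos_inv)
        then show "inv x \<in> \<Union>\<V>" using X self[of "inv x"] x by auto
        show "x \<in> topspace T" using x topspace_eq by simp
      next
        fix x Z assume x: "x \<in> topspace T" and Z: "inv x \<in> Z" "Z \<in> \<V>"
        then have xG: "x \<in> carrier G" by (simp add: topspace_eq)
        have "Z \<in> rcosets N" using V op car Z by auto
        then have "Z = N #> inv x" using Z coset by auto
        moreover have "inv\<^bsub>G Mod N\<^esub> (N #> x) = N #> inv x"
          using xG cl by (simp add: N.inv_FactGroup car N.rcos_inv)
        ultimately show "x \<in> \<Union>?S"
          using Z self[OF xG] cl[OF xG] top by auto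
      qed
      moreover have "openin T {x \<in> topspace T. inv x \<in> \<Union>\<V>}"
        using V op by (intro openin_continuous_map_preimage[OF continuous_inv]) auto
      ultimately show "openin ?Q ?S"
        using top op car by auto
    qed
  qed
qed

end

section \<open>Lie quotients by kernels of open homomorphisms to the scalars\<close>

text \<open>Identifies a scalar with a point of \<open>affine_space K 1\<close>, whose points are
  extensional functions on \<open>{..<1}\<close>.\<close>

definition line :: "'a \<Rightarrow> nat \<Rightarrow> 'a" where
  "line a = (\<lambda>i\<in>{..<1}. a)"

lemma line_0 [simp]: "line a 0 = a"
  by (simp add: line_def)

lemma line_eq_iff [simp]: "line a = line b \<longleftrightarrow> a = b"
  by (metis line_0)

locale valued_ring = cring K for K :: "('k, 'b) valued_field_scheme" (structure) +
  assumes absval_nonneg: "x \<in> carrier K \<Longrightarrow> 0 \<le> absval K x"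
    and absval_eq_0_iff: "x \<in> carrier K \<Longrightarrow> absval K x = 0 \<longleftrightarrow> x = \<zero>"
    and absval_mult: "x \<in> carrier K \<Longrightarrow> y \<in> carrier K \<Longrightarrow> absval K (x \<otimes> y) = absval K x * absval K y"
    and absval_add: "x \<in> carrier K \<Longrightarrow> y \<in> carrier K \<Longrightarrow> absval K (x \<oplus> y) \<le> absval K x + absval K y"
    and absval_a_inv: "x \<in> carrier K \<Longrightarrow> absval K (\<ominus> x) = absval K x"
begin

lemma minus_eq_zero_iff:
  assumes "x \<in> carrier K" "y \<in> carrier K"
  shows "x \<ominus> y = \<zero> \<longleftrightarrow> x = y"
proof
  assume "x \<ominus> y = \<zero>"
  then show "x = y"
    using minus_equality[of x "\<ominus> y"] assms by (simp add: a_minus_def)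
qed (use assms in \<open>simp add: a_minus_def r_neg\<close>)

lemma absval_zero: "absval K \<zero> = 0"
  by (simp add: absval_eq_0_iff)

lemma absval_diff_commute:
  assumes "x \<in> carrier K" "y \<in> carrier K"
  shows "absval K (x \<ominus> y) = absval K (y \<ominus> x)"
proof -
  have "\<ominus> (x \<ominus> y) = y \<ominus> x"
    using assms by (simp add: a_minus_def minus_add a_comm)
  then show ?thesis
    using absval_a_inv[of "x \<ominus> y"] assms by simp
qed

lemma absval_diff_triangle:
  assumes "x \<in> carrier K" "y \<in> carrier K" "z \<in> carrier K"
  shows "absval K (x \<ominus> z) \<le> absval K (x \<ominus> y) + absval K (y \<ominus> z)"
proof -
  have "x \<ominus> z = (x \<ominus> y) \<oplus> (y \<ominus> z)"
    using assms by (simp add: a_minus_def a_ac r_neg r_neg1 r_neg2)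
  then show ?thesis
    using absval_add[of "x \<ominus> y" "y \<ominus> z"] assms by simp
qed

lemma Metric_space_field_dist: "Metric_space (carrier K) (field_dist K)"
proof
  show "0 \<le> field_dist K x y" for x y
    by (simp add: field_dist_def absval_nonneg)
  show "field_dist K x y = field_dist K y x" for x y
    by (simp add: field_dist_def absval_diff_commute)
  show "field_dist K x y = 0 \<longleftrightarrow> x = y" if "x \<in> carrier K" "y \<in> carrier K" for x y
    using that by (simp add: field_dist_def absval_eq_0_iff minus_eq_zero_iff)
  show "field_dist K x z \<le> field_dist K x y + field_dist K y z"
    if "x \<in> carrier K" "y \<in> carrier K" "z \<in> carrier K" for x y z
    using that by (simp add: field_dist_def absval_diff_triangle)
qed

sublocale metric: Metric_space "carrier K" "field_dist K"
  by (rule Metric_space_field_dist)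

lemma topspace_field_topology: "topspace (field_topology K) = carrier K"
  by (simp add: field_topology_def)

lemma Hausdorff_field_topology: "Hausdorff_space (field_topology K)"
  by (simp add: field_topology_def metric.Hausdorff_space_mtopology)

lemma topspace_affine_space: "topspace (affine_space K n) = {..<n} \<rightarrow>\<^sub>E carrier K"
  by (simp add: affine_space_def topspace_field_topology)

text \<open>Around \<open>a\<close> a linear form is f a + sum of l i (x i - a i), a power series
  supported on the finite set \<open>S\<close> of multi-indices of degree at most one. The net of
  its finite partial sums is therefore constant as soon as the index set contains \<open>S\<close>,
  and the radius can be taken to be 1.\<close>

lemma analytic_at_point_linear:
  assumes l: "\<And>i. i < n \<Longrightarrow> l i \<in> carrier K"
    and D: "D \<subseteq> topspace (affine_space K n)" and a: "a \<in> D"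
    and f: "\<And>x. x \<in> D \<Longrightarrow> f x = (\<Oplus>i\<in>{..<n}. l i \<otimes> x i)"
  shows "analytic_at_point K n D f a"
proof -
  define e :: "nat \<Rightarrow> nat \<Rightarrow> nat" where "e i = (\<lambda>j. if i = j then 1 else 0)" for i
  define S where "S = insert (\<lambda>_. 0) (e ` {..<n})"
  define c where "c \<alpha> = (if \<alpha> = (\<lambda>_. 0) then f a
      else if \<alpha> \<in> e ` {..<n} then l (inv_into {..<n} e \<alpha>) else \<zero>)" for \<alpha>
  have inj: "inj_on e A" for A
    by (auto simp: inj_on_def e_def fun_eq_iff split: if_splits)
  have e0: "e i \<noteq> (\<lambda>_. 0)" for i
    by (auto simp: e_def fun_eq_iff)
  have ce: "c (e i) = l i" if "i < n" for i
    using that e0 inj by (simp add: c_def)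
  have c0: "c \<alpha> = \<zero>" if "\<alpha> \<notin> S" for \<alpha>
    using that by (auto simp: c_def S_def)
  have car: "x i \<in> carrier K" if "x \<in> D" "i < n" for x i
    using D that by (auto simp: topspace_affine_space)
  have fc: "f x \<in> carrier K" if "x \<in> D" for x
    using f[OF that] car[OF that] l by (auto intro!: finsum_closed)
  have cc: "c \<alpha> \<in> carrier K" for \<alpha>
    using fc[OF a] l ce by (auto simp: c_def inj)
  have SM: "S \<subseteq> multi_indices n"
    by (auto simp: S_def multi_indices_def e_def)
  have term_closed: "power_series_term K n c a x \<alpha> \<in> carrier K" if "x \<in> D" for x \<alpha>
    unfolding power_series_term_def using that car a cc by (intro m_closed finprod_closed) auto
  have sum_eq: "finsum K (power_series_term K n c a x) F = f x"
    if x: "x \<in> D" and F: "finite F" "S \<subseteq> F" for x F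
  proof -
    let ?t = "power_series_term K n c a x"
    have "finsum K ?t F = finsum K ?t S"
    proof (rule add.finprod_mono_neutral_cong_right[OF F])
      show "?t \<alpha> = \<zero>" if "\<alpha> \<in> F - S" for \<alpha>
        unfolding power_series_term_def using that c0 car x a
        by (subst c0) (auto intro!: l_null finprod_closed)
    qed (use term_closed x in auto)
    also have "\<dots> = ?t (\<lambda>_. 0) \<oplus> finsum K ?t (e ` {..<n})"
      unfolding S_def using e0[symmetric] term_closed x by (intro finsum_insert) (auto simp: image_iff)
    also have "?t (\<lambda>_. 0) = f a"
      using fc[OF a] car x a by (simp add: power_series_term_def c_def)
    also have "finsum K ?t (e ` {..<n}) = (\<Oplus>i\<in>{..<n}. ?t (e i))"
      using term_closed x inj by (intro finsum_reindex) auto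
    also have "\<dots> = (\<Oplus>i\<in>{..<n}. l i \<otimes> x i \<oplus> \<ominus> (l i \<otimes> a i))"
    proof (rule finsum_cong')
      fix i assume "i \<in> {..<n}"
      then have i: "i < n" by simp
      have "finprod K (\<lambda>j. (x j \<ominus> a j) [^] e i j) {..<n} =
            finprod K (\<lambda>j. if i = j then x j \<ominus> a j else \<one>) {..<n}"
        using car x a by (intro finprod_cong') (auto simp: e_def)
      also have "\<dots> = x i \<ominus> a i"
        using car x a i by (intro finprod_singleton) auto
      finally show "?t (e i) = l i \<otimes> x i \<oplus> \<ominus> (l i \<otimes> a i)"
        using i l[OF i] car x a ce[OF i]
        by (simp add: power_series_term_def a_minus_def r_distr r_minus)
    qed (use car x a l in auto)
    also have "\<dots> = (\<Oplus>i\<in>{..<n}. l i \<otimes> x i) \<oplus> (\<Oplus>i\<in>{..<n}. \<ominus> (l i \<otimes> a i))"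
      using car x a l by (intro finsum_addf) auto
    finally have eq: "finsum K ?t F = f a \<oplus> (f x \<oplus> (\<Oplus>i\<in>{..<n}. \<ominus> (l i \<otimes> a i)))"
      using f[OF x] by simp
    \<comment> \<open>The constant coefficient f a is cancelled by the constants coming from
      expanding the factors x i - a i.\<close>
    have "f a \<oplus> (\<Oplus>i\<in>{..<n}. \<ominus> (l i \<otimes> a i)) = (\<Oplus>i\<in>{..<n}. l i \<otimes> a i \<oplus> \<ominus> (l i \<otimes> a i))"
      unfolding f[OF a] using car a l by (intro finsum_addf[symmetric]) auto
    also have "\<dots> = (\<Oplus>i\<in>{..<n}. \<zero>)"
      using car a l by (intro finsum_cong') (auto simp: r_neg)
    also have "\<dots> = \<zero>"
      by simp
    finally have z: "f a \<oplus> (\<Oplus>i\<in>{..<n}. \<ominus> (l i \<otimes> a i)) = \<zero>" .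
    have "(\<Oplus>i\<in>{..<n}. \<ominus> (l i \<otimes> a i)) \<in> carrier K"
      using car a l by (intro finsum_closed) auto
    then show ?thesis
      unfolding eq using fc[OF a] fc[OF x] z a_lcomm[of "f a" "f x"] by simp
  qed
  have fin: "finite S" by (simp add: S_def)
  have "(\<lambda>\<alpha>. absval K (c \<alpha>) * 1 ^ (\<Sum>i<n. \<alpha> i)) summable_on multi_indices n \<longleftrightarrow>
        (\<lambda>\<alpha>. absval K (c \<alpha>) * 1 ^ (\<Sum>i<n. \<alpha> i)) summable_on S"
    using SM by (intro summable_on_cong_neutral) (auto simp: c0 absval_zero)
  then have summ: "(\<lambda>\<alpha>. absval K (c \<alpha>) * 1 ^ (\<Sum>i<n. \<alpha> i)) summable_on multi_indices n"
    using fin by simp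
  have "limitin (field_topology K) (\<lambda>F. finsum K (power_series_term K n c a x) F) (f x)
            (finite_subsets_at_top (multi_indices n))" if x: "x \<in> D" for x
  proof (rule limitin_eventually)
    show "f x \<in> topspace (field_topology K)"
      using fc x by (simp add: topspace_field_topology)
    show "\<forall>\<^sub>F F in finite_subsets_at_top (multi_indices n).
            finsum K (power_series_term K n c a x) F = f x"
      unfolding eventually_finite_subsets_at_top using fin SM sum_eq[OF x] by blast
  qed
  then show ?thesis
    unfolding analytic_at_point_def using summ cc by (intro exI[of _ c] exI[of _ 1]) auto
qed

lemma continuous_map_line:
  "continuous_map (field_topology K) (affine_space K 1) line"
  unfolding affine_space_def by (auto simp: continuous_map_componentwise line_def)

lemma continuous_map_coordinate:
  "i < n \<Longrightarrow> continuous_map (affine_space K n) (field_topology K) (\<lambda>x. x i)"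
  unfolding affine_space_def by (rule continuous_map_product_projection) simp

lemma openin_affine_line:
  assumes "openin (field_topology K) V"
  shows "openin (affine_space K 1) (line ` V)"
proof -
  have "V \<subseteq> carrier K"
    using openin_subset[OF assms] by (simp add: topspace_field_topology)
  then have "line ` V = {x \<in> topspace (affine_space K 1). x 0 \<in> V}"
    by (auto simp: topspace_affine_space image_iff PiE_iff extensional_def fun_eq_iff line_def intro!: bexI)
  then show ?thesis
    using openin_continuous_map_preimage[OF continuous_map_coordinate assms, of 0 1] by simp
qed

text \<open>In the single chart used below, the transition map, multiplication and inversion read as
  x, x + y and - x. All three are linear forms, so this one criterion covers every analyticity
  condition of a Lie group.\<close>

lemma analytic_map_line_linear:
  assumes E: "openin (affine_space K n) E"
    and g: "\<And>z. z \<in> E \<Longrightarrow> g z = line (h z)"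
    and l: "\<And>i. i < n \<Longrightarrow> l i \<in> carrier K"
    and h: "\<And>z. z \<in> E \<Longrightarrow> h z = (\<Oplus>i\<in>{..<n}. l i \<otimes> z i)"
  shows "analytic_map K n 1 E g"
  unfolding analytic_map_def
proof (intro conjI ballI allI impI)
  have sub: "E \<subseteq> topspace (affine_space K n)"
    using E by (rule openin_subset)
  show "g \<in> E \<rightarrow> topspace (affine_space K 1)"
  proof
    fix z assume z: "z \<in> E"
    then have "h z \<in> carrier K"
      using sub l h by (auto simp: topspace_affine_space intro!: finsum_closed)
    then show "g z \<in> topspace (affine_space K 1)"
      using g[OF z] by (auto simp: topspace_affine_space line_def)
  qed
  fix a j assume "a \<in> E" "j < (1::nat)"
  then show "analytic_at_point K n E (\<lambda>x. g x j) a"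
    using sub l g h by (intro analytic_at_point_linear[of n l]) auto
qed (fact E)

text \<open>A continuous open homomorphism induces a topological isomorphism from the quotient by
  its kernel onto its image, an open subgroup of \<open>K\<close>. That isomorphism, composed with
  \<open>line\<close>, is a global chart, and it alone forms the atlas.\<close>

proposition kernel_in_lie_quotient_kernels:
  assumes "topological_group G T" "comm_group G"
    and fc: "f \<in> carrier G \<rightarrow> carrier K"
    and fm: "\<And>x y. x \<in> carrier G \<Longrightarrow> y \<in> carrier G \<Longrightarrow> f (x \<otimes>\<^bsub>G\<^esub> y) = f x \<oplus> f y"
    and cont: "continuous_map T (field_topology K) f"
    and opn: "open_map T (field_topology K) f"
  shows "{x \<in> carrier G. f x = \<zero>} \<in> lie_quotient_kernels K G T"
proof -
  \<comment> \<open>Keeps \<open>1\<close> from being rewritten to \<open>Suc 0\<close>, so that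
    facts about \<open>affine_space K 1\<close> and \<open>{..<1 + 1}\<close> still match.\<close>
  note One_nat_def [simp del]
  have lessThan_1: "{..<1::nat} = {0}" and lessThan_2: "{..<1 + 1::nat} = {0, 1}"
    by (auto simp: One_nat_def)
  interpret G: topological_group G T by fact
  interpret Gc: comm_group G by fact
  define N where "N = {x \<in> carrier G. f x = \<zero>}"
  let ?Q = "quotient_topology G T N"
  have fcl: "f x \<in> carrier K" if "x \<in> carrier G" for x
    using fc that by blast
  have f1: "f \<one>\<^bsub>G\<^esub> = \<zero>"
    using fm[of "\<one>\<^bsub>G\<^esub>" "\<one>\<^bsub>G\<^esub>"] fcl[of "\<one>\<^bsub>G\<^esub>"]
      r_neg1[of "f \<one>\<^bsub>G\<^esub>" "f \<one>\<^bsub>G\<^esub>"] by (simp add: l_neg)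
  have finv: "f (inv\<^bsub>G\<^esub> x) = \<ominus> f x" if "x \<in> carrier G" for x
    using fm[of "inv\<^bsub>G\<^esub> x" x] fcl f1 that by (intro minus_equality[symmetric]) auto
  have sg: "subgroup N G"
    unfolding N_def by (rule G.subgroupI) (auto simp: fm finv f1 fcl intro: exI[of _ "\<one>\<^bsub>G\<^esub>"])
  have N: "N \<lhd> G"
    by (rule Gc.normal_iff_subgroup[THEN iffD2, OF sg])
  have NI: "x \<in> N" if "x \<in> carrier G" "f x = \<zero>" for x
    using that by (simp add: N_def)
  have ND: "f x = \<zero>" if "x \<in> N" for x
    using that by (simp add: N_def)
  interpret NG: normal N G by (rule N)
  note coset = G.rcosets_eq_coset_of_element[OF sg] and ex = G.rcosets_nonempty[OF sg]
  have top: "topspace ?Q = rcosets\<^bsub>G\<^esub> N"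
    by (rule G.topspace_quotient_topology[OF sg])
  have op: "openin ?Q \<V> \<longleftrightarrow> \<V> \<subseteq> rcosets\<^bsub>G\<^esub> N \<and> openin T (\<Union>\<V>)" for \<V>
    unfolding G.openin_quotient_topology[OF sg] by (simp add: FactGroup_def)
  have cl: "N #>\<^bsub>G\<^esub> x \<in> rcosets\<^bsub>G\<^esub> N" if "x \<in> carrier G" for x
    using that unfolding RCOSETS_def by blast
  have self: "x \<in> N #>\<^bsub>G\<^esub> x" if "x \<in> carrier G" for x
    using G.rcos_self[OF that sg] .
  have closed: "closedin T N"
  proof -
    have "closedin (field_topology K) {\<zero>}"
      by (rule closedin_t1_singleton[OF Hausdorff_imp_t1_space[OF Hausdorff_field_topology]])
        (simp add: topspace_field_topology)
    moreover have "N = {x \<in> topspace T. f x \<in> {\<zero>}}"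
      unfolding N_def G.topspace_eq by blast
    ultimately show ?thesis
      using closedin_continuous_map_preimage[OF cont] by blast
  qed
  \<comment> \<open>The value is read off a chosen representative; as \<open>f\<close> vanishes on
    \<open>N\<close>, all representatives of a coset give the same value.\<close>
  define \<phi> where "\<phi> X = line (f (SOME x. x \<in> X))" for X
  have \<phi>: "\<phi> X = line (f x)" if X: "X \<in> rcosets\<^bsub>G\<^esub> N" "x \<in> X" for X x
  proof -
    let ?y = "SOME x. x \<in> X"
    have "?y \<in> X" using X(2) by (rule someI)
    then obtain n where n: "n \<in> N" "?y = n \<otimes>\<^bsub>G\<^esub> x"
      using coset(1)[OF X] by (auto simp: r_coset_def)
    then have "f ?y = f x"
      using fm[of n x] coset(2)[OF X] fcl[of x] ND[of n] NG.subset by auto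
    then show ?thesis by (simp add: \<phi>_def)
  qed
  have f_eq: "N #>\<^bsub>G\<^esub> x = N #>\<^bsub>G\<^esub> y"
    if "f x = f y" "x \<in> carrier G" "y \<in> carrier G" for x y
  proof -
    have "f (x \<otimes>\<^bsub>G\<^esub> inv\<^bsub>G\<^esub> y) = \<zero>"
      using that fcl by (simp add: fm finv r_neg)
    then have "x \<otimes>\<^bsub>G\<^esub> inv\<^bsub>G\<^esub> y \<in> N" using that by (intro NI) auto
    moreover have "x = (x \<otimes>\<^bsub>G\<^esub> inv\<^bsub>G\<^esub> y) \<otimes>\<^bsub>G\<^esub> y"
      using that by (simp add: G.m_assoc)
    ultimately have "x \<in> N #>\<^bsub>G\<^esub> y"
      unfolding r_coset_def by blast
    then show ?thesis
      using coset(1)[OF cl] that by blast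
  qed
  have \<phi>_coset: "\<phi> (N #>\<^bsub>G\<^esub> x) = line (f x)" if "x \<in> carrier G" for x
    using \<phi>[OF cl self] that by blast
  have \<phi>_inj: "inj_on \<phi> (rcosets\<^bsub>G\<^esub> N)"
  proof (rule inj_onI)
    fix X Y assume X: "X \<in> rcosets\<^bsub>G\<^esub> N" and Y: "Y \<in> rcosets\<^bsub>G\<^esub> N" and eq: "\<phi> X = \<phi> Y"
    obtain x y where x: "x \<in> X" and y: "y \<in> Y" using ex X Y by blast
    have "f x = f y"
      using eq \<phi>[OF X x] \<phi>[OF Y y] by simp
    then show "X = Y"
      using f_eq[of x y] coset[OF X x] coset[OF Y y] \<open>f x = f y\<close> by (metis (no_types))
  qed
  define D where "D = line ` f ` carrier G"
  have \<phi>_img: "\<phi> ` \<V> = line ` f ` \<Union>\<V>" if V: "\<V> \<subseteq> rcosets\<^bsub>G\<^esub> N" for \<V>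
  proof (intro equalityI subsetI)
    fix z assume "z \<in> \<phi> ` \<V>"
    then obtain X where X: "X \<in> \<V>" "z = \<phi> X" by blast
    moreover obtain x where "x \<in> X" using ex[of X] V X(1) by auto
    ultimately show "z \<in> line ` f ` \<Union>\<V>" using \<phi>[of X] V X by blast
  next
    fix z assume "z \<in> line ` f ` \<Union>\<V>"
    then obtain x X where "z = line (f x)" "x \<in> X" "X \<in> \<V>" by blast
    then show "z \<in> \<phi> ` \<V>" using \<phi>[of X x] V by (intro image_eqI[of _ _ X]) auto
  qed
  have UN: "\<Union>(rcosets\<^bsub>G\<^esub> N) = carrier G"
    using sg by (rule G.rcosets_part_G)
  have img: "\<phi> ` (rcosets\<^bsub>G\<^esub> N) = D"
    using \<phi>_img[of "rcosets\<^bsub>G\<^esub> N"] UN by (simp add: D_def)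
  have line_open: "openin (affine_space K 1) (line ` f ` U)" if "openin T U" for U
    using opn that openin_affine_line by (auto simp: open_map_def)
  have D_open: "openin (affine_space K 1) D"
    unfolding D_def using line_open openin_topspace[of T] by (simp add: G.topspace_eq)
  have cont_\<phi>: "continuous_map ?Q (affine_space K 1) \<phi>"
    unfolding continuous_map_def
  proof (intro conjI allI impI)
    show "\<phi> \<in> topspace ?Q \<rightarrow> topspace (affine_space K 1)"
      using img openin_subset[OF D_open] by (auto simp: top)
    fix V assume V: "openin (affine_space K 1) V"
    have "\<Union>{X \<in> topspace ?Q. \<phi> X \<in> V} = {x \<in> topspace T. line (f x) \<in> V}"
    proof (intro equalityI subsetI)
      fix x assume "x \<in> \<Union>{X \<in> topspace ?Q. \<phi> X \<in> V}"
      then obtain X where "X \<in> rcosets\<^bsub>G\<^esub> N" "\<phi> X \<in> V" "x \<in> X" by (auto simp: top)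
      then show "x \<in> {x \<in> topspace T. line (f x) \<in> V}"
        using \<phi>[of X x] coset(2)[of X x] by (simp add: G.topspace_eq)
    next
      fix x assume x: "x \<in> {x \<in> topspace T. line (f x) \<in> V}"
      then have "x \<in> carrier G" by (simp add: G.topspace_eq)
      then show "x \<in> \<Union>{X \<in> topspace ?Q. \<phi> X \<in> V}"
        using x cl[of x] self[of x] \<phi>_coset[of x] top by (intro UnionI[of "N #>\<^bsub>G\<^esub> x"]) auto
    qed
    moreover have "openin T {x \<in> topspace T. (line \<circ> f) x \<in> V}"
      by (rule openin_continuous_map_preimage[OF continuous_map_compose[OF cont continuous_map_line] V])
    ultimately show "openin ?Q {X \<in> topspace ?Q. \<phi> X \<in> V}"
      unfolding op by (auto simp: top)
  qed
  have homeo: "homeomorphic_map ?Q (subtopology (affine_space K 1) D) \<phi>"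
  proof (rule bijective_open_imp_homeomorphic_map)
    show "continuous_map ?Q (subtopology (affine_space K 1) D) \<phi>"
      using cont_\<phi> img by (auto simp: continuous_map_in_subtopology top)
    show "open_map ?Q (subtopology (affine_space K 1) D) \<phi>"
      unfolding open_map_def
    proof (intro allI impI)
      fix \<V> assume "openin ?Q \<V>"
      then have V: "\<V> \<subseteq> rcosets\<^bsub>G\<^esub> N" "openin T (\<Union>\<V>)" by (auto simp: op)
      then have "openin (affine_space K 1) (\<phi> ` \<V>)" using \<phi>_img line_open by simp
      moreover have "\<phi> ` \<V> \<subseteq> D" using V img by blast
      ultimately show "openin (subtopology (affine_space K 1) D) (\<phi> ` \<V>)"
        by (simp add: openin_open_subtopology[OF D_open])
    qed
    show "\<phi> ` topspace ?Q = topspace (subtopology (affine_space K 1) D)"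
      using img openin_subset[OF D_open] by (auto simp: top)
    show "inj_on \<phi> (topspace ?Q)"
      using \<phi>_inj by (simp add: top)
  qed
  have "Hausdorff_space (affine_space K 1)"
    by (simp add: affine_space_def Hausdorff_space_product_topology Hausdorff_field_topology)
  then have haus: "Hausdorff_space ?Q"
    using homeomorphic_map_imp_homeomorphic_space[OF homeo] homeomorphic_Hausdorff_space
      Hausdorff_space_subtopology by blast
  have tg: "topological_group (G Mod N) ?Q"
    by (rule G.topological_group_quotient[OF N haus])
  let ?U = "rcosets\<^bsub>G\<^esub> N"
  have inv_\<phi>: "inv_into ?U \<phi> (line (f x)) = N #>\<^bsub>G\<^esub> x" if "x \<in> carrier G" for x
    using inv_into_f_f[OF \<phi>_inj cl[OF that]] \<phi>_coset[OF that] by simp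
  have DE: "\<exists>x\<in>carrier G. z = line (f x)" if "z \<in> D" for z
    using that by (auto simp: D_def)
  have chart: "chart_on K 1 ?Q (?U, \<phi>)"
    using homeo img D_open openin_topspace[of ?Q] subtopology_topspace[of ?Q]
    by (simp add: chart_on_def top)
  have D0: "z 0 \<in> carrier K" if "z \<in> D" for z
    using DE[OF that] fcl by auto
  have atlas: "analytic_atlas K 1 ?Q {(?U, \<phi>)}"
  proof -
    have "analytic_map K 1 1 D (\<lambda>x. \<phi> (inv_into ?U \<phi> x))"
    proof (rule analytic_map_line_linear[where l = "\<lambda>_. \<one>" and h = "\<lambda>z. z 0", OF D_open])
      show "\<phi> (inv_into ?U \<phi> z) = line (z 0)" if "z \<in> D" for z
        using DE[OF that] inv_\<phi> \<phi>_coset by auto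
    qed (use D0 in \<open>auto simp: lessThan_1\<close>)
    then show ?thesis
      using chart img by (simp add: analytic_atlas_def top)
  qed
  have mult: "analytic_mult_in_charts K 1 (G Mod N) (?U, \<phi>) (?U, \<phi>) (?U, \<phi>)"
  proof -
    let ?\<mu> = "\<lambda>z. inv_into ?U \<phi> (first_half 1 z) \<otimes>\<^bsub>G Mod N\<^esub> inv_into ?U \<phi> (second_half 1 z)"
    let ?E = "{z \<in> topspace (affine_space K (1 + 1)).
             first_half 1 z \<in> \<phi> ` ?U \<and> second_half 1 z \<in> \<phi> ` ?U \<and> ?\<mu> z \<in> ?U}"
    have fh: "first_half 1 z = line (z 0)" "second_half 1 z = line (z 1)" for z :: "nat \<Rightarrow> 'k"
      by (auto simp: first_half_def second_half_def restrict_def fun_eq_iff line_def)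
    have lineD: "line a \<in> D \<longleftrightarrow> a \<in> f ` carrier G" for a
      unfolding D_def by auto
    have \<mu>: "?\<mu> z = N #>\<^bsub>G\<^esub> (x \<otimes>\<^bsub>G\<^esub> y)"
      if "x \<in> carrier G" "y \<in> carrier G" "z 0 = f x" "z 1 = f y" for x y z
      using that inv_\<phi> NG.rcos_sum by (simp add: fh FactGroup_def)
    \<comment> \<open>Written as an intersection of coordinate preimages of the image of
      \<open>f\<close>, the domain is visibly open, as \<open>analytic_map\<close> demands.\<close>
    have E: "?E = {z \<in> topspace (affine_space K (1 + 1)). z 0 \<in> f ` carrier G} \<inter>
        {z \<in> topspace (affine_space K (1 + 1)). z 1 \<in> f ` carrier G}"
    proof (intro equalityI subsetI)
      fix z assume "z \<in> ?E"
      then show "z \<in> {z \<in> topspace (affine_space K (1 + 1)). z 0 \<in> f ` carrier G} \<inter>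
        {z \<in> topspace (affine_space K (1 + 1)). z 1 \<in> f ` carrier G}"
        using lineD by (simp only: img fh) blast
    next
      fix z assume z: "z \<in> {z \<in> topspace (affine_space K (1 + 1)). z 0 \<in> f ` carrier G} \<inter>
        {z \<in> topspace (affine_space K (1 + 1)). z 1 \<in> f ` carrier G}"
      then obtain x y where xy: "x \<in> carrier G" "y \<in> carrier G" "z 0 = f x" "z 1 = f y"
        by blast
      have "?\<mu> z \<in> ?U"
        using \<mu>[of x y z, OF xy] cl[of "x \<otimes>\<^bsub>G\<^esub> y"] xy(1,2) by simp
      then show "z \<in> ?E"
        using z lineD by (simp only: img fh) blast
    qed
    have fopen: "openin (field_topology K) (f ` carrier G)"
      using opn openin_topspace[of T] by (simp add: open_map_def G.topspace_eq)
    have E_open: "openin (affine_space K (1 + 1)) ?E"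
      unfolding E
      by (intro openin_Int openin_continuous_map_preimage[OF continuous_map_coordinate fopen]) auto
    have "analytic_map K (1 + 1) 1 ?E (\<lambda>z. \<phi> (?\<mu> z))"
    proof (rule analytic_map_line_linear[where l = "\<lambda>_. \<one>" and h = "\<lambda>z. z 0 \<oplus> z 1", OF E_open])
      fix z assume "z \<in> ?E"
      then obtain x y where xy: "x \<in> carrier G" "y \<in> carrier G" "z 0 = f x" "z 1 = f y"
        unfolding E by blast
      show "\<phi> (?\<mu> z) = line (z 0 \<oplus> z 1)"
        unfolding \<mu>[of x y z, OF xy] using xy \<phi>_coset[of "x \<otimes>\<^bsub>G\<^esub> y"] by (simp add: fm)
      show "z 0 \<oplus> z 1 = (\<Oplus>i\<in>{..<1 + 1}. \<one> \<otimes> z i)"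
        unfolding lessThan_2 using xy fcl by simp
    qed simp
    then show ?thesis
      by (simp only: analytic_mult_in_charts_def prod.case Let_def)
  qed
  have inv: "analytic_inv_in_charts K 1 (G Mod N) (?U, \<phi>) (?U, \<phi>)"
  proof -
    have inv_z: "inv\<^bsub>G Mod N\<^esub> (inv_into ?U \<phi> (line (f x))) = N #>\<^bsub>G\<^esub> inv\<^bsub>G\<^esub> x"
      if "x \<in> carrier G" for x
    proof -
      have "N #>\<^bsub>G\<^esub> x \<in> carrier (G Mod N)"
        using cl[OF that] by (simp add: FactGroup_def)
      then show ?thesis
        using that inv_\<phi> by (simp add: NG.inv_FactGroup NG.rcos_inv)
    qed
    have E: "{z \<in> \<phi> ` ?U. inv\<^bsub>G Mod N\<^esub> (inv_into ?U \<phi> z) \<in> ?U} = D"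
    proof (intro equalityI subsetI)
      fix z assume z: "z \<in> D"
      then obtain x where x: "x \<in> carrier G" "z = line (f x)" using DE by blast
      then have "inv\<^bsub>G Mod N\<^esub> (inv_into ?U \<phi> z) \<in> ?U"
        using inv_z[OF x(1)] cl[of "inv\<^bsub>G\<^esub> x"] by simp
      then show "z \<in> {z \<in> \<phi> ` ?U. inv\<^bsub>G Mod N\<^esub> (inv_into ?U \<phi> z) \<in> ?U}"
        using z img by simp
    qed (use img in auto)
    have "analytic_map K 1 1 D (\<lambda>x. \<phi> (inv\<^bsub>G Mod N\<^esub> (inv_into ?U \<phi> x)))"
    proof (rule analytic_map_line_linear[where l = "\<lambda>_. \<ominus> \<one>" and h = "\<lambda>z. \<ominus> z 0", OF D_open])
      show "\<phi> (inv\<^bsub>G Mod N\<^esub> (inv_into ?U \<phi> z)) = line (\<ominus> z 0)" if z: "z \<in> D" for z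
      proof -
        obtain x where x: "x \<in> carrier G" "z = line (f x)" using DE[OF z] by blast
        then show ?thesis
          using inv_z[OF x(1)] \<phi>_coset[of "inv\<^bsub>G\<^esub> x"] finv by simp
      qed
    qed (use D0 in \<open>auto simp: l_minus lessThan_1\<close>)
    then show ?thesis
      by (simp only: analytic_inv_in_charts_def prod.case E)
  qed
  have "lie_group K (G Mod N) ?Q"
    unfolding lie_group_def
    using tg atlas mult inv by (intro conjI exI[of _ "1::nat"] exI[of _ "{(?U, \<phi>)}"]) simp_all
  then show ?thesis
    using N closed by (simp add: lie_quotient_kernels_def flip: N_def)
qed

end

section \<open>Series with integer coefficients\<close>

lemma (in valued_ring) lie_group_imp_locally_compact_space:
  assumes K: "locally_compact_space (field_topology K)" and L: "lie_group K H (S :: 'a topology)"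
  shows "locally_compact_space S"
  unfolding locally_compact_space_def
proof
  fix x assume x: "x \<in> topspace S"
  obtain n A where A: "analytic_atlas K n S (A :: ('a, 'k) chart set)"
    using L unfolding lie_group_def by blast
  then obtain U \<phi> where C: "(U, \<phi>) \<in> A" "x \<in> U" "chart_on K n S (U, \<phi>)"
    using x unfolding analytic_atlas_def by blast
  have U: "openin S U" and D: "openin (affine_space K n) (\<phi> ` U)"
    and h: "homeomorphic_map (subtopology S U) (subtopology (affine_space K n) (\<phi> ` U)) \<phi>"
    using C(3) by (auto simp: chart_on_def)
  have "locally_compact_space (affine_space K n)"
    unfolding affine_space_def locally_compact_space_product_topology using K by simp
  moreover have "Hausdorff_space (affine_space K n)"
    by (simp add: affine_space_def Hausdorff_space_product_topology Hausdorff_field_topology)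
  ultimately have "locally_compact_space (subtopology (affine_space K n) (\<phi> ` U))"
    using locally_compact_space_open_subset D by blast
  then have "locally_compact_space (subtopology S U)"
    using homeomorphic_locally_compact_space[OF homeomorphic_map_imp_homeomorphic_space[OF h]] by blast
  moreover have "x \<in> topspace (subtopology S U)"
    using C(2) x by simp
  ultimately obtain V C where "openin (subtopology S U) V" "compactin (subtopology S U) C"
      "x \<in> V" "V \<subseteq> C"
    unfolding locally_compact_space_def by blast
  then show "\<exists>U K. openin S U \<and> compactin S K \<and> x \<in> U \<and> U \<subseteq> K"
    using U openin_open_subtopology compactin_subtopology by metis
qed

text \<open>The weight n + 1 of the norm times the bound 2 (1/2) ^ n on the coefficients: it bounds
  the n-th term of a series at a sequence of norm at most 1.\<close>

definition wt :: "nat \<Rightarrow> real" where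
  "wt n = 2 * (real n + 1) * (1 / 2) ^ n"

lemma summable_wt: "summable wt"
proof -
  have "summable (\<lambda>n. of_nat (Suc n) * (1 / 2) ^ n :: real)"
    using geometric_deriv_sums[of "1/2 :: real"] by (auto simp: sums_iff)
  from summable_mult[OF this, of 2] show ?thesis
    by (simp add: wt_def[abs_def] algebra_simps)
qed

lemma wt_nonneg: "0 \<le> wt n"
  by (simp add: wt_def)

definition bounded_by :: "real \<Rightarrow> (nat \<Rightarrow> int) \<Rightarrow> bool" where
  "bounded_by C x \<longleftrightarrow> (\<forall>n. \<bar>real_of_int (x n)\<bar> \<le> C * (real n + 1))"

text \<open>
  The last but one assumption is what keeps the coefficients \<open>\<beta>\<^sup>n (1 - \<beta>\<^sup>k)\<close> from decaying faster than by the
  factor \<open>\<bar>\<beta>\<bar>\<close> when \<open>k\<close> grows with \<open>n\<close>: over the reals \<open>1 - 2\<^sup>-\<^sup>k\<close> increases, and p-adically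
  \<open>\<bar>1 - p\<^sup>k\<bar>\<close> is constant for \<open>k \<ge> 1\<close>. The last assumption says that one integer digit of bounded
  size reduces the remainder by the factor \<open>\<bar>\<beta>\<bar>\<close>.
\<close>

locale digit_ring = valued_ring K for K :: "('k, 'b) valued_field_scheme" (structure) +
  fixes \<iota> :: "int \<Rightarrow> 'k" and \<beta> :: 'k
  assumes complete: "Metric_space.mcomplete (carrier K) (field_dist K)"
    and iota_closed [simp]: "\<iota> i \<in> carrier K"
    and iota_add: "\<iota> (i + j) = \<iota> i \<oplus> \<iota> j"
    and absval_iota_le: "absval K (\<iota> i) \<le> \<bar>real_of_int i\<bar>"
    and absval_iota_ge: "i \<noteq> 0 \<Longrightarrow> 1 \<le> \<bar>real_of_int i\<bar> * absval K (\<iota> i)"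
    and beta_closed [simp]: "\<beta> \<in> carrier K"
    and absval_beta: "0 < absval K \<beta>" "absval K \<beta> \<le> 1 / 2"
    and absval_one_minus_mono: "k \<le> l \<Longrightarrow> absval K (\<one> \<ominus> \<beta> [^] (k::nat)) \<le> absval K (\<one> \<ominus> \<beta> [^] (l::nat))"
    and digits: "\<exists>B. \<forall>a\<in>carrier K. \<forall>v\<in>carrier K. absval K a \<le> absval K v \<longrightarrow>
        (\<exists>i. \<bar>i\<bar> \<le> B \<and> absval K (a \<ominus> \<iota> i \<otimes> v) \<le> absval K \<beta> * absval K v)"
begin

lemma absval_one: "absval K \<one> = 1"
proof -
  have "absval K \<beta> = absval K \<beta> * absval K \<one>"
    using absval_mult[of \<beta> \<one>] by simp
  then show ?thesis using absval_beta by simp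
qed

lemma absval_beta_power: "absval K (\<beta> [^] (n::nat)) = absval K \<beta> ^ n"
  by (induction n) (simp_all add: absval_one absval_mult)

lemma iota_0: "\<iota> 0 = \<zero>"
  using iota_add[of 0 0] r_neg1[of "\<iota> 0" "\<iota> 0"] by (simp add: l_neg)

text \<open>By induction: an approximation up to |\<beta>| ^ k is improved by the factor |\<beta>|
  on adding one of the finitely many admissible digits times \<beta> ^ k. Thus the digit axiom also
  yields total boundedness of the unit ball.\<close>

lemma finite_net:
  "\<exists>F. finite F \<and> F \<subseteq> carrier K \<and>
     (\<forall>a\<in>carrier K. absval K a \<le> 1 \<longrightarrow> (\<exists>y\<in>F. absval K (a \<ominus> y) \<le> absval K \<beta> ^ k))"
proof (induction k)
  case 0
  then show ?case
    by (intro exI[of _ "{\<zero>}"]) (auto simp: a_minus_def)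
next
  case (Suc k)
  obtain B where B: "\<And>a v. a \<in> carrier K \<Longrightarrow> v \<in> carrier K \<Longrightarrow> absval K a \<le> absval K v \<Longrightarrow>
        \<exists>i. \<bar>i\<bar> \<le> B \<and> absval K (a \<ominus> \<iota> i \<otimes> v) \<le> absval K \<beta> * absval K v"
    using digits by blast
  obtain F where F: "finite F" "F \<subseteq> carrier K"
    "\<And>a. a \<in> carrier K \<Longrightarrow> absval K a \<le> 1 \<Longrightarrow> \<exists>y\<in>F. absval K (a \<ominus> y) \<le> absval K \<beta> ^ k"
    using Suc by blast
  let ?F = "(\<lambda>(y, i). y \<oplus> \<iota> i \<otimes> \<beta> [^] k) ` (F \<times> {- B..B})"
  have "\<exists>z\<in>?F. absval K (a \<ominus> z) \<le> absval K \<beta> ^ Suc k"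
    if a: "a \<in> carrier K" "absval K a \<le> 1" for a
  proof -
    obtain y where y: "y \<in> F" "absval K (a \<ominus> y) \<le> absval K \<beta> ^ k" using F(3) a by blast
    then have yc: "y \<in> carrier K" using F by blast
    obtain i where i: "\<bar>i\<bar> \<le> B"
      "absval K ((a \<ominus> y) \<ominus> \<iota> i \<otimes> \<beta> [^] k) \<le> absval K \<beta> * absval K (\<beta> [^] k)"
      using B[of "a \<ominus> y" "\<beta> [^] k"] y yc a by (auto simp: absval_beta_power)
    have "a \<ominus> (y \<oplus> \<iota> i \<otimes> \<beta> [^] k) = (a \<ominus> y) \<ominus> \<iota> i \<otimes> \<beta> [^] k"
      using a yc by (simp add: a_minus_def minus_add a_assoc)
    then show ?thesis
      using i y by (intro bexI[of _ "y \<oplus> \<iota> i \<otimes> \<beta> [^] k"] image_eqI[of _ _ "(y, i)"])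
        (auto simp: absval_beta_power)
  qed
  then show ?case
    using F(1,2) by (intro exI[of _ ?F]) auto
qed

text \<open>Closed balls of radius 1 are compact: they are closed in a complete space, and totally
  bounded by translating \<open>finite_net\<close>.\<close>

lemma locally_compact_field_topology: "locally_compact_space (field_topology K)"
  unfolding locally_compact_space_def
proof
  fix x assume "x \<in> topspace (field_topology K)"
  then have x: "x \<in> carrier K" by (simp add: topspace_field_topology)
  have "metric.mtotally_bounded (metric.mcball x 1)"
    unfolding metric.mtotally_bounded_def
  proof (intro allI impI)
    fix \<epsilon> :: real assume "\<epsilon> > 0"
    then obtain k where k: "absval K \<beta> ^ k < \<epsilon> / 2"
      using real_arch_pow_inv[of "\<epsilon> / 2" "absval K \<beta>"] absval_beta by auto
    obtain F where F: "finite F" "F \<subseteq> carrier K"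
      "\<And>a. a \<in> carrier K \<Longrightarrow> absval K a \<le> 1 \<Longrightarrow> \<exists>y\<in>F. absval K (a \<ominus> y) \<le> absval K \<beta> ^ k"
      using finite_net[of k] by blast
    let ?S = "metric.mcball x 1" and ?B = "\<lambda>y. metric.mcball x 1 \<inter> metric.mball (x \<ominus> y) (\<epsilon> / 2)"
    \<comment> \<open>The translated net points x - y may lie outside the ball, whereas total
      boundedness asks for centres inside it. Each useful net point is replaced by a nearby point of
      the ball, at the price of doubling the radius \<epsilon> / 2.\<close>
    define c where "c y = (SOME s. s \<in> ?B y)" for y
    have c: "c y \<in> ?B y" if "?B y \<noteq> {}" for y
      using that unfolding c_def some_in_eq .
    have cover: "\<exists>y\<in>F. ?B y \<noteq> {} \<and> a \<in> metric.mball (c y) \<epsilon>" if aS: "a \<in> ?S" for a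
    proof -
      have a: "a \<in> carrier K" "absval K (x \<ominus> a) \<le> 1" using aS x by (auto simp: field_dist_def)
      then obtain y where y: "y \<in> F" "absval K ((x \<ominus> a) \<ominus> y) \<le> absval K \<beta> ^ k"
        using F(3)[of "x \<ominus> a"] x by auto
      have yc: "y \<in> carrier K" using y F by blast
      then have "(x \<ominus> y) \<ominus> a = (x \<ominus> a) \<ominus> y"
        using a x by (simp add: a_minus_def a_ac)
      then have "a \<in> ?B y"
        using aS y k a x yc by (auto simp: field_dist_def)
      then have ne: "?B y \<noteq> {}" by blast
      have "field_dist K (c y) a \<le> field_dist K (c y) (x \<ominus> y) + field_dist K (x \<ominus> y) a"
        using c[OF ne] a x yc by (intro metric.triangle) auto
      also have "\<dots> < \<epsilon> / 2 + \<epsilon> / 2"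
        using c[OF ne] \<open>a \<in> ?B y\<close> metric.commute[of "c y" "x \<ominus> y"] by (intro add_strict_mono) auto
      finally show ?thesis
        using c[OF ne] ne y(1) a by (intro bexI[of _ y]) auto
    qed
    have "?S \<subseteq> (\<Union>z\<in>c ` {y \<in> F. ?B y \<noteq> {}}. metric.mball z \<epsilon>)"
    proof
      fix a assume "a \<in> ?S"
      from cover[OF this] show "a \<in> (\<Union>z\<in>c ` {y \<in> F. ?B y \<noteq> {}}. metric.mball z \<epsilon>)"
        by (elim bexE conjE) (rule UN_I[OF imageI], auto)
    qed
    moreover have "c ` {y \<in> F. ?B y \<noteq> {}} \<subseteq> ?S"
    proof
      fix s assume "s \<in> c ` {y \<in> F. ?B y \<noteq> {}}"
      then show "s \<in> ?S" using c x by auto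
    qed
    ultimately show "\<exists>C. finite C \<and> C \<subseteq> ?S \<and> ?S \<subseteq> (\<Union>y\<in>C. metric.mball y \<epsilon>)"
      using F(1) by (intro exI[of _ "c ` {y \<in> F. ?B y \<noteq> {}}"]) simp
  qed
  then have "compactin (field_topology K) (metric.mcball x 1)"
    using metric.mtotally_bounded_eq_compact_closure_of[OF complete, of "metric.mcball x 1"]
      closure_of_closedin[OF metric.closedin_mcball[of x 1]]
    by (simp add: field_topology_def)
  then show "\<exists>U C. openin (field_topology K) U \<and> compactin (field_topology K) C \<and> x \<in> U \<and> U \<subseteq> C"
    using x metric.openin_mball[of x 1] metric.mball_subset_mcball[of x 1]
    by (intro exI[of _ "metric.mball x 1"] exI[of _ "metric.mcball x 1"])
      (auto simp: field_topology_def)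
qed

section \<open>Convergence, additivity and digit expansions of series\<close>

primrec partial_sum :: "(nat \<Rightarrow> 'k) \<Rightarrow> (nat \<Rightarrow> int) \<Rightarrow> nat \<Rightarrow> 'k" where
  "partial_sum v x 0 = \<zero>"
| "partial_sum v x (Suc n) = partial_sum v x n \<oplus> \<iota> (x n) \<otimes> v n"

text \<open>The factor 2 leaves room for the coefficients of g, differences of two scalars each of
  size at most (1/2) ^ n.\<close>

definition geometric_coeffs :: "(nat \<Rightarrow> 'k) \<Rightarrow> bool" where
  "geometric_coeffs v \<longleftrightarrow> (\<forall>n. v n \<in> carrier K \<and> absval K (v n) \<le> 2 * (1 / 2) ^ n)"

lemma partial_sum_closed [simp]: "geometric_coeffs v \<Longrightarrow> partial_sum v x n \<in> carrier K"
  by (induction n) (auto simp: geometric_coeffs_def)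

lemma partial_sum_diff:
  assumes v: "geometric_coeffs v" and "m \<le> n"
  shows "absval K (partial_sum v x n \<ominus> partial_sum v x m) \<le> (\<Sum>i\<in>{m..<n}. absval K (\<iota> (x i) \<otimes> v i))"
  using assms(2)
proof (induction n rule: dec_induct)
  case base
  have "partial_sum v x m \<ominus> partial_sum v x m = \<zero>"
    using v by (simp add: minus_eq_zero_iff)
  then show ?case by (simp add: absval_zero)
next
  case (step n)
  let ?s = "partial_sum v x"
  have vc: "v n \<in> carrier K" using v by (simp add: geometric_coeffs_def)
  have "?s (Suc n) \<ominus> ?s m = (?s n \<ominus> ?s m) \<oplus> \<iota> (x n) \<otimes> v n"
    using v vc by (simp add: a_minus_def a_ac)
  then have "absval K (?s (Suc n) \<ominus> ?s m) \<le> absval K (?s n \<ominus> ?s m) + absval K (\<iota> (x n) \<otimes> v n)"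
    using absval_add[of "?s n \<ominus> ?s m" "\<iota> (x n) \<otimes> v n"] v vc by simp
  then show ?case
    using step by simp
qed

lemma term_le:
  assumes v: "geometric_coeffs v" and x: "bounded_by C x"
  shows "absval K (\<iota> (x n) \<otimes> v n) \<le> C * wt n"
proof -
  have vn: "v n \<in> carrier K" "absval K (v n) \<le> 2 * (1 / 2) ^ n"
    using v by (auto simp: geometric_coeffs_def)
  have xn: "absval K (\<iota> (x n)) \<le> C * (real n + 1)"
    using x absval_iota_le[of "x n"] by (auto simp: bounded_by_def intro: order_trans)
  have "absval K (\<iota> (x n)) * absval K (v n) \<le> (C * (real n + 1)) * (2 * (1 / 2) ^ n)"
    using vn xn absval_nonneg[of "\<iota> (x n)"] absval_nonneg[of "v n"] by (intro mult_mono) auto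
  then show ?thesis
    using vn by (simp add: absval_mult wt_def algebra_simps)
qed

lemma partial_sum_converges:
  assumes v: "geometric_coeffs v" and x: "bounded_by C x"
  shows "\<exists>l. limitin (field_topology K) (partial_sum v x) l sequentially"
proof -
  have "metric.MCauchy (partial_sum v x)"
    unfolding metric.MCauchy_def
  proof (intro conjI allI impI)
    show "range (partial_sum v x) \<subseteq> carrier K" using v by auto
    fix \<epsilon> :: real assume "\<epsilon> > 0"
    have "summable (\<lambda>i. C * wt i)" using summable_wt by (rule summable_mult)
    then obtain N where N: "\<And>m n. m \<ge> N \<Longrightarrow> \<bar>\<Sum>i\<in>{m..<n}. C * wt i\<bar> < \<epsilon>"
      using \<open>\<epsilon> > 0\<close> unfolding summable_Cauchy real_norm_def by blast
    have *: "field_dist K (partial_sum v x n) (partial_sum v x m) < \<epsilon>" if "m \<ge> N" "m \<le> n" for m n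
    proof -
      have "absval K (partial_sum v x n \<ominus> partial_sum v x m) \<le> (\<Sum>i\<in>{m..<n}. absval K (\<iota> (x i) \<otimes> v i))"
        using partial_sum_diff v that by blast
      also have "\<dots> \<le> (\<Sum>i\<in>{m..<n}. C * wt i)"
        by (intro sum_mono term_le v x)
      also have "\<dots> < \<epsilon>" using N[OF that(1), of n] by linarith
      finally show ?thesis using v by (simp add: field_dist_def)
    qed
    show "\<exists>N. \<forall>n n'. N \<le> n \<longrightarrow> N \<le> n' \<longrightarrow> field_dist K (partial_sum v x n) (partial_sum v x n') < \<epsilon>"
    proof (intro exI[of _ N] allI impI)
      fix n n' assume "N \<le> n" "N \<le> n'"
      then show "field_dist K (partial_sum v x n) (partial_sum v x n') < \<epsilon>"
        using *[of n n'] *[of n' n] metric.commute by (metis linear)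
    qed
  qed
  then show ?thesis
    using complete by (simp add: metric.mcomplete_def field_topology_def)
qed

definition series :: "(nat \<Rightarrow> 'k) \<Rightarrow> (nat \<Rightarrow> int) \<Rightarrow> 'k" where
  "series v x = (THE l. limitin (field_topology K) (partial_sum v x) l sequentially)"

lemma limit_unique:
  assumes "limitin (field_topology K) X a sequentially" "limitin (field_topology K) X b sequentially"
  shows "a = b"
  by (rule limitin_Hausdorff_unique[OF assms _ Hausdorff_field_topology]) simp

lemma series_eqI:
  assumes "limitin (field_topology K) (partial_sum v x) l sequentially"
  shows "series v x = l"
  unfolding series_def using assms limit_unique by blast

lemma series_limit:
  assumes "geometric_coeffs v" "bounded_by C x"
  shows "limitin (field_topology K) (partial_sum v x) (series v x) sequentially"
  using partial_sum_converges[OF assms] series_eqI by metis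

lemma limit_iff:
  "limitin (field_topology K) X l sequentially \<longleftrightarrow> l \<in> carrier K \<and>
    (\<forall>\<epsilon>>0. \<forall>\<^sub>F n in sequentially. X n \<in> carrier K \<and> absval K (X n \<ominus> l) < \<epsilon>)"
proof -
  have "X n \<in> carrier K \<and> field_dist K (X n) l < \<epsilon> \<longleftrightarrow> X n \<in> carrier K \<and> absval K (X n \<ominus> l) < \<epsilon>"
    if "l \<in> carrier K" for n \<epsilon>
    using that by (auto simp: field_dist_def)
  then show ?thesis
    unfolding field_topology_def metric.limitin_metric by auto
qed

lemma series_closed [simp]:
  assumes "geometric_coeffs v" "bounded_by C x"
  shows "series v x \<in> carrier K"
  using series_limit[OF assms] by (simp add: limit_iff)

lemma limit_add:
  assumes X: "limitin (field_topology K) X a sequentially" and Y: "limitin (field_topology K) Y b sequentially"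
  shows "limitin (field_topology K) (\<lambda>n. X n \<oplus> Y n) (a \<oplus> b) sequentially"
  unfolding limit_iff
proof (intro conjI allI impI)
  have ab: "a \<in> carrier K" "b \<in> carrier K" using X Y by (auto simp: limit_iff)
  then show "a \<oplus> b \<in> carrier K" by simp
  fix \<epsilon> :: real assume "\<epsilon> > 0"
  then have "\<epsilon> / 2 > 0" by simp
  then have "\<forall>\<^sub>F n in sequentially. X n \<in> carrier K \<and> absval K (X n \<ominus> a) < \<epsilon> / 2"
    "\<forall>\<^sub>F n in sequentially. Y n \<in> carrier K \<and> absval K (Y n \<ominus> b) < \<epsilon> / 2"
    using X Y unfolding limit_iff by blast+
  then show "\<forall>\<^sub>F n in sequentially. X n \<oplus> Y n \<in> carrier K \<and> absval K ((X n \<oplus> Y n) \<ominus> (a \<oplus> b)) < \<epsilon>"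
  proof eventually_elim
    case (elim n)
    then have "(X n \<oplus> Y n) \<ominus> (a \<oplus> b) = (X n \<ominus> a) \<oplus> (Y n \<ominus> b)"
      using ab by (simp add: a_minus_def minus_add a_ac)
    then show ?case
      using absval_add[of "X n \<ominus> a" "Y n \<ominus> b"] elim ab by simp
  qed
qed

lemma limit_le:
  assumes X: "limitin (field_topology K) X l sequentially" and a: "a \<in> carrier K"
    and le: "\<forall>\<^sub>F n in sequentially. absval K (X n \<ominus> a) \<le> C"
  shows "absval K (l \<ominus> a) \<le> C"
proof (rule field_le_epsilon)
  fix \<epsilon> :: real assume "\<epsilon> > 0"
  then have "\<forall>\<^sub>F n in sequentially. X n \<in> carrier K \<and> absval K (X n \<ominus> l) < \<epsilon>"
    using X unfolding limit_iff by blast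
  with le have "\<forall>\<^sub>F n in sequentially. absval K (X n \<ominus> a) \<le> C \<and> X n \<in> carrier K \<and> absval K (X n \<ominus> l) < \<epsilon>"
    by eventually_elim simp
  then obtain n where n: "absval K (X n \<ominus> a) \<le> C" "X n \<in> carrier K" "absval K (X n \<ominus> l) < \<epsilon>"
    using eventually_happens sequentially_bot by blast
  have l: "l \<in> carrier K" using X by (simp add: limit_iff)
  have "absval K (l \<ominus> a) \<le> absval K (X n \<ominus> l) + absval K (X n \<ominus> a)"
    using absval_diff_triangle[of l "X n" a] absval_diff_commute[of l "X n"] n l a by simp
  then show "absval K (l \<ominus> a) \<le> C + \<epsilon>" using n by linarith
qed

text \<open>Bounds the operator norm of the series by the sum of \<open>wt\<close>; continuity of
  the homomorphisms rests on this.\<close>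

lemma series_bound:
  assumes v: "geometric_coeffs v" and x: "bounded_by C x" and C: "0 \<le> C"
  shows "absval K (series v x) \<le> C * suminf wt"
proof -
  have "absval K (partial_sum v x n \<ominus> \<zero>) \<le> C * suminf wt" for n
  proof -
    have "absval K (partial_sum v x n \<ominus> partial_sum v x 0) \<le> (\<Sum>i\<in>{0..<n}. absval K (\<iota> (x i) \<otimes> v i))"
      using partial_sum_diff v by blast
    also have "\<dots> \<le> (\<Sum>i\<in>{0..<n}. C * wt i)"
      by (intro sum_mono term_le v x)
    also have "\<dots> = C * (\<Sum>i<n. wt i)"
      by (simp add: sum_distrib_left lessThan_atLeast0)
    also have "\<dots> \<le> C * suminf wt"
      using C summable_wt wt_nonneg by (intro mult_left_mono sum_le_suminf) auto
    finally show ?thesis by simp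
  qed
  then have "absval K (series v x \<ominus> \<zero>) \<le> C * suminf wt"
    by (intro limit_le[OF series_limit[OF v x]]) auto
  then show ?thesis
    using series_closed[OF v x] by (simp add: a_minus_def)
qed

lemma series_add:
  assumes v: "geometric_coeffs v" and x: "bounded_by C x" and y: "bounded_by D y"
  shows "series v (\<lambda>n. x n + y n) = series v x \<oplus> series v y"
proof (rule series_eqI)
  have vn: "v n \<in> carrier K" for n using v by (simp add: geometric_coeffs_def)
  have "partial_sum v (\<lambda>n. x n + y n) n = partial_sum v x n \<oplus> partial_sum v y n" for n
    using v vn by (induction n) (simp_all add: iota_add l_distr a_ac)
  then have "partial_sum v (\<lambda>n. x n + y n) = (\<lambda>n. partial_sum v x n \<oplus> partial_sum v y n)"
    by (rule ext)
  then show "limitin (field_topology K) (partial_sum v (\<lambda>n. x n + y n)) (series v x \<oplus> series v y) sequentially"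
    using limit_add[OF series_limit[OF v x] series_limit[OF v y]] by presburger
qed

text \<open>Applied to f = g + h, this turns vanishing of f and g into vanishing of h.\<close>

lemma series_coeff_add:
  assumes v: "geometric_coeffs v" and w: "geometric_coeffs w" and u: "geometric_coeffs u" and x: "bounded_by C x"
    and eq: "\<And>n. u n = v n \<oplus> w n"
  shows "series u x = series v x \<oplus> series w x"
proof (rule series_eqI)
  have vn: "v n \<in> carrier K" "w n \<in> carrier K" for n using v w by (auto simp: geometric_coeffs_def)
  have "partial_sum u x n = partial_sum v x n \<oplus> partial_sum w x n" for n
    using v w vn by (induction n) (simp_all add: eq r_distr a_ac)
  then have "partial_sum u x = (\<lambda>n. partial_sum v x n \<oplus> partial_sum w x n)"
    by (rule ext)
  then show "limitin (field_topology K) (partial_sum u x) (series v x \<oplus> series w x) sequentially"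
    using limit_add[OF series_limit[OF v x] series_limit[OF w x]] by presburger
qed

text \<open>Greedy expansion starting at position \<open>N\<close>. If the remainder is at most |v
  n|, one digit brings it down to |\<beta>| |v n|, which by \<open>slow\<close> is at most |v (n +
  1)|, so the next position can take over. The remainders tend to zero with the
  coefficients.\<close>

lemma digit_expansion:
  assumes v: "geometric_coeffs v"
    and slow: "\<And>n. absval K \<beta> * absval K (v n) \<le> absval K (v (Suc n))"
    and B: "\<And>a v. a \<in> carrier K \<Longrightarrow> v \<in> carrier K \<Longrightarrow> absval K a \<le> absval K v \<Longrightarrow>
        \<exists>i. \<bar>i\<bar> \<le> B \<and> absval K (a \<ominus> \<iota> i \<otimes> v) \<le> absval K \<beta> * absval K v"
    and a: "a \<in> carrier K" "absval K a \<le> absval K (v N)" and B0: "0 \<le> B"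
  shows "\<exists>x. (\<forall>n<N. x n = 0) \<and> (\<forall>n. \<bar>x n\<bar> \<le> B) \<and> series v x = a"
proof -
  have vn: "v n \<in> carrier K" "absval K (v n) \<le> 2 * (1 / 2) ^ n" for n
    using v by (auto simp: geometric_coeffs_def)
  define digit where "digit r n = (SOME i. \<bar>i\<bar> \<le> B \<and>
    absval K (r \<ominus> \<iota> i \<otimes> v n) \<le> absval K \<beta> * absval K (v n))" for r n
  have digit: "\<bar>digit r n\<bar> \<le> B" "absval K (r \<ominus> \<iota> (digit r n) \<otimes> v n) \<le> absval K (v (Suc n))"
    if "r \<in> carrier K" "absval K r \<le> absval K (v n)" for r n
    using someI_ex[OF B[OF that(1) vn(1)[of n] that(2)]] slow[of n] unfolding digit_def by linarith+
  \<comment> \<open>\<open>rest k\<close> is what remains of \<open>a\<close> after the digits at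
    positions N, ..., N + k - 1.\<close>
  define rest where "rest = rec_nat a (\<lambda>k r. r \<ominus> \<iota> (digit r (N + k)) \<otimes> v (N + k))"
  have rest_simps: "rest 0 = a" "rest (Suc k) = rest k \<ominus> \<iota> (digit (rest k) (N + k)) \<otimes> v (N + k)" for k
    by (simp_all add: rest_def)
  have rest: "rest k \<in> carrier K \<and> absval K (rest k) \<le> absval K (v (N + k))" for k
  proof (induction k)
    case (Suc k)
    then show ?case
      using digit(2)[of "rest k" "N + k"] vn by (simp add: rest_simps)
  qed (use a in \<open>simp add: rest_simps\<close>)
  define x where "x n = (if n < N then 0 else digit (rest (n - N)) n)" for n
  have x0: "partial_sum v x n = \<zero>" if "n \<le> N" for n
    using that vn by (induction n) (simp_all add: x_def iota_0)
  have xk: "partial_sum v x (N + k) = a \<ominus> rest k" for k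
  proof (induction k)
    case 0
    then show ?case using x0[of N] a minus_eq_zero_iff[of a a] by (simp add: rest_simps)
  next
    case (Suc k)
    have "partial_sum v x (N + Suc k) = (a \<ominus> rest k) \<oplus> \<iota> (digit (rest k) (N + k)) \<otimes> v (N + k)"
      using Suc x_def[of "N + k"] by simp
    also have "\<dots> = a \<ominus> rest (Suc k)"
      unfolding rest_simps using a rest[of k] vn by (simp add: a_minus_def minus_add a_assoc)
    finally show ?case .
  qed
  have "limitin (field_topology K) (partial_sum v x) a sequentially"
    unfolding limit_iff
  proof (intro conjI allI impI a(1))
    fix \<epsilon> :: real assume "\<epsilon> > 0"
    then obtain M where M: "(1 / 2) ^ M < \<epsilon> / 2"
      using real_arch_pow_inv[of "\<epsilon> / 2" "1 / 2 :: real"] by auto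
    show "\<forall>\<^sub>F n in sequentially. partial_sum v x n \<in> carrier K \<and> absval K (partial_sum v x n \<ominus> a) < \<epsilon>"
      using eventually_ge_at_top[of "max N M"]
    proof eventually_elim
      case (elim n)
      define k where "k = n - N"
      have n: "n = N + k" using elim by (simp add: k_def)
      have "absval K (partial_sum v x n \<ominus> a) = absval K (a \<ominus> (a \<ominus> rest k))"
        unfolding n xk using a rest by (intro absval_diff_commute) auto
      also have "a \<ominus> (a \<ominus> rest k) = rest k"
        using a rest[of k] by (simp add: a_minus_def minus_add r_neg2 r_neg1 r_neg)
      also have "absval K (rest k) \<le> 2 * (1 / 2) ^ n"
        using rest[of k] vn(2)[of n] n by simp
      also have "\<dots> \<le> 2 * (1 / 2) ^ M"
        using elim by (intro mult_left_mono power_decreasing) auto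
      also have "\<dots> < \<epsilon>" using M by simp
      finally show ?case using v by simp
    qed
  qed
  then have "series v x = a" by (rule series_eqI)
  moreover have "\<bar>x n\<bar> \<le> B" for n
    using digit(1)[of "rest (n - N)" n] rest[of "n - N"] B0 by (cases "n < N") (simp_all add: x_def)
  ultimately show ?thesis
    by (intro exI[of _ x]) (simp add: x_def)
qed

text \<open>Quantitative openness at zero. Digits are bounded by a constant B, so those placed from
  position N > B / \<epsilon> on obey the bound \<epsilon> (n + 1); the growth of the weight is what
  is used here. The radius \<delta> is |v N|, the range in which an expansion may start at
  N.\<close>

lemma series_surj_near_zero:
  assumes v: "geometric_coeffs v"
    and slow: "\<And>n. absval K \<beta> * absval K (v n) \<le> absval K (v (Suc n))"
    and pos: "\<And>n. 0 < absval K (v n)" and \<epsilon>: "\<epsilon> > 0"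
  shows "\<exists>\<delta>>0. \<forall>a\<in>carrier K. absval K a < \<delta> \<longrightarrow> (\<exists>x. bounded_by \<epsilon> x \<and> series v x = a)"
proof -
  obtain B0 where B0: "\<And>a v. a \<in> carrier K \<Longrightarrow> v \<in> carrier K \<Longrightarrow> absval K a \<le> absval K v \<Longrightarrow>
        \<exists>i. \<bar>i\<bar> \<le> B0 \<and> absval K (a \<ominus> \<iota> i \<otimes> v) \<le> absval K \<beta> * absval K v"
    using digits by blast
  \<comment> \<open>The digit axiom fixes no sign for its bound, while the zero entries before
    position \<open>N\<close> must respect it as well.\<close>
  define B where "B = max B0 0"
  have B: "\<exists>i. \<bar>i\<bar> \<le> B \<and> absval K (a \<ominus> \<iota> i \<otimes> v) \<le> absval K \<beta> * absval K v"
    if "a \<in> carrier K" "v \<in> carrier K" "absval K a \<le> absval K v" for a v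
    using B0[OF that] by (auto simp: B_def)
  obtain N where N: "real_of_int B / \<epsilon> < real N"
    using reals_Archimedean2 by blast
  have "\<exists>x. bounded_by \<epsilon> x \<and> series v x = a" if a: "a \<in> carrier K" "absval K a < absval K (v N)" for a
  proof -
    obtain x where x: "\<And>n. n < N \<Longrightarrow> x n = 0" "\<And>n. \<bar>x n\<bar> \<le> B" "series v x = a"
      using digit_expansion[OF v slow B a(1), of N] a(2) by (auto simp: B_def)
    have "\<bar>real_of_int (x n)\<bar> \<le> \<epsilon> * (real n + 1)" for n
    proof (cases "n < N")
      case False
      have "\<bar>real_of_int (x n)\<bar> \<le> real_of_int B"
        using x(2)[of n] by linarith
      also have "\<dots> \<le> \<epsilon> * real N"
        using N \<epsilon> by (simp add: field_simps)
      also have "\<dots> \<le> \<epsilon> * (real n + 1)"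
        using False \<epsilon> by (intro mult_left_mono) auto
      finally show ?thesis .
    qed (use x \<epsilon> in simp)
    then show ?thesis
      using x(3) by (auto simp: bounded_by_def)
  qed
  then show ?thesis
    using pos by blast
qed

text \<open>The right-hand side telescopes, which bounds the tails of the lacunary series.\<close>

lemma lacunary_estimate:
  fixes b :: real
  assumes b: "0 < b" "b \<le> 1 / 2" and i: "1 \<le> i"
  shows "(real i + 1) * b ^ (i + 1)\<^sup>2 \<le> b ^ i\<^sup>2 / (2 * real i) - b ^ (i + 1)\<^sup>2 / (2 * (real i + 1))"
proof -
  \<comment> \<open>Dividing the claim by b ^ (i^2) leaves b ^ (2 i + 1) times 2 i (i + 1 + 1 / (2
    (i + 1))) at most 1. As b is at most 1/2 and the innermost fraction is at most 1, it suffices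
    that 2 i (i + 2) is at most 2 ^ (2 i + 1).\<close>
  have pw: "i * (i + 2) \<le> 4 ^ i"
    using i
  proof (induction i rule: dec_induct)
    case (step n)
    then have "Suc n * (Suc n + 2) \<le> 4 * (n * (n + 2))"
      by (cases n) auto
    then show ?case using step by simp
  qed simp
  have "2 * real i * (real i + 1 + 1 / (2 * (real i + 1))) \<le> 2 * (real i * (real i + 2))"
    using i by (simp add: field_simps)
  also have "\<dots> \<le> 2 * 4 ^ i"
    using of_nat_mono[OF pw, where 'a = real] by (simp add: algebra_simps)
  also have "\<dots> = 2 ^ (2 * i + 1)"
    by (simp add: power_mult)
  finally have 1: "2 * real i * (real i + 1 + 1 / (2 * (real i + 1))) \<le> 2 ^ (2 * i + 1)" .
  have "b ^ (2 * i + 1) * (2 * real i * (real i + 1 + 1 / (2 * (real i + 1)))) \<le> (1 / 2) ^ (2 * i + 1) * 2 ^ (2 * i + 1)"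
    using b 1 by (intro mult_mono power_mono) auto
  also have "\<dots> = 1"
    by (simp add: power_divide)
  finally have 2: "b ^ (2 * i + 1) * (real i + 1 + 1 / (2 * (real i + 1))) \<le> 1 / (2 * real i)"
    using i by (simp add: field_simps)
  have "b ^ (i + 1)\<^sup>2 = b ^ i\<^sup>2 * b ^ (2 * i + 1)"
    unfolding power_add[symmetric] by (rule arg_cong[of _ _ "\<lambda>k. b ^ k"]) (simp add: power2_eq_square)
  then have "b ^ (i + 1)\<^sup>2 * (real i + 1 + 1 / (2 * (real i + 1)))
      = b ^ i\<^sup>2 * (b ^ (2 * i + 1) * (real i + 1 + 1 / (2 * (real i + 1))))"
    by simp
  also have "\<dots> \<le> b ^ i\<^sup>2 * (1 / (2 * real i))"
    using 2 b by (intro mult_left_mono) auto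
  finally show ?thesis
    by (simp add: algebra_simps)
qed

text \<open>Let n be the first position with a nonzero entry. As |x n| is at most n + 1,
  \<open>absval_iota_ge\<close> gives its scalar absolute value at least 1 / (n + 1), so the leading
  term has size at least b ^ ((n + 1)^2) / (n + 1). The tail amounts to at most half of that, so the
  two cannot cancel.\<close>

lemma lacunary_series_nonzero:
  assumes u: "\<And>n. u n = \<beta> [^] ((n + 1)\<^sup>2)" and uc: "geometric_coeffs u"
    and x: "bounded_by 1 x" and s: "series u x = \<zero>"
  shows "x = (\<lambda>_. 0)"
proof (rule ccontr)
  define b where "b = absval K \<beta>"
  have b: "0 < b" "b \<le> 1 / 2" using absval_beta by (auto simp: b_def)
  assume "x \<noteq> (\<lambda>_. 0)"
  then have ex: "\<exists>n. x n \<noteq> 0" by auto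
  define n where "n = (LEAST n. x n \<noteq> 0)"
  have n: "x n \<noteq> 0" "\<And>m. m < n \<Longrightarrow> x m = 0"
    using LeastI_ex[OF ex] not_less_Least by (auto simp: n_def)
  have un: "u i \<in> carrier K" "absval K (u i) = b ^ (i + 1)\<^sup>2" for i
    by (auto simp: u absval_beta_power b_def)
  have "partial_sum u x m = \<zero>" if "m \<le> n" for m
    using that n(2) un by (induction m) (simp_all add: iota_0)
  then have pn: "partial_sum u x (Suc n) = \<iota> (x n) \<otimes> u n"
    using un by simp
  have xle: "\<bar>real_of_int (x i)\<bar> \<le> real i + 1" for i
    using x by (simp add: bounded_by_def)
  have "1 \<le> \<bar>real_of_int (x n)\<bar> * absval K (\<iota> (x n))"
    using absval_iota_ge[OF n(1)] by simp
  also have "\<dots> \<le> (real n + 1) * absval K (\<iota> (x n))"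
    using xle absval_nonneg by (intro mult_right_mono) auto
  finally have low: "b ^ (n + 1)\<^sup>2 / (real n + 1) \<le> absval K (\<iota> (x n) \<otimes> u n)"
    using mult_left_mono[of 1 "(real n + 1) * absval K (\<iota> (x n))" "b ^ (n + 1)\<^sup>2"] b un
    by (simp add: absval_mult divide_le_eq algebra_simps)
  \<comment> \<open>The term at position i has exponent (i + 1)^2 and is dominated by R i - R (i +
    1). The tail from n + 1 on thus telescopes to at most R (n + 1), exactly half of the lower bound
    for the leading term.\<close>
  define R where "R i = b ^ i\<^sup>2 / (2 * real i)" for i
  have tail: "absval K (partial_sum u x m \<ominus> partial_sum u x (Suc n)) \<le> R (n + 1)" if "Suc n \<le> m" for m
  proof -
    have "absval K (partial_sum u x m \<ominus> partial_sum u x (Suc n))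
        \<le> (\<Sum>i\<in>{Suc n..<m}. absval K (\<iota> (x i) \<otimes> u i))"
      using partial_sum_diff[OF uc that] .
    also have "\<dots> \<le> (\<Sum>i\<in>{Suc n..<m}. R i - R (Suc i))"
    proof (rule sum_mono)
      fix i assume "i \<in> {Suc n..<m}"
      then have i: "1 \<le> i" by simp
      have "absval K (\<iota> (x i) \<otimes> u i) \<le> (real i + 1) * b ^ (i + 1)\<^sup>2"
        using un xle[of i] absval_iota_le[of "x i"] b by (simp add: absval_mult mult_right_mono)
      also have "\<dots> \<le> R i - R (Suc i)"
        using lacunary_estimate[OF b i] by (simp add: R_def add.commute)
      finally show "absval K (\<iota> (x i) \<otimes> u i) \<le> R i - R (Suc i)" .
    qed
    also have "\<dots> = R (Suc n) - R m"
      using that by (rule sum_Suc_diff'[of "Suc n" m "\<lambda>i. - R i", simplified])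
    also have "\<dots> \<le> R (n + 1)"
      using b by (simp add: R_def)
    finally show ?thesis .
  qed
  have "absval K (series u x \<ominus> partial_sum u x (Suc n)) \<le> R (n + 1)"
  proof (rule limit_le[OF series_limit[OF uc x]])
    show "\<forall>\<^sub>F m in sequentially. absval K (partial_sum u x m \<ominus> partial_sum u x (Suc n)) \<le> R (n + 1)"
      using eventually_ge_at_top[of "Suc n"] by eventually_elim (rule tail)
  qed (rule partial_sum_closed[OF uc])
  then have "absval K (\<iota> (x n) \<otimes> u n) \<le> R (n + 1)"
    unfolding s pn using un absval_a_inv[of "\<iota> (x n) \<otimes> u n"] by (simp add: a_minus_def)
  moreover have "R (n + 1) = b ^ (n + 1)\<^sup>2 / (real n + 1) / 2"
    by (simp add: R_def add.commute mult.commute)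
  moreover have "0 < b ^ (n + 1)\<^sup>2 / (real n + 1)"
    using b by simp
  moreover have "False" if "A \<le> r" "r = q / 2" "0 < q" "q \<le> A" for A r q :: real
    using that by linarith
  ultimately show False
    using low by blast
qed

end

section \<open>The group of integer sequences of linear growth\<close>

definition seqs :: "(nat \<Rightarrow> int) set" where
  "seqs = {x. \<exists>C\<ge>0. bounded_by C x}"

text \<open>Cutting off at 1 makes the supremum exist for arbitrary sequences, so symmetry and
  non-negativity hold unrelativised, as \<open>Metric_space\<close> asks. Below 1 it is the weighted
  sup norm of the difference.\<close>

definition wdist :: "(nat \<Rightarrow> int) \<Rightarrow> (nat \<Rightarrow> int) \<Rightarrow> real" where
  "wdist x y = (SUP n. min 1 (\<bar>real_of_int (x n - y n)\<bar> / (real n + 1)))"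

lemma wdist_ge: "min 1 (\<bar>real_of_int (x n - y n)\<bar> / (real n + 1)) \<le> wdist x y"
  unfolding wdist_def by (rule cSUP_upper) (auto intro!: bdd_aboveI[of _ 1])

lemma wdist_leI:
  assumes "\<And>n. min 1 (\<bar>real_of_int (x n - y n)\<bar> / (real n + 1)) \<le> c"
  shows "wdist x y \<le> c"
  unfolding wdist_def using assms by (intro cSUP_least) auto

lemma wdist_le_if_bounded_by:
  assumes "bounded_by c (\<lambda>n. x n - y n)"
  shows "wdist x y \<le> c"
proof (rule wdist_leI)
  fix n
  have "\<bar>real_of_int (x n - y n)\<bar> / (real n + 1) \<le> c"
    using assms by (simp add: bounded_by_def divide_le_eq)
  then show "min 1 (\<bar>real_of_int (x n - y n)\<bar> / (real n + 1)) \<le> c"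
    by (rule min.coboundedI2)
qed

lemma wdist_less_imp:
  assumes "wdist x y < c" "c \<le> 1"
  shows "\<bar>real_of_int (x n - y n)\<bar> < c * (real n + 1)"
proof -
  have "min 1 (\<bar>real_of_int (x n - y n)\<bar> / (real n + 1)) < c"
    using wdist_ge[of x n y] assms(1) by (rule le_less_trans)
  then have "\<bar>real_of_int (x n - y n)\<bar> / (real n + 1) < c"
    using assms(2) by (simp add: min_less_iff_disj)
  then show ?thesis
    by (simp add: pos_divide_less_eq)
qed

lemma bounded_by_if_wdist_less:
  assumes "wdist x y < c" "c \<le> 1"
  shows "bounded_by c (\<lambda>n. x n - y n)"
  using wdist_less_imp[OF assms] less_imp_le by (auto simp: bounded_by_def)

lemma wdist_commute: "wdist x y = wdist y x"
  by (simp add: wdist_def abs_minus_commute)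

lemma wdist_nonneg: "0 \<le> wdist x y"
  by (rule order_trans[OF _ wdist_ge[of x 0 y]]) simp

lemma wdist_translate: "wdist (\<lambda>n. x n + z n) (\<lambda>n. y n + z n) = wdist x y"
  by (simp add: wdist_def)

lemma wdist_triangle: "wdist x z \<le> wdist x y + wdist y z"
proof (rule wdist_leI)
  fix n
  have "\<bar>real_of_int (x n - z n)\<bar> / (real n + 1) \<le>
      \<bar>real_of_int (x n - y n)\<bar> / (real n + 1) + \<bar>real_of_int (y n - z n)\<bar> / (real n + 1)"
    unfolding add_divide_distrib[symmetric] by (intro divide_right_mono) auto
  then show "min 1 (\<bar>real_of_int (x n - z n)\<bar> / (real n + 1)) \<le> wdist x y + wdist y z"
    using wdist_ge[of x n y] wdist_ge[of y n z] wdist_nonneg[of x y] wdist_nonneg[of y z]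
    by linarith
qed

lemma wdist_add:
  "wdist (\<lambda>n. x n + y n) (\<lambda>n. x' n + y' n) \<le> wdist x x' + wdist y y'"
proof -
  have "wdist (\<lambda>n. x n + y n) (\<lambda>n. x' n + y' n) \<le>
      wdist (\<lambda>n. x n + y n) (\<lambda>n. x' n + y n) + wdist (\<lambda>n. x' n + y n) (\<lambda>n. x' n + y' n)"
    by (rule wdist_triangle)
  then show ?thesis
    using wdist_translate[of x y x'] wdist_translate[of y x' y'] by (simp add: add.commute)
qed

lemma wdist_uminus: "wdist (\<lambda>n. - x n) (\<lambda>n. - y n) = wdist x y"
  by (simp add: wdist_def abs_minus_commute)

lemma wdist_eq_0_iff: "wdist x y = 0 \<longleftrightarrow> x = y"
proof
  assume 0: "wdist x y = 0"
  show "x = y"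
  proof
    fix n
    have "\<bar>real_of_int (x n - y n)\<bar> / (real n + 1) \<le> 0"
      using wdist_ge[of x n y] 0 by simp
    then show "x n = y n" by (simp add: divide_le_0_iff)
  qed
qed (simp add: wdist_def)

lemma bounded_by_mono:
  assumes "bounded_by C x" "C \<le> D"
  shows "bounded_by D x"
proof -
  have "C * (real n + 1) \<le> D * (real n + 1)" for n
    using assms(2) by (intro mult_right_mono) auto
  then show ?thesis
    using assms(1) unfolding bounded_by_def by (blast intro: order_trans)
qed

lemma bounded_by_add:
  assumes "bounded_by C x" "bounded_by D y"
  shows "bounded_by (C + D) (\<lambda>n. x n + y n)"
  unfolding bounded_by_def
proof
  fix n
  have "\<bar>real_of_int (x n + y n)\<bar> \<le> \<bar>real_of_int (x n)\<bar> + \<bar>real_of_int (y n)\<bar>" by simp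
  also have "\<dots> \<le> C * (real n + 1) + D * (real n + 1)"
    using assms by (intro add_mono) (auto simp: bounded_by_def)
  finally show "\<bar>real_of_int (x n + y n)\<bar> \<le> (C + D) * (real n + 1)"
    by (simp add: algebra_simps)
qed

lemma bounded_by_uminus: "bounded_by C x \<Longrightarrow> bounded_by C (\<lambda>n. - x n)"
  by (simp add: bounded_by_def)

lemma seqs_0: "(\<lambda>n. 0) \<in> seqs"
  by (auto simp: seqs_def bounded_by_def)

lemma seqs_add:
  assumes "x \<in> seqs" "y \<in> seqs"
  shows "(\<lambda>n. x n + y n) \<in> seqs"
proof -
  obtain C D where "0 \<le> C" "bounded_by C x" "0 \<le> D" "bounded_by D y"
    using assms by (auto simp: seqs_def)
  then show ?thesis
    using bounded_by_add[of C x D y] by (auto simp: seqs_def intro!: exI[of _ "C + D"])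
qed

lemma seqs_uminus: "x \<in> seqs \<Longrightarrow> (\<lambda>n. - x n) \<in> seqs"
  by (simp add: seqs_def bounded_by_def)

lemma seqs_if_bounded_by:
  assumes "bounded_by C x"
  shows "x \<in> seqs"
proof -
  have "bounded_by (max C 0) x"
    using assms by (rule bounded_by_mono) simp
  moreover have "0 \<le> max C 0" by simp
  ultimately show ?thesis
    unfolding seqs_def by blast
qed

section \<open>The sequence group over the scalars and its completeness\<close>

context digit_ring
begin

lemma inj_iota: "\<iota> i = \<iota> j \<longleftrightarrow> i = j"
proof
  assume eq: "\<iota> i = \<iota> j"
  have "\<iota> i = \<iota> (i - j) \<oplus> \<iota> j" using iota_add[of "i - j" j] by simp
  then have "\<iota> (i - j) = \<zero>"
    using eq r_neg1[of "\<iota> j" "\<iota> (i - j)"] by (simp add: a_comm l_neg)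
  then show "i = j"
    using absval_iota_ge[of "i - j"] by (auto simp: absval_zero)
qed simp

text \<open>The group of the theorem has scalar sequences as elements, so integer sequences are
  transported along the injective additive map \<iota>. Distances and series are still computed on
  the integer side, through \<open>dec\<close>.\<close>

definition enc :: "(nat \<Rightarrow> int) \<Rightarrow> nat \<Rightarrow> 'k" where
  "enc x = (\<lambda>n. \<iota> (x n))"

definition dec :: "(nat \<Rightarrow> 'k) \<Rightarrow> nat \<Rightarrow> int" where
  "dec = inv_into UNIV enc"

lemma dec_enc [simp]: "dec (enc x) = x"
proof -
  have "inj enc" by (rule injI) (auto simp: enc_def fun_eq_iff inj_iota)
  then show ?thesis by (simp add: dec_def)
qed

definition seq_group :: "(nat \<Rightarrow> 'k) monoid" where
  "seq_group = \<lparr>carrier = enc ` seqs, monoid.mult = (\<lambda>a b n. a n \<oplus> b n), one = (\<lambda>n. \<zero>)\<rparr>"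

definition seq_topology :: "(nat \<Rightarrow> 'k) topology" where
  "seq_topology = Metric_space.mtopology (enc ` seqs) (\<lambda>a b. wdist (dec a) (dec b))"

lemma carrier_seq_group: "carrier seq_group = enc ` seqs"
  by (simp add: seq_group_def)

lemma enc_mult: "enc x \<otimes>\<^bsub>seq_group\<^esub> enc y = enc (\<lambda>n. x n + y n)"
  by (simp add: seq_group_def enc_def iota_add)

lemma enc_one: "\<one>\<^bsub>seq_group\<^esub> = enc (\<lambda>n. 0)"
  by (simp add: seq_group_def enc_def iota_0)

lemma comm_group_seq_group: "comm_group seq_group"
proof (rule comm_groupI)
  fix a b c assume "a \<in> carrier seq_group" "b \<in> carrier seq_group" "c \<in> carrier seq_group"
  then show "(a \<otimes>\<^bsub>seq_group\<^esub> b) \<otimes>\<^bsub>seq_group\<^esub> c = a \<otimes>\<^bsub>seq_group\<^esub> (b \<otimes>\<^bsub>seq_group\<^esub> c)"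
    by (auto simp: carrier_seq_group enc_mult add.assoc)
next
  fix a assume "a \<in> carrier seq_group"
  then obtain x where x: "x \<in> seqs" "a = enc x" by (auto simp: carrier_seq_group)
  then show "\<exists>b\<in>carrier seq_group. b \<otimes>\<^bsub>seq_group\<^esub> a = \<one>\<^bsub>seq_group\<^esub>"
    using seqs_uminus by (intro bexI[of _ "enc (\<lambda>n. - x n)"]) (auto simp: carrier_seq_group enc_mult enc_one)
qed (auto simp: carrier_seq_group enc_mult enc_one seqs_add seqs_0 add.commute)

sublocale seq: Metric_space "enc ` seqs" "\<lambda>a b. wdist (dec a) (dec b)"
proof unfold_locales
  fix a b assume "a \<in> enc ` seqs" "b \<in> enc ` seqs"
  then show "wdist (dec a) (dec b) = 0 \<longleftrightarrow> a = b"
    by (auto simp: wdist_eq_0_iff)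
qed (auto simp: wdist_nonneg wdist_commute wdist_triangle)

lemma enc_inv: "x \<in> seqs \<Longrightarrow> inv\<^bsub>seq_group\<^esub> (enc x) = enc (\<lambda>n. - x n)"
  using comm_group.axioms(2)[OF comm_group_seq_group]
  by (intro group.inv_equality) (auto simp: enc_mult enc_one carrier_seq_group seqs_uminus)

lemma topspace_seq_topology: "topspace seq_topology = enc ` seqs"
  by (simp add: seq_topology_def)

lemma mball_seq: "x \<in> seqs \<Longrightarrow> seq.mball (enc x) r = enc ` {y \<in> seqs. wdist x y < r}"
  by (auto simp: seq.mball_def)

lemma openin_seq_ball: "x \<in> seqs \<Longrightarrow> openin seq_topology (enc ` {y \<in> seqs. wdist x y < r})"
  using seq.openin_mball[of "enc x" r] by (simp add: mball_seq seq_topology_def)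

lemma openin_seq_topology:
  "openin seq_topology U \<longleftrightarrow> U \<subseteq> enc ` seqs \<and>
    (\<forall>x\<in>seqs. enc x \<in> U \<longrightarrow> (\<exists>r>0. \<forall>y\<in>seqs. wdist x y < r \<longrightarrow> enc y \<in> U))"
  (is "?L \<longleftrightarrow> ?U \<and> ?R")
proof -
  have ball: "seq.mball (enc x) r \<subseteq> U \<longleftrightarrow> (\<forall>y\<in>seqs. wdist x y < r \<longrightarrow> enc y \<in> U)" if "x \<in> seqs" for x r
    unfolding mball_seq[OF that] image_subset_iff by blast
  have "?L \<longleftrightarrow> ?U \<and> (\<forall>a. a \<in> U \<longrightarrow> (\<exists>r>0. seq.mball a r \<subseteq> U))"
    unfolding seq_topology_def seq.openin_mtopology ..
  also have "\<dots> \<longleftrightarrow> ?U \<and> (\<forall>x\<in>seqs. enc x \<in> U \<longrightarrow> (\<exists>r>0. seq.mball (enc x) r \<subseteq> U))"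
    by blast
  also have "\<dots> \<longleftrightarrow> ?U \<and> ?R"
    by (simp add: ball cong: ball_cong)
  finally show ?thesis .
qed

lemma topological_group_seq_group: "topological_group seq_group seq_topology"
proof -
  interpret comm_group seq_group by (rule comm_group_seq_group)
  show ?thesis
  proof
    show "topspace seq_topology = carrier seq_group"
      by (simp add: topspace_seq_topology carrier_seq_group)
    show "Hausdorff_space seq_topology"
      by (simp add: seq_topology_def seq.Hausdorff_space_mtopology)
    show "continuous_map seq_topology seq_topology (\<lambda>a. inv\<^bsub>seq_group\<^esub> a)"
      unfolding continuous_map_def
    proof (intro conjI allI impI)
      show "(\<lambda>a. inv\<^bsub>seq_group\<^esub> a) \<in> topspace seq_topology \<rightarrow> topspace seq_topology"
        using inv_closed by (auto simp: topspace_seq_topology carrier_seq_group)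
      fix U assume U: "openin seq_topology U"
      show "openin seq_topology {a \<in> topspace seq_topology. inv\<^bsub>seq_group\<^esub> a \<in> U}"
        unfolding openin_seq_topology
      proof (intro conjI ballI impI)
        fix x assume x: "x \<in> seqs" "enc x \<in> {a \<in> topspace seq_topology. inv\<^bsub>seq_group\<^esub> a \<in> U}"
        then have "enc (\<lambda>n. - x n) \<in> U" by (simp add: enc_inv)
        then obtain r where r: "r > 0" "\<And>y. y \<in> seqs \<Longrightarrow> wdist (\<lambda>n. - x n) y < r \<Longrightarrow> enc y \<in> U"
          using U seqs_uminus[OF x(1)] unfolding openin_seq_topology by blast
        show "\<exists>r>0. \<forall>y\<in>seqs. wdist x y < r \<longrightarrow> enc y \<in> {a \<in> topspace seq_topology. inv\<^bsub>seq_group\<^esub> a \<in> U}"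
          using r by (intro exI[of _ r]) (auto simp: topspace_seq_topology enc_inv seqs_uminus wdist_uminus)
      qed (auto simp: topspace_seq_topology)
    qed
    show "continuous_map (prod_topology seq_topology seq_topology) seq_topology (\<lambda>(a, b). a \<otimes>\<^bsub>seq_group\<^esub> b)"
      unfolding continuous_map_def
    proof (intro conjI allI impI)
      show "(\<lambda>(a, b). a \<otimes>\<^bsub>seq_group\<^esub> b) \<in> topspace (prod_topology seq_topology seq_topology) \<rightarrow> topspace seq_topology"
        using m_closed by (auto simp: topspace_seq_topology carrier_seq_group)
      fix U assume U: "openin seq_topology U"
      show "openin (prod_topology seq_topology seq_topology)
          {z \<in> topspace (prod_topology seq_topology seq_topology). (case z of (a, b) \<Rightarrow> a \<otimes>\<^bsub>seq_group\<^esub> b) \<in> U}"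
        unfolding openin_prod_topology_alt
      proof (intro allI impI)
        fix a b
        assume "(a, b) \<in> {z \<in> topspace (prod_topology seq_topology seq_topology). (case z of (a, b) \<Rightarrow> a \<otimes>\<^bsub>seq_group\<^esub> b) \<in> U}"
        then obtain x y where x: "x \<in> seqs" "a = enc x" and y: "y \<in> seqs" "b = enc y"
          and xy: "enc (\<lambda>n. x n + y n) \<in> U"
          by (auto simp: topspace_seq_topology enc_mult)
        obtain r where r: "r > 0" "\<And>z. z \<in> seqs \<Longrightarrow> wdist (\<lambda>n. x n + y n) z < r \<Longrightarrow> enc z \<in> U"
          using U seqs_add[OF x(1) y(1)] xy unfolding openin_seq_topology by blast
        let ?B = "\<lambda>x. enc ` {y \<in> seqs. wdist x y < r / 2}"
        have "enc x' \<otimes>\<^bsub>seq_group\<^esub> enc y' \<in> U"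
          if "x' \<in> seqs" "wdist x x' < r / 2" "y' \<in> seqs" "wdist y y' < r / 2" for x' y'
          unfolding enc_mult using r(2)[OF seqs_add] wdist_add[of x y x' y'] that by simp
        moreover have "wdist x x = 0" for x by (simp add: wdist_eq_0_iff)
        ultimately have "a \<in> ?B x" "b \<in> ?B y" "?B x \<times> ?B y \<subseteq>
            {z \<in> topspace (prod_topology seq_topology seq_topology). (case z of (a, b) \<Rightarrow> a \<otimes>\<^bsub>seq_group\<^esub> b) \<in> U}"
          using r(1) x y by (auto simp: topspace_seq_topology)
        then show "\<exists>A B. openin seq_topology A \<and> openin seq_topology B \<and> a \<in> A \<and> b \<in> B \<and>
            A \<times> B \<subseteq> {z \<in> topspace (prod_topology seq_topology seq_topology). (case z of (a, b) \<Rightarrow> a \<otimes>\<^bsub>seq_group\<^esub> b) \<in> U}"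
          using openin_seq_ball[OF x(1)] openin_seq_ball[OF y(1)] by blast
      qed
    qed
  qed
qed

text \<open>Integrality makes each coordinate eventually constant along a Cauchy filter; these
  constants form the limit. What remains is that the convergence is uniform in the weighted norm and
  that the limit again has linear growth.\<close>

lemma complete_seq_group: "complete_group seq_group seq_topology"
  unfolding complete_group_def
proof (intro allI impI)
  fix F assume "cauchy_group_filter seq_group seq_topology F"
  then have F: "F \<noteq> bot" "eventually (\<lambda>a. a \<in> enc ` seqs) F"
    and cau: "\<And>U. openin seq_topology U \<Longrightarrow> enc (\<lambda>n. 0) \<in> U \<Longrightarrow>
        eventually (\<lambda>(a, b). inv\<^bsub>seq_group\<^esub> a \<otimes>\<^bsub>seq_group\<^esub> b \<in> U) (F \<times>\<^sub>F F)"
    by (auto simp: cauchy_group_filter_def carrier_seq_group enc_one)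
  have close: "\<exists>P. eventually P F \<and> (\<forall>a b. P a \<longrightarrow> P b \<longrightarrow> a \<in> enc ` seqs \<and> b \<in> enc ` seqs \<and> wdist (dec a) (dec b) < r)"
    if r: "r > 0" for r
  proof -
    have "openin seq_topology (enc ` {y \<in> seqs. wdist (\<lambda>n. 0) y < r})"
      using openin_seq_ball[OF seqs_0] .
    moreover have "enc (\<lambda>n. 0) \<in> enc ` {y \<in> seqs. wdist (\<lambda>n. 0) y < r}"
      using r seqs_0 wdist_eq_0_iff[of "\<lambda>n. 0" "\<lambda>n. 0"] by (intro imageI) simp
    ultimately have "eventually (\<lambda>(a, b). inv\<^bsub>seq_group\<^esub> a \<otimes>\<^bsub>seq_group\<^esub> b \<in> enc ` {y \<in> seqs. wdist (\<lambda>n. 0) y < r}) (F \<times>\<^sub>F F)"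
      by (rule cau)
    then have "\<exists>P. eventually P F \<and> (\<forall>a b. P a \<longrightarrow> P b \<longrightarrow>
        inv\<^bsub>seq_group\<^esub> a \<otimes>\<^bsub>seq_group\<^esub> b \<in> enc ` {y \<in> seqs. wdist (\<lambda>n. 0) y < r})"
      by (simp only: eventually_prod_same prod.case)
    then obtain P where P: "eventually P F"
      "\<And>a b. P a \<Longrightarrow> P b \<Longrightarrow> inv\<^bsub>seq_group\<^esub> a \<otimes>\<^bsub>seq_group\<^esub> b \<in> enc ` {y \<in> seqs. wdist (\<lambda>n. 0) y < r}"
      by blast
    have "wdist x y < r" if "P (enc x)" "P (enc y)" "x \<in> seqs" "y \<in> seqs" for x y
    proof -
      have "enc (\<lambda>n. - x n + y n) \<in> enc ` {y \<in> seqs. wdist (\<lambda>n. 0) y < r}"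
        using P(2)[OF that(1,2)] that by (simp add: enc_inv enc_mult)
      then have "wdist (\<lambda>n. 0) (\<lambda>n. - x n + y n) < r"
        by (metis (no_types, lifting) dec_enc image_iff mem_Collect_eq)
      then show ?thesis
        using wdist_translate[of "\<lambda>n. 0" x "\<lambda>n. - x n + y n"] by simp
    qed
    then show ?thesis
      using P(1) F(2)
      by (intro exI[of _ "\<lambda>a. P a \<and> a \<in> enc ` seqs"]) (auto intro: eventually_conj)
  qed
  \<comment> \<open>At distance less than 1 / (n + 1) the n-th entries differ by less than 1, hence
    agree.\<close>
  have "\<exists>c. eventually (\<lambda>a. dec a n = c) F" for n
  proof -
    have "1 / (real n + 1) > 0" by simp
    from close[OF this] obtain P where P: "eventually P F"
      "\<And>a b. P a \<Longrightarrow> P b \<Longrightarrow> wdist (dec a) (dec b) < 1 / (real n + 1)" by blast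
    obtain a where a: "P a" using eventually_happens'[OF F(1) P(1)] by blast
    have "dec b n = dec a n" if "P b" for b
      using wdist_less_imp[OF P(2)[OF a that], of n] by simp
    then show ?thesis
      using P(1) by (intro exI[of _ "dec a n"]) (auto elim: eventually_mono)
  qed
  then obtain c where c: "\<And>n. eventually (\<lambda>a. dec a n = c n) F" by metis
  \<comment> \<open>For each n some member \<open>b\<close> of the same small set already has n-th
    entry c n. The bound on the distance of \<open>a\<close> to \<open>b\<close> does not depend on
    n, although \<open>b\<close> does.\<close>
  have near: "\<exists>P. eventually P F \<and> (\<forall>a. P a \<longrightarrow> a \<in> enc ` seqs \<and> bounded_by r (\<lambda>n. dec a n - c n))"
    if r: "r > 0" "r \<le> 1" for r
  proof -
    obtain P where P: "eventually P F"
      "\<And>a b. P a \<Longrightarrow> P b \<Longrightarrow> a \<in> enc ` seqs \<and> wdist (dec a) (dec b) < r" using close[OF r(1)] by blast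
    have "bounded_by r (\<lambda>n. dec a n - c n)" if a: "P a" for a
      unfolding bounded_by_def
    proof
      fix n
      have "eventually (\<lambda>b. P b \<and> dec b n = c n) F" using P(1) c by (rule eventually_conj)
      then obtain b where b: "P b" "dec b n = c n" using eventually_happens'[OF F(1)] by blast
      then show "\<bar>real_of_int (dec a n - c n)\<bar> \<le> r * (real n + 1)"
        using wdist_less_imp[of "dec a" "dec b" r n] P(2)[OF a b(1)] r by simp
    qed
    then show ?thesis using P by blast
  qed
  obtain P where P: "eventually P F" "\<And>a. P a \<Longrightarrow> a \<in> enc ` seqs \<and> bounded_by 1 (\<lambda>n. dec a n - c n)"
    using near[of 1] by auto
  obtain a where a: "P a" using eventually_happens'[OF F(1) P(1)] by blast
  \<comment> \<open>Linear growth of \<open>c\<close> follows from c = a - (a - c), where a - c is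
    bounded by the weight.\<close>
  have "(\<lambda>n. dec a n + - (dec a n - c n)) \<in> seqs"
    using P(2)[OF a] by (intro seqs_add bounded_by_uminus[THEN seqs_if_bounded_by]) auto
  then have cs: "c \<in> seqs" by simp
  have "limitin seq_topology (\<lambda>a. a) (enc c) F"
    unfolding seq_topology_def seq.limitin_metric
  proof (intro conjI allI impI)
    show "enc c \<in> enc ` seqs" using cs by blast
    fix \<epsilon> :: real assume "\<epsilon> > 0"
    then have r: "min 1 (\<epsilon> / 2) > 0" "min 1 (\<epsilon> / 2) \<le> 1" "min 1 (\<epsilon> / 2) < \<epsilon>" by auto
    obtain P where P: "eventually P F"
      "\<And>a. P a \<Longrightarrow> a \<in> enc ` seqs \<and> bounded_by (min 1 (\<epsilon> / 2)) (\<lambda>n. dec a n - c n)"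
      using near[OF r(1,2)] by blast
    show "eventually (\<lambda>a. a \<in> enc ` seqs \<and> wdist (dec a) (dec (enc c)) < \<epsilon>) F"
      using P(1) by (rule eventually_mono) (use P(2) wdist_le_if_bounded_by r(3) in fastforce)
  qed
  then show "\<exists>l. limitin seq_topology (\<lambda>a. a) l F" by blast
qed

section \<open>Series as open homomorphisms, and the failure of the filter basis property\<close>

lemma seqsE:
  assumes "x \<in> seqs"
  obtains C where "0 \<le> C" "bounded_by C x"
  using assms unfolding seqs_def by blast

lemma series_hom:
  assumes v: "geometric_coeffs v" and "x \<in> seqs" "y \<in> seqs"
  shows "series v x \<in> carrier K" "series v (\<lambda>n. x n + y n) = series v x \<oplus> series v y"
proof -
  obtain C D where C: "bounded_by C x" "bounded_by D y" using assms(2,3) by (metis seqsE)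
  show "series v x \<in> carrier K" using series_closed[OF v C(1)] .
  show "series v (\<lambda>n. x n + y n) = series v x \<oplus> series v y" using series_add[OF v C] .
qed

lemma series_diff:
  assumes v: "geometric_coeffs v" and "x \<in> seqs" "y \<in> seqs"
  shows "series v x \<ominus> series v y = series v (\<lambda>n. x n - y n)"
proof -
  have d: "(\<lambda>n. x n - y n) \<in> seqs"
    using seqs_add[OF assms(2) seqs_uminus[OF assms(3)]] by simp
  have "series v x = series v (\<lambda>n. x n - y n) \<oplus> series v y"
    using series_hom(2)[OF v d assms(3)] by simp
  then show ?thesis
    using series_hom(1)[OF v d assms(3)] series_hom(1)[OF v assms(3,3)]
    by (simp add: a_minus_def a_assoc r_neg)
qed

text \<open>Continuity comes from \<open>series_bound\<close>, openness from translating
  \<open>series_surj_near_zero\<close> to an arbitrary point of the open set.\<close>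

lemma series_kernel_in_lie_quotient_kernels:
  assumes v: "geometric_coeffs v"
    and slow: "\<And>n. absval K \<beta> * absval K (v n) \<le> absval K (v (Suc n))"
    and pos: "\<And>n. 0 < absval K (v n)"
  shows "{a \<in> carrier seq_group. series v (dec a) = \<zero>} \<in> lie_quotient_kernels K seq_group seq_topology"
proof (rule kernel_in_lie_quotient_kernels[OF topological_group_seq_group comm_group_seq_group])
  show "(\<lambda>a. series v (dec a)) \<in> carrier seq_group \<rightarrow> carrier K"
    using series_hom(1)[OF v] by (auto simp: carrier_seq_group)
  show "series v (dec (a \<otimes>\<^bsub>seq_group\<^esub> b)) = series v (dec a) \<oplus> series v (dec b)"
    if "a \<in> carrier seq_group" "b \<in> carrier seq_group" for a b
    using that series_hom(2)[OF v] by (auto simp: carrier_seq_group enc_mult)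
  show "continuous_map seq_topology (field_topology K) (\<lambda>a. series v (dec a))"
    unfolding field_topology_def metric.continuous_map_to_metric
  proof (intro ballI allI impI)
    fix a and \<epsilon> :: real assume "a \<in> topspace seq_topology" and \<epsilon>: "\<epsilon> > 0"
    then obtain x where x: "x \<in> seqs" "a = enc x" by (auto simp: topspace_seq_topology)
    define W where "W = suminf wt"
    have W: "0 \<le> W" unfolding W_def using summable_wt wt_nonneg by (rule suminf_nonneg)
    \<comment> \<open>At most 1, where \<open>wdist\<close> controls the weighted norm; the summand
      1 keeps the denominator positive and makes c W < \<epsilon> strict.\<close>
    define c where "c = min 1 (\<epsilon> / (W + 1))"
    have c: "0 < c" "c \<le> 1" using \<epsilon> W by (auto simp: c_def)
    have "c * W < \<epsilon>"
    proof -
      have "c * W \<le> \<epsilon> / (W + 1) * W" using W by (intro mult_right_mono) (auto simp: c_def)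
      also have "\<dots> < \<epsilon>" using W \<epsilon> by (simp add: field_simps)
      finally show ?thesis .
    qed
    have "series v y \<in> metric.mball (series v x) \<epsilon>" if y: "y \<in> seqs" "wdist x y < c" for y
    proof -
      have "absval K (series v x \<ominus> series v y) \<le> c * W"
        unfolding series_diff[OF v x(1) y(1)] W_def
        using bounded_by_if_wdist_less[OF y(2) c(2)] c(1) by (intro series_bound[OF v]) auto
      then show ?thesis
        using \<open>c * W < \<epsilon>\<close> series_hom(1)[OF v] x y by (simp add: field_dist_def)
    qed
    moreover have "wdist x x < c" using c wdist_eq_0_iff[of x x] by simp
    ultimately show "\<exists>U. openin seq_topology U \<and> a \<in> U \<and>
        (\<forall>b\<in>U. series v (dec b) \<in> metric.mball (series v (dec a)) \<epsilon>)"
      using openin_seq_ball[OF x(1), of c] x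
      by (intro exI[of _ "enc ` {y \<in> seqs. wdist x y < c}"]) auto
  qed
  show "open_map seq_topology (field_topology K) (\<lambda>a. series v (dec a))"
    unfolding open_map_def
  proof (intro allI impI)
    fix U assume U: "openin seq_topology U"
    show "openin (field_topology K) ((\<lambda>a. series v (dec a)) ` U)"
      unfolding field_topology_def metric.openin_mtopology
    proof (intro conjI allI impI)
      show "(\<lambda>a. series v (dec a)) ` U \<subseteq> carrier K"
        using U series_hom(1)[OF v] by (auto simp: openin_seq_topology)
      fix b assume "b \<in> (\<lambda>a. series v (dec a)) ` U"
      then obtain x where x: "x \<in> seqs" "enc x \<in> U" "b = series v x"
        using U by (auto simp: openin_seq_topology)
      then obtain r where r: "r > 0" "\<And>y. y \<in> seqs \<Longrightarrow> wdist x y < r \<Longrightarrow> enc y \<in> U"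
        using U unfolding openin_seq_topology by blast
      \<comment> \<open>Halved because a sequence bounded by r / 2 only gives the non-strict
        distance bound r / 2, while U contains the open ball of radius r.\<close>
      have "r / 2 > 0" using r by simp
      then obtain \<delta> where \<delta>: "\<delta> > 0"
        "\<forall>a\<in>carrier K. absval K a < \<delta> \<longrightarrow> (\<exists>z. bounded_by (r / 2) z \<and> series v z = a)"
        using series_surj_near_zero[OF v slow pos \<open>r / 2 > 0\<close>] by (elim exE conjE) (rule that)
      have "c \<in> (\<lambda>a. series v (dec a)) ` U" if c: "c \<in> metric.mball b \<delta>" for c
      proof -
        have c': "c \<in> carrier K" "b \<in> carrier K" "absval K (c \<ominus> b) < \<delta>"
          using c metric.commute[of b c] by (auto simp: field_dist_def)
        then obtain z where z: "bounded_by (r / 2) z" "series v z = c \<ominus> b"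
          using bspec[OF \<delta>(2), of "c \<ominus> b"] by auto
        have zs: "z \<in> seqs" using z(1) by (rule seqs_if_bounded_by)
        have "series v (\<lambda>n. x n + z n) = b \<oplus> (c \<ominus> b)"
          using series_hom(2)[OF v x(1) zs] z x by simp
        also have "\<dots> = c"
          using c' by (simp add: a_minus_def a_lcomm[of b c] r_neg)
        finally have eq: "series v (\<lambda>n. x n + z n) = c" .
        have "bounded_by (r / 2) (\<lambda>n. x n - (x n + z n))"
          using z(1) by (simp add: bounded_by_def)
        then have "wdist x (\<lambda>n. x n + z n) \<le> r / 2"
          by (rule wdist_le_if_bounded_by)
        then have "enc (\<lambda>n. x n + z n) \<in> U"
          using r seqs_add[OF x(1) zs] by simp
        then show ?thesis
          using eq by (intro image_eqI[of _ _ "enc (\<lambda>n. x n + z n)"]) simp_all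
      qed
      then show "\<exists>r>0. metric.mball b r \<subseteq> (\<lambda>a. series v (dec a)) ` U"
        using \<delta>(1) by blast
    qed
  qed
qed

text \<open>A compact neighbourhood in the quotient contains the cosets of all sequences
  \<open>z k\<close>, which have a single nonzero entry each. Finitely many images of small balls
  cover it, so two of the cosets fall into one image, that is, z k and z l are close up to p - q
  with p, q in \<open>P\<close>. Discreteness forces p = q, and then z k and z l are themselves
  close, which their k-th entries contradict.\<close>

lemma discrete_not_in_lie_quotient_kernels:
  assumes P: "P \<in> lie_quotient_kernels K seq_group seq_topology"
    and disc: "\<And>x. enc x \<in> P \<Longrightarrow> bounded_by 1 x \<Longrightarrow> x = (\<lambda>_. 0)"
  shows False
proof -
  interpret G: topological_group seq_group seq_topology by (rule topological_group_seq_group)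
  let ?Q = "quotient_topology seq_group seq_topology P"
  have nP: "P \<lhd> seq_group" and lie: "lie_group K (seq_group Mod P) ?Q"
    using P by (auto simp: lie_quotient_kernels_def)
  have sg: "subgroup P seq_group" using nP by (rule normal_imp_subgroup)
  have Psub: "P \<subseteq> enc ` seqs" using subgroup.subset[OF sg] by (simp add: carrier_seq_group)
  have Padd: "enc (\<lambda>n. x n - y n) \<in> P" if "enc x \<in> P" "enc y \<in> P" for x y
  proof -
    have "y \<in> seqs" using Psub that(2) by (metis dec_enc image_iff subsetD)
    then have "enc x \<otimes>\<^bsub>seq_group\<^esub> inv\<^bsub>seq_group\<^esub> (enc y) \<in> P"
      using that subgroup.m_closed[OF sg] subgroup.m_inv_closed[OF sg] by blast
    then show ?thesis using \<open>y \<in> seqs\<close> by (simp add: enc_inv enc_mult)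
  qed
  have top: "topspace ?Q = rcosets\<^bsub>seq_group\<^esub> P"
    by (rule G.topspace_quotient_topology[OF sg])
  have one_in: "enc (\<lambda>n. 0) \<in> P" using subgroup.one_closed[OF sg] by (simp add: enc_one)
  have P_coset: "P \<in> rcosets\<^bsub>seq_group\<^esub> P"
    using G.coset_mult_one[OF subgroup.subset[OF sg]] G.one_closed unfolding RCOSETS_def by blast
  have "locally_compact_space ?Q"
    by (rule lie_group_imp_locally_compact_space[OF locally_compact_field_topology lie])
  then obtain W C where W: "openin ?Q W" "compactin ?Q C" "P \<in> W" "W \<subseteq> C"
    using P_coset unfolding locally_compact_space_def top by blast
  have "openin seq_topology (\<Union>W)"
    using W(1) by (simp add: G.openin_quotient_topology[OF sg])
  moreover have "enc (\<lambda>n. 0) \<in> \<Union>W" using W(3) one_in by blast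
  ultimately obtain r where r: "r > 0" "\<And>y. y \<in> seqs \<Longrightarrow> wdist (\<lambda>n. 0) y < r \<Longrightarrow> enc y \<in> \<Union>W"
    using seqs_0 unfolding openin_seq_topology by blast
  \<comment> \<open>The bound 1/2 ensures e / 4 + e \<le> 1, the range in which \<open>disc\<close>
    applies to p - q.\<close>
  define e where "e = min r (1 / 2)"
  have e: "0 < e" "e \<le> 1 / 2" "e \<le> r" using r(1) by (auto simp: e_def)
  \<comment> \<open>Norm at most e / 2, hence less than r, puts \<open>z k\<close> into the
    neighbourhood, and differences of two such sequences are bounded by e.\<close>
  define z where "z k = (\<lambda>n. if n = k then \<lfloor>e * (real k + 1) / 2\<rfloor> else 0)" for k :: nat
  have floor_abs: "\<bar>real_of_int \<lfloor>t\<rfloor>\<bar> \<le> t" if "0 \<le> t" for t :: real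
    using that of_int_floor_le[of t] zero_le_floor[of t] by simp
  have z_le: "bounded_by (e / 2) (z k)" for k
    unfolding bounded_by_def
  proof
    fix n
    have "0 \<le> e * (real k + 1) / 2" using e(1) by simp
    then have "\<bar>real_of_int \<lfloor>e * (real k + 1) / 2\<rfloor>\<bar> \<le> e * (real k + 1) / 2"
      by (rule floor_abs)
    then show "\<bar>real_of_int (z k n)\<bar> \<le> e / 2 * (real n + 1)"
      using e(1) by (simp add: z_def)
  qed
  have zs: "z k \<in> seqs" for k using z_le by (rule seqs_if_bounded_by)
  have z_diff: "bounded_by e (\<lambda>n. z k n - z l n)" for k l
    using bounded_by_add[OF z_le[of k] bounded_by_uminus[OF z_le[of l]]] by simp
  have z_W: "P #>\<^bsub>seq_group\<^esub> enc (z k) \<in> C" for k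
  proof -
    have "wdist (\<lambda>n. 0) (z k) \<le> e / 2"
      using bounded_by_uminus[OF z_le] by (intro wdist_le_if_bounded_by) simp
    then have "enc (z k) \<in> \<Union>W" using r(2)[OF zs] e by simp
    then obtain X where X: "X \<in> W" "enc (z k) \<in> X" by blast
    have "X \<in> rcosets\<^bsub>seq_group\<^esub> P" using openin_subset[OF W(1)] X(1) top by blast
    then show ?thesis
      using G.rcosets_eq_coset_of_element(1)[OF sg _ X(2)] X(1) W(4) by blast
  qed
  \<comment> \<open>The image of the ball of radius e / 8 around \<open>y\<close> in the quotient.
    Cosets in one such image have representatives at distance less than e / 4.\<close>
  define N where "N y = {X \<in> rcosets\<^bsub>seq_group\<^esub> P. X \<inter> enc ` {w \<in> seqs. wdist y w < e / 8} \<noteq> {}}" for y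
  have N_open: "openin ?Q (N y)" if "y \<in> seqs" for y
    unfolding N_def by (rule G.openin_cosets_meeting[OF sg openin_seq_ball[OF that]])
  have "C \<subseteq> \<Union>(N ` seqs)"
  proof
    fix X assume "X \<in> C"
    then have X: "X \<in> rcosets\<^bsub>seq_group\<^esub> P" using compactin_subset_topspace[OF W(2)] top by blast
    obtain a where a: "a \<in> X" using G.rcosets_nonempty[OF sg X] by blast
    then obtain y where y: "y \<in> seqs" "a = enc y"
      using G.rcosets_eq_coset_of_element(2)[OF sg X a] by (auto simp: carrier_seq_group)
    have "y \<in> {w \<in> seqs. wdist y w < e / 8}" using y e wdist_eq_0_iff[of y y] by simp
    then have "X \<in> N y" using X a y(2) unfolding N_def by blast
    then show "X \<in> \<Union>(N ` seqs)" using y(1) by blast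
  qed
  then obtain F where F: "finite F" "F \<subseteq> N ` seqs" "C \<subseteq> \<Union>F"
    using compactinD[OF W(2), of "N ` seqs"] N_open by blast
  \<comment> \<open>For small k the rounding may make \<open>z k\<close> vanish. From k0 on, e (k +
    1) > 4 holds, so the loss of at most 1 by rounding down leaves an entry larger than e (k + 1) /
    4.\<close>
  obtain k0 :: nat where k0: "8 / e < real k0" using reals_Archimedean2 by blast
  have "\<forall>k\<in>{k0..}. \<exists>A\<in>F. P #>\<^bsub>seq_group\<^esub> enc (z k) \<in> A"
    using z_W F(3) by blast
  then obtain A where A: "A \<in> F" "infinite {k \<in> {k0..}. P #>\<^bsub>seq_group\<^esub> enc (z k) \<in> A}"
    using pigeonhole_infinite_rel[of "{k0..}" F "\<lambda>k A. P #>\<^bsub>seq_group\<^esub> enc (z k) \<in> A"] F(1) infinite_Ici[of k0]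
    by auto
  obtain k where k: "k \<ge> k0" "P #>\<^bsub>seq_group\<^esub> enc (z k) \<in> A"
    using A(2) not_finite_existsD by blast
  have "infinite ({k \<in> {k0..}. P #>\<^bsub>seq_group\<^esub> enc (z k) \<in> A} - {k})" using A(2) by simp
  then obtain l where "l \<in> {k \<in> {k0..}. P #>\<^bsub>seq_group\<^esub> enc (z k) \<in> A} - {k}"
    using infinite_imp_nonempty by blast
  then have l: "l \<noteq> k" "P #>\<^bsub>seq_group\<^esub> enc (z l) \<in> A"
    by simp_all
  obtain y where y: "y \<in> seqs" "A = N y" using F(2) A(1) by blast
  have near: "\<exists>p. enc p \<in> P \<and> wdist y (\<lambda>n. p n + z i n) < e / 8"
    if "P #>\<^bsub>seq_group\<^esub> enc (z i) \<in> A" for i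
  proof -
    obtain w where w: "enc w \<in> P #>\<^bsub>seq_group\<^esub> enc (z i)" "wdist y w < e / 8"
      using \<open>P #>\<^bsub>seq_group\<^esub> enc (z i) \<in> A\<close> y(2) unfolding N_def by auto
    obtain q where q: "q \<in> P" "enc w = q \<otimes>\<^bsub>seq_group\<^esub> enc (z i)"
      using w(1) unfolding r_coset_def by blast
    obtain p where p: "q = enc p" using q(1) Psub by blast
    have "w = (\<lambda>n. p n + z i n)"
      using q(2) unfolding p enc_mult by (metis dec_enc)
    then show ?thesis using w(2) q(1) p by blast
  qed
  obtain p q where pq: "enc p \<in> P" "wdist y (\<lambda>n. p n + z k n) < e / 8"
      "enc q \<in> P" "wdist y (\<lambda>n. q n + z l n) < e / 8"
    using near[OF k(2)] near[OF l(2)] by blast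
  have "wdist (\<lambda>n. p n + z k n) (\<lambda>n. q n + z l n) < e / 4"
    using wdist_triangle[of "\<lambda>n. p n + z k n" "\<lambda>n. q n + z l n" y] pq
      wdist_commute[of y "\<lambda>n. p n + z k n"] by simp
  then have close: "bounded_by (e / 4) (\<lambda>n. p n + z k n - (q n + z l n))"
    using e by (intro bounded_by_if_wdist_less) auto
  have "bounded_by (e / 4 + e) (\<lambda>n. p n - q n)"
    using bounded_by_add[OF close z_diff[of l k]] by (simp add: algebra_simps)
  then have "bounded_by 1 (\<lambda>n. p n - q n)"
    by (rule bounded_by_mono) (use e in simp)
  then have "(\<lambda>n. p n - q n) = (\<lambda>_. 0)"
    using disc Padd[OF pq(1,3)] by blast
  then have "p n = q n" for n
    by (metis right_minus_eq)
  then have "bounded_by (e / 4) (\<lambda>n. z k n - z l n)"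
    using close by simp
  then have "\<bar>real_of_int (z k k - z l k)\<bar> \<le> e / 4 * (real k + 1)"
    by (simp add: bounded_by_def)
  then have "real_of_int \<lfloor>e * (real k + 1) / 2\<rfloor> \<le> e / 4 * (real k + 1)"
    using l(1) by (simp add: z_def)
  moreover have "e * (real k + 1) / 2 - 1 < real_of_int \<lfloor>e * (real k + 1) / 2\<rfloor>"
    by (rule real_of_int_floor_gt_diff_one)
  moreover have "4 < e * (real k + 1) "
  proof -
    have "8 < e * real k0" using k0 e by (simp add: field_simps)
    also have "\<dots> \<le> e * (real k + 1)" using k(1) e by (intro mult_left_mono) auto
    finally show ?thesis by simp
  qed
  moreover have False if "f \<le> e / 4 * K" "e * K / 2 - 1 < f" "4 < e * K" for f K
    using that by (simp add: field_simps)
  ultimately show False by blast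
qed

theorem seq_group_counterexample:
  "\<exists>(G :: (nat \<Rightarrow> 'k) monoid) T. topological_group G T \<and> comm_group G \<and> complete_group G T \<and>
     \<not> filter_basis (lie_quotient_kernels K G T)"
proof (intro exI conjI)
  define b where "b = absval K \<beta>"
  have b: "0 < b" "b \<le> 1 / 2" using absval_beta by (auto simp: b_def)
  define v where "v n = \<beta> [^] n" for n :: nat
  define u where "u n = \<beta> [^] ((n + 1)\<^sup>2)" for n :: nat
  define w where "w n = v n \<ominus> u n" for n
  have cl: "v n \<in> carrier K" "u n \<in> carrier K" "w n \<in> carrier K" for n
    by (auto simp: v_def u_def w_def)
  have av: "absval K (v n) = b ^ n" and au: "absval K (u n) = b ^ (n + 1)\<^sup>2" for n
    by (auto simp: v_def u_def absval_beta_power b_def)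
  have bp: "b ^ n \<le> (1 / 2) ^ n" for n
    using b by (intro power_mono) auto
  have ub: "b ^ (n + 1)\<^sup>2 \<le> b ^ n" for n
    using b by (intro power_decreasing) (auto simp: power2_eq_square)
  have v: "geometric_coeffs v"
    using bp cl by (auto simp: geometric_coeffs_def av intro: order_trans[OF bp])
  have u: "geometric_coeffs u"
    unfolding geometric_coeffs_def
  proof (intro allI conjI)
    fix n
    have "b ^ (n + 1)\<^sup>2 \<le> (1 / 2) ^ n" using ub bp by (rule order_trans)
    then show "absval K (u n) \<le> 2 * (1 / 2) ^ n" unfolding au using zero_le_power[of "1 / 2 :: real" n] by linarith
  qed (rule cl)
  have w: "geometric_coeffs w"
    unfolding geometric_coeffs_def
  proof (intro allI conjI)
    fix n
    have "absval K (w n) \<le> b ^ n + b ^ (n + 1)\<^sup>2"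
      using absval_add[of "v n" "\<ominus> u n"] cl absval_a_inv[of "u n"] by (simp add: w_def a_minus_def av au)
    also have "\<dots> \<le> (1 / 2) ^ n + (1 / 2) ^ n"
      using ub[of n] bp[of n] by linarith
    finally show "absval K (w n) \<le> 2 * (1 / 2) ^ n" by simp
  qed (rule cl)
  \<comment> \<open>As (n + 1)^2 = n + (n^2 + n + 1), the coefficient of g factors as \<beta> ^ n (1
    - \<beta> ^ (n^2 + n + 1)). Since c is monotone, the second factor does not shrink with n, so
    the decay is no faster than that of \<beta> ^ n.\<close>
  define c where "c k = absval K (\<one> \<ominus> \<beta> [^] k)" for k :: nat
  have aw: "absval K (w n) = b ^ n * c (n\<^sup>2 + n + 1)" for n
  proof -
    have "w n = v n \<otimes> (\<one> \<ominus> \<beta> [^] (n\<^sup>2 + n + 1))"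
    proof -
      have "(n + 1)\<^sup>2 = n + (n\<^sup>2 + n + 1)" by (simp add: power2_eq_square)
      then have "u n = \<beta> [^] n \<otimes> \<beta> [^] (n\<^sup>2 + n + 1)"
        unfolding u_def nat_pow_mult[OF beta_closed] by (rule arg_cong)
      then show ?thesis
        unfolding w_def v_def a_minus_def by (simp add: r_distr r_minus del: nat_pow_Suc)
    qed
    then show ?thesis
      using cl by (simp add: absval_mult av c_def)
  qed
  have c_mono: "c k \<le> c l" if "k \<le> l" for k l
    using that by (simp add: c_def absval_one_minus_mono)
  \<comment> \<open>For k = 1 this is the triangle inequality 1 \<le> |1 - \<beta>| + |\<beta>| with
    |\<beta>| \<le> 1/2; monotonicity gives the rest.\<close>
  have c_pos: "0 < c k" if "1 \<le> k" for k
  proof -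
    have "1 \<le> absval K (\<one> \<ominus> \<beta>) + b"
      using absval_diff_triangle[of \<one> \<beta> \<zero>] by (simp add: absval_one b_def a_minus_def)
    then have "0 < c 1" using b by (simp add: c_def)
    then show ?thesis using c_mono[OF that] by linarith
  qed
  let ?M = "\<lambda>v. {a \<in> carrier seq_group. series v (dec a) = \<zero>}"
  have M: "?M v \<in> lie_quotient_kernels K seq_group seq_topology"
    using b by (intro series_kernel_in_lie_quotient_kernels v) (simp_all add: av flip: b_def)
  have N: "?M w \<in> lie_quotient_kernels K seq_group seq_topology"
  proof (rule series_kernel_in_lie_quotient_kernels[OF w])
    fix n :: nat
    have "c (n\<^sup>2 + n + 1) \<le> c ((Suc n)\<^sup>2 + Suc n + 1)"
      by (rule c_mono) (simp add: power2_eq_square)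
    then show "absval K \<beta> * absval K (w n) \<le> absval K (w (Suc n))"
      unfolding aw using b by (simp add: b_def[symmetric] mult_left_mono)
    show "0 < absval K (w n)"
      unfolding aw using b c_pos[of "n\<^sup>2 + n + 1"] by simp
  qed
  show "\<not> filter_basis (lie_quotient_kernels K seq_group seq_topology)"
  proof
    assume "filter_basis (lie_quotient_kernels K seq_group seq_topology)"
    then obtain P where P: "P \<in> lie_quotient_kernels K seq_group seq_topology" "P \<subseteq> ?M v \<inter> ?M w"
      using M N unfolding filter_basis_def by blast
    show False
    proof (rule discrete_not_in_lie_quotient_kernels[OF P(1)])
      fix x assume x: "enc x \<in> P" "bounded_by 1 x"
      then have "series v x = \<zero>" "series w x = \<zero>" using P(2) by auto
      moreover have "series v x = series w x \<oplus> series u x"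
        using cl by (intro series_coeff_add[OF w u v x(2)]) (simp add: w_def a_minus_def a_assoc l_neg)
      ultimately have "series u x = \<zero>"
        using series_closed[OF u x(2)] by simp
      then show "x = (\<lambda>_. 0)"
        using lacunary_series_nonzero[OF u_def u x(2)] by simp
    qed
  qed
qed (rule topological_group_seq_group comm_group_seq_group complete_seq_group)+

end

section \<open>The p-adic numbers\<close>

context
  fixes p :: nat
  assumes prime_p: "prime p"
begin

section \<open>The p-adic absolute value on the rationals\<close>

lemma prime_elem_int_p: "prime_elem (int p)"
  using prime_p by auto

lemma p_ge_2: "2 \<le> real p"
  using prime_ge_2_nat[OF prime_p] by simp

lemma not_unit_p: "\<not> is_unit (int p)"
  using prime_gt_1_nat[OF prime_p] by simp

lemma rat_as_fraction:
  fixes x :: rat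
  obtains a b :: int where "x = of_int a / of_int b" "b > 0" "coprime a b"
  using quotient_of_div quotient_of_denom_pos quotient_of_coprime by (metis surj_pair)

text \<open>The definition refers to lowest terms. Comparing multiplicities in a d = c b shows that
  every other fraction gives the same exponent, which frees later proofs from reducing
  fractions.\<close>

lemma padic_abs_fraction:
  assumes "a \<noteq> 0" "b \<noteq> 0"
  shows "padic_abs p (of_int a / of_int b) =
    real p powi (int (multiplicity (int p) b) - int (multiplicity (int p) a))"
proof -
  obtain c d where cd: "quotient_of (of_int a / of_int b) = (c, d)"
    by (metis surj_pair)
  then have d: "d > 0" and eq: "(of_int a / of_int b :: rat) = of_int c / of_int d"
    using quotient_of_denom_pos quotient_of_div by blast+
  then have "(of_int (a * d) :: rat) = of_int (c * b)"
    using assms by (simp add: field_simps)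
  then have "a * d = c * b"
    by (simp only: of_int_eq_iff)
  then have "multiplicity (int p) (a * d) = multiplicity (int p) (c * b)" and c: "c \<noteq> 0"
    using assms d by auto
  then have "multiplicity (int p) a + multiplicity (int p) d = multiplicity (int p) c + multiplicity (int p) b"
    using assms d by (simp add: prime_elem_multiplicity_mult_distrib[OF prime_elem_int_p])
  then have "int (multiplicity (int p) d) - int (multiplicity (int p) c) =
      int (multiplicity (int p) b) - int (multiplicity (int p) a)"
    by linarith
  then show ?thesis
    using assms by (simp add: padic_abs_def cd)
qed

lemma padic_abs_zero [simp]: "padic_abs p 0 = 0"
  by (simp add: padic_abs_def)

lemma padic_abs_pos: "x \<noteq> 0 \<Longrightarrow> 0 < padic_abs p x"
  using p_ge_2 by (auto simp: padic_abs_def split: prod.splits intro!: zero_less_power_int)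

lemma padic_abs_nonneg: "0 \<le> padic_abs p x"
  using padic_abs_pos[of x] by (cases "x = 0") auto

lemma padic_abs_mult: "padic_abs p (x * y) = padic_abs p x * padic_abs p y"
proof (cases "x = 0 \<or> y = 0")
  case False
  obtain a b c d where x: "x = of_int a / of_int b" "b > 0" and y: "y = of_int c / of_int d" "d > 0"
    using rat_as_fraction by metis
  have nz: "a \<noteq> 0" "c \<noteq> 0" "b \<noteq> 0" "d \<noteq> 0" using x y False by auto
  have "padic_abs p (x * y) = padic_abs p (of_int (a * c) / of_int (b * d))"
    by (simp add: x y)
  also have "\<dots> = real p powi ((int (multiplicity (int p) b) - int (multiplicity (int p) a)) +
      (int (multiplicity (int p) d) - int (multiplicity (int p) c)))"
    using nz by (subst padic_abs_fraction)
      (auto simp: prime_elem_multiplicity_mult_distrib[OF prime_elem_int_p] intro!: arg_cong[of _ _ "\<lambda>k. real p powi k"])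
  also have "\<dots> = padic_abs p x * padic_abs p y"
    unfolding x y using nz p_ge_2 by (simp add: padic_abs_fraction power_int_add)
  finally show ?thesis .
qed auto

lemma padic_abs_int_le_1: "padic_abs p (of_int i) \<le> 1"
proof (cases "i = 0")
  case False
  then show ?thesis
    using padic_abs_fraction[of i 1] p_ge_2 power_int_increasing[of "- int (multiplicity (int p) i)" 0 "real p"]
    by simp
qed simp

lemma padic_abs_int_eq: "i \<noteq> 0 \<Longrightarrow> padic_abs p (of_int i) = 1 / real p ^ multiplicity (int p) i"
  using padic_abs_fraction[of i 1] by (simp add: power_int_minus divide_inverse)

lemma padic_abs_int_eq_1: "\<not> int p dvd i \<Longrightarrow> padic_abs p (of_int i) = 1"
  by (subst padic_abs_int_eq) (auto simp: not_dvd_imp_multiplicity_0)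

lemma padic_abs_p: "padic_abs p (of_nat p) = 1 / real p"
proof -
  have "multiplicity (int p) (int p) = 1"
    using not_unit_p prime_p by (intro multiplicity_self) auto
  then show ?thesis
    using padic_abs_int_eq[of "int p"] p_ge_2 by simp
qed

lemma padic_abs_minus: "padic_abs p (- x) = padic_abs p x"
proof -
  have "padic_abs p (-1) = 1"
    using padic_abs_int_eq_1[of "-1"] not_unit_p by simp
  then show ?thesis
    using padic_abs_mult[of "-1" x] by simp
qed

lemma padic_abs_diff_commute: "padic_abs p (x - y) = padic_abs p (y - x)"
  using padic_abs_minus[of "x - y"] by simp

text \<open>Over a common denominator this says that a power of p dividing both numerators divides
  their sum.\<close>

lemma padic_abs_add_le_max: "padic_abs p (x + y) \<le> max (padic_abs p x) (padic_abs p y)"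
proof (cases "x = 0 \<or> y = 0 \<or> x + y = 0")
  case True
  then show ?thesis by (auto simp: padic_abs_nonneg le_max_iff_disj)
next
  case False
  obtain a b c d where x: "x = of_int a / of_int b" "b > 0" and y: "y = of_int c / of_int d" "d > 0"
    using rat_as_fraction by metis
  define s t where "s = a * d" and "t = c * b"
  have xs: "x = of_int s / of_int (b * d)" "y = of_int t / of_int (b * d)"
    using x y by (auto simp: s_def t_def)
  then have st: "s \<noteq> 0" "t \<noteq> 0" "s + t \<noteq> 0" "b * d \<noteq> 0"
    using False x y by (auto simp: add_divide_distrib[symmetric] simp flip: of_int_add)
  have sum: "x + y = of_int (s + t) / of_int (b * d)"
    unfolding xs by (simp add: add_divide_distrib)
  have "int p ^ min (multiplicity (int p) s) (multiplicity (int p) t) dvd s + t"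
    by (intro dvd_add multiplicity_dvd') auto
  then have "min (multiplicity (int p) s) (multiplicity (int p) t) \<le> multiplicity (int p) (s + t)"
    using st not_unit_p by (intro multiplicity_geI) auto
  then have "multiplicity (int p) s \<le> multiplicity (int p) (s + t) \<or> multiplicity (int p) t \<le> multiplicity (int p) (s + t)"
    by linarith
  then have "padic_abs p (x + y) \<le> padic_abs p x \<or> padic_abs p (x + y) \<le> padic_abs p y"
    unfolding sum unfolding xs padic_abs_fraction[OF st(3,4)] padic_abs_fraction[OF st(1,4)] padic_abs_fraction[OF st(2,4)]
    using p_ge_2 by (auto intro: power_int_increasing)
  then show ?thesis by (simp add: le_max_iff_disj)
qed

lemma padic_abs_add_le: "padic_abs p (x + y) \<le> padic_abs p x + padic_abs p y"
  using padic_abs_add_le_max[of x y] padic_abs_nonneg[of x] padic_abs_nonneg[of y] by linarith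

lemma padic_abs_reverse_triangle: "\<bar>padic_abs p x - padic_abs p y\<bar> \<le> padic_abs p (x - y)"
  using padic_abs_add_le[of "x - y" y] padic_abs_add_le[of "y - x" x] padic_abs_diff_commute[of x y] by simp

text \<open>In lowest terms a / b the denominator is prime to p, so Bezout provides an inverse u of
  b modulo p. The digit is a u modulo p, for which p divides a - b i.\<close>

lemma padic_digit_unit_ball:
  assumes "padic_abs p x \<le> 1"
  shows "\<exists>i. 0 \<le> i \<and> i < int p \<and> padic_abs p (x - of_int i) \<le> 1 / real p"
proof (cases "x = 0")
  case True
  then show ?thesis using p_ge_2 by (intro exI[of _ 0]) auto
next
  case False
  obtain a b where ab: "x = of_int a / of_int b" "b > 0" "coprime a b"
    using rat_as_fraction by metis
  have nz: "a \<noteq> 0" "b \<noteq> 0" using ab False by auto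
  have pb: "\<not> int p dvd b"
  proof
    assume dvd: "int p dvd b"
    then have "\<not> int p dvd a"
      using ab(3) not_unit_p by (meson coprime_common_divisor)
    then have "multiplicity (int p) a = 0" by (rule not_dvd_imp_multiplicity_0)
    moreover have "1 \<le> multiplicity (int p) b"
      using dvd nz not_unit_p by (intro multiplicity_geI) auto
    ultimately have "real p powi 1 \<le> padic_abs p x"
      unfolding ab(1) padic_abs_fraction[OF nz] using p_ge_2 by (intro power_int_increasing) auto
    then show False using assms p_ge_2 by simp
  qed
  have "coprime b (int p)"
    using pb prime_p by (metis coprime_commute prime_imp_coprime prime_nat_int_transfer)
  then obtain u v where uv: "u * b + v * int p = 1"
    using bezout_int[of b "int p"] by auto
  define i where "i = (a * u) mod int p"
  have "int p dvd a - b * i"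
  proof -
    have "a - b * i = a - b * (a * u) + b * (a * u - i)" by (simp add: algebra_simps)
    also have "a - b * (a * u) = a * (v * int p)"
      using arg_cong[OF uv, of "\<lambda>t. a * t"] by (simp add: algebra_simps)
    finally have eq: "a - b * i = a * (v * int p) + b * (a * u - i)" .
    have "int p dvd a * u - i" by (simp add: i_def mod_eq_dvd_iff[symmetric])
    then show ?thesis unfolding eq by (intro dvd_add dvd_mult) auto
  qed
  then obtain k where k: "a - b * i = int p * k" by blast
  have "x - of_int i = of_int (a - b * i) / of_int b"
    using ab nz by (simp add: field_simps)
  then have "(x - of_int i) * of_int b = of_nat p * of_int k"
    unfolding k using nz by simp
  then have "padic_abs p (x - of_int i) * padic_abs p (of_int b) = padic_abs p (of_nat p) * padic_abs p (of_int k)"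
    by (simp only: padic_abs_mult[symmetric])
  then have "padic_abs p (x - of_int i) = 1 / real p * padic_abs p (of_int k)"
    using padic_abs_int_eq_1[OF pb] padic_abs_p by simp
  also have "\<dots> \<le> 1 / real p"
    using padic_abs_int_le_1[of k] p_ge_2 by (simp add: divide_right_mono)
  finally show ?thesis
    using p_ge_2 by (intro exI[of _ i]) (auto simp: i_def)
qed

lemma padic_digit:
  assumes "padic_abs p x \<le> padic_abs p y" "y \<noteq> 0"
  shows "\<exists>i. \<bar>i\<bar> \<le> int p \<and> padic_abs p (x - of_int i * y) \<le> padic_abs p y / real p"
proof -
  have y: "0 < padic_abs p y" using assms(2) by (rule padic_abs_pos)
  have xy: "padic_abs p (x / y) * padic_abs p y = padic_abs p x"
    using assms(2) by (simp flip: padic_abs_mult)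
  then have "padic_abs p (x / y) * padic_abs p y \<le> 1 * padic_abs p y"
    using assms(1) by simp
  then have "padic_abs p (x / y) \<le> 1"
    using y by (rule mult_right_le_imp_le)
  then obtain i where i: "0 \<le> i" "i < int p" "padic_abs p (x / y - of_int i) \<le> 1 / real p"
    using padic_digit_unit_ball by blast
  have "x - of_int i * y = (x / y - of_int i) * y"
    using assms(2) by (simp add: field_simps)
  then have "padic_abs p (x - of_int i * y) = padic_abs p (x / y - of_int i) * padic_abs p y"
    by (simp only: padic_abs_mult)
  also have "\<dots> \<le> 1 / real p * padic_abs p y"
    using i y by (intro mult_right_mono) auto
  finally show ?thesis
    using i by (intro exI[of _ i]) auto
qed

section \<open>The ring of Cauchy sequences and the ideal of null sequences\<close>

lemma padic_cauchy_ring_sel: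
  "carrier (padic_cauchy_ring p) = {x. \<forall>\<epsilon>>0. \<exists>M. \<forall>m\<ge>M. \<forall>n\<ge>M. padic_abs p (x m - x n) < \<epsilon>}"
  "monoid.mult (padic_cauchy_ring p) x y = (\<lambda>n. x n * y n)" "one (padic_cauchy_ring p) = (\<lambda>n. 1)"
  "zero (padic_cauchy_ring p) = (\<lambda>n. 0)" "add (padic_cauchy_ring p) x y = (\<lambda>n. x n + y n)"
  by (simp_all add: padic_cauchy_ring_def)

lemma cauchyD:
  assumes "x \<in> carrier (padic_cauchy_ring p)" "\<epsilon> > 0"
  shows "\<exists>M. \<forall>m\<ge>M. \<forall>n\<ge>M. padic_abs p (x m - x n) < \<epsilon>"
  using assms unfolding padic_cauchy_ring_sel by blast

lemma cauchy_const: "(\<lambda>n. q) \<in> carrier (padic_cauchy_ring p)"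
  by (simp add: padic_cauchy_ring_sel)

lemma cauchy_minus: "x \<in> carrier (padic_cauchy_ring p) \<Longrightarrow> (\<lambda>n. - x n) \<in> carrier (padic_cauchy_ring p)"
  using padic_abs_diff_commute by (simp add: padic_cauchy_ring_sel)

lemma cauchy_add:
  assumes x: "x \<in> carrier (padic_cauchy_ring p)" and y: "y \<in> carrier (padic_cauchy_ring p)"
  shows "(\<lambda>n. x n + y n) \<in> carrier (padic_cauchy_ring p)"
  unfolding padic_cauchy_ring_sel
proof (intro CollectI allI impI)
  fix \<epsilon> :: real assume \<epsilon>: "\<epsilon> > 0"
  obtain M N where M: "\<And>m n. m \<ge> M \<Longrightarrow> n \<ge> M \<Longrightarrow> padic_abs p (x m - x n) < \<epsilon>"
    and N: "\<And>m n. m \<ge> N \<Longrightarrow> n \<ge> N \<Longrightarrow> padic_abs p (y m - y n) < \<epsilon>"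
    using cauchyD[OF x \<epsilon>] cauchyD[OF y \<epsilon>] by blast
  have "padic_abs p ((x m + y m) - (x n + y n)) < \<epsilon>" if "m \<ge> max M N" "n \<ge> max M N" for m n
    using padic_abs_add_le_max[of "x m - x n" "y m - y n"] M[of m n] N[of m n] that
    by (simp add: algebra_simps)
  then show "\<exists>M. \<forall>m\<ge>M. \<forall>n\<ge>M. padic_abs p ((x m + y m) - (x n + y n)) < \<epsilon>" by blast
qed

lemma cauchy_bounded:
  assumes x: "x \<in> carrier (padic_cauchy_ring p)"
  shows "\<exists>B>0. \<forall>n. padic_abs p (x n) \<le> B"
proof -
  obtain M where M: "\<And>m n. m \<ge> M \<Longrightarrow> n \<ge> M \<Longrightarrow> padic_abs p (x m - x n) < 1"
    using cauchyD[OF x, of 1] by auto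
  define S where "S = insert 1 ((\<lambda>n. padic_abs p (x n)) ` {..M})"
  define B where "B = Max S + 1"
  have S: "finite S" "1 \<in> S" by (auto simp: S_def)
  then have "1 \<le> Max S" by (intro Max_ge)
  have "padic_abs p (x n) \<le> B" for n
  proof (cases "n \<le> M")
    case True
    then have "padic_abs p (x n) \<le> Max S" by (intro Max_ge S) (auto simp: S_def)
    then show ?thesis by (simp add: B_def)
  next
    case False
    have "padic_abs p (x M) \<le> Max S" by (intro Max_ge S) (auto simp: S_def)
    then show ?thesis
      using padic_abs_add_le[of "x n - x M" "x M"] M[of n M] False by (simp add: B_def)
  qed
  then show ?thesis
    using \<open>1 \<le> Max S\<close> by (intro exI[of _ B]) (auto simp: B_def)
qed

lemma cauchy_mult:
  assumes x: "x \<in> carrier (padic_cauchy_ring p)" and y: "y \<in> carrier (padic_cauchy_ring p)"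
  shows "(\<lambda>n. x n * y n) \<in> carrier (padic_cauchy_ring p)"
  unfolding padic_cauchy_ring_sel
proof (intro CollectI allI impI)
  fix \<epsilon> :: real assume \<epsilon>: "\<epsilon> > 0"
  obtain A B where A: "A > 0" "\<And>n. padic_abs p (x n) \<le> A" and B: "B > 0" "\<And>n. padic_abs p (y n) \<le> B"
    using cauchy_bounded[OF x] cauchy_bounded[OF y] by blast
  have pos: "\<epsilon> / B > 0" "\<epsilon> / A > 0" using \<epsilon> A B by auto
  obtain M N where M: "\<And>m n. m \<ge> M \<Longrightarrow> n \<ge> M \<Longrightarrow> padic_abs p (x m - x n) < \<epsilon> / B"
    and N: "\<And>m n. m \<ge> N \<Longrightarrow> n \<ge> N \<Longrightarrow> padic_abs p (y m - y n) < \<epsilon> / A"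
    using cauchyD[OF x pos(1)] cauchyD[OF y pos(2)] by blast
  have "padic_abs p (x m * y m - x n * y n) < \<epsilon>" if mn: "m \<ge> max M N" "n \<ge> max M N" for m n
  proof -
    have "padic_abs p ((x m - x n) * y m) \<le> padic_abs p (x m - x n) * B"
      unfolding padic_abs_mult using B(2) padic_abs_nonneg by (intro mult_left_mono)
    also have "\<dots> < \<epsilon>" using M[of m n] mn B(1) by (simp add: pos_less_divide_eq)
    finally have 1: "padic_abs p ((x m - x n) * y m) < \<epsilon>" .
    have "padic_abs p (x n * (y m - y n)) \<le> A * padic_abs p (y m - y n)"
      unfolding padic_abs_mult using A(2) padic_abs_nonneg by (intro mult_right_mono)
    also have "\<dots> < \<epsilon>" using N[of m n] mn A(1) by (simp add: pos_less_divide_eq mult.commute)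
    finally have 2: "padic_abs p (x n * (y m - y n)) < \<epsilon>" .
    have "x m * y m - x n * y n = (x m - x n) * y m + x n * (y m - y n)"
      by (simp add: algebra_simps)
    then show ?thesis
      using padic_abs_add_le_max[of "(x m - x n) * y m" "x n * (y m - y n)"] 1 2 by simp
  qed
  then show "\<exists>M. \<forall>m\<ge>M. \<forall>n\<ge>M. padic_abs p (x m * y m - x n * y n) < \<epsilon>" by blast
qed

lemma cring_padic_cauchy_ring: "cring (padic_cauchy_ring p)"
proof (rule cringI)
  show "abelian_group (padic_cauchy_ring p)"
  proof (rule abelian_groupI)
    fix x assume "x \<in> carrier (padic_cauchy_ring p)"
    then show "\<exists>y\<in>carrier (padic_cauchy_ring p). y \<oplus>\<^bsub>padic_cauchy_ring p\<^esub> x = \<zero>\<^bsub>padic_cauchy_ring p\<^esub>"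
      using cauchy_minus by (intro bexI[of _ "\<lambda>n. - x n"]) (auto simp: padic_cauchy_ring_sel(2-))
  qed (use cauchy_add cauchy_const in \<open>auto simp: padic_cauchy_ring_sel(2-) algebra_simps\<close>)
  show "comm_monoid (padic_cauchy_ring p)"
    by (rule comm_monoidI) (use cauchy_mult cauchy_const in \<open>auto simp: padic_cauchy_ring_sel(2-) algebra_simps\<close>)
qed (auto simp: padic_cauchy_ring_sel(2-) algebra_simps)

lemma null_seqI:
  assumes "\<And>n. padic_abs p (x n) \<le> f n" "f \<longlonglongrightarrow> 0"
  shows "x \<in> padic_null_ideal p"
  unfolding padic_null_ideal_def
  using tendsto_sandwich[of "\<lambda>_. 0" "\<lambda>n. padic_abs p (x n)" sequentially f] assms padic_abs_nonneg by auto

lemma null_seq_cauchy: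
  assumes "x \<in> padic_null_ideal p"
  shows "x \<in> carrier (padic_cauchy_ring p)"
  unfolding padic_cauchy_ring_sel
proof (intro CollectI allI impI)
  fix \<epsilon> :: real assume "\<epsilon> > 0"
  then have "\<forall>\<^sub>F n in sequentially. padic_abs p (x n) < \<epsilon>"
    using assms by (intro order_tendstoD(2)[of _ 0]) (auto simp: padic_null_ideal_def)
  then obtain M where M: "\<And>n. n \<ge> M \<Longrightarrow> padic_abs p (x n) < \<epsilon>"
    by (auto simp: eventually_sequentially)
  have "padic_abs p (x m - x n) < \<epsilon>" if "m \<ge> M" "n \<ge> M" for m n
    using padic_abs_add_le_max[of "x m" "- x n"] padic_abs_minus[of "x n"] M[of m] M[of n] that by simp
  then show "\<exists>M. \<forall>m\<ge>M. \<forall>n\<ge>M. padic_abs p (x m - x n) < \<epsilon>" by blast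
qed

lemma null_seq_add:
  assumes "x \<in> padic_null_ideal p" "y \<in> padic_null_ideal p"
  shows "(\<lambda>n. x n + y n) \<in> padic_null_ideal p"
  using assms tendsto_add[of "\<lambda>n. padic_abs p (x n)" 0 sequentially "\<lambda>n. padic_abs p (y n)" 0]
  by (intro null_seqI[of _ "\<lambda>n. padic_abs p (x n) + padic_abs p (y n)"] padic_abs_add_le)
    (simp add: padic_null_ideal_def)

lemma null_seq_minus: "x \<in> padic_null_ideal p \<Longrightarrow> (\<lambda>n. - x n) \<in> padic_null_ideal p"
  by (simp add: padic_null_ideal_def padic_abs_minus)

lemma null_seq_mult:
  assumes "x \<in> padic_null_ideal p" "y \<in> carrier (padic_cauchy_ring p)"
  shows "(\<lambda>n. x n * y n) \<in> padic_null_ideal p"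
proof -
  obtain B where B: "\<And>n. padic_abs p (y n) \<le> B" using cauchy_bounded[OF assms(2)] by blast
  have "(\<lambda>n. padic_abs p (x n) * B) \<longlonglongrightarrow> 0"
    using assms(1) by (intro tendsto_mult_left_zero) (simp add: padic_null_ideal_def)
  moreover have "padic_abs p (x n * y n) \<le> padic_abs p (x n) * B" for n
    unfolding padic_abs_mult using B padic_abs_nonneg by (intro mult_left_mono)
  ultimately show ?thesis by (intro null_seqI)
qed

lemma a_inv_padic_cauchy_ring:
  "x \<in> carrier (padic_cauchy_ring p) \<Longrightarrow> \<ominus>\<^bsub>padic_cauchy_ring p\<^esub> x = (\<lambda>n. - x n)"
proof -
  interpret C: cring "padic_cauchy_ring p" by (rule cring_padic_cauchy_ring)
  assume "x \<in> carrier (padic_cauchy_ring p)"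
  then show ?thesis
    using cauchy_minus by (intro C.minus_equality) (auto simp: padic_cauchy_ring_sel(2-))
qed

lemma ideal_padic_null_ideal: "ideal (padic_null_ideal p) (padic_cauchy_ring p)"
proof -
  interpret C: cring "padic_cauchy_ring p" by (rule cring_padic_cauchy_ring)
  show ?thesis
  proof (rule idealI)
    show "ring (padic_cauchy_ring p)" by (rule C.ring_axioms)
    show "subgroup (padic_null_ideal p) (add_monoid (padic_cauchy_ring p))"
    proof (rule C.add.subgroupI)
      show "padic_null_ideal p \<subseteq> carrier (padic_cauchy_ring p)" using null_seq_cauchy by blast
      show "padic_null_ideal p \<noteq> {}" by (auto simp: padic_null_ideal_def intro: exI[of _ "\<lambda>n. 0"])
      show "\<ominus>\<^bsub>padic_cauchy_ring p\<^esub> x \<in> padic_null_ideal p" if "x \<in> padic_null_ideal p" for x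
        using that null_seq_cauchy null_seq_minus by (simp add: a_inv_padic_cauchy_ring)
      show "x \<oplus>\<^bsub>padic_cauchy_ring p\<^esub> y \<in> padic_null_ideal p"
        if "x \<in> padic_null_ideal p" "y \<in> padic_null_ideal p" for x y
        using that null_seq_add by (simp add: padic_cauchy_ring_sel(2-))
    qed
    show "x \<otimes>\<^bsub>padic_cauchy_ring p\<^esub> a \<in> padic_null_ideal p"
      "a \<otimes>\<^bsub>padic_cauchy_ring p\<^esub> x \<in> padic_null_ideal p"
      if "a \<in> padic_null_ideal p" "x \<in> carrier (padic_cauchy_ring p)" for a x
      using null_seq_mult[OF that] by (simp_all add: padic_cauchy_ring_sel(2-) mult.commute)
  qed
qed

section \<open>The p-adic numbers as a ring with absolute value\<close>

definition padic_class :: "(nat \<Rightarrow> rat) \<Rightarrow> (nat \<Rightarrow> rat) set" where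
  "padic_class x = padic_null_ideal p +>\<^bsub>padic_cauchy_ring p\<^esub> x"

text \<open>\<open>padic_field\<close> extends the record of the quotient ring by the absolute
  value, so the ring axioms are carried over through the selectors.\<close>

lemma cring_padic_field: "cring (padic_field p)"
proof -
  interpret Q: cring "padic_cauchy_ring p Quot padic_null_ideal p"
    by (rule ideal.quotient_is_cring[OF ideal_padic_null_ideal cring_padic_cauchy_ring])
  have sel: "carrier (padic_field p) = carrier (padic_cauchy_ring p Quot padic_null_ideal p)"
    "monoid.mult (padic_field p) = monoid.mult (padic_cauchy_ring p Quot padic_null_ideal p)"
    "one (padic_field p) = one (padic_cauchy_ring p Quot padic_null_ideal p)"
    "zero (padic_field p) = zero (padic_cauchy_ring p Quot padic_null_ideal p)"
    "add (padic_field p) = add (padic_cauchy_ring p Quot padic_null_ideal p)"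
    by (simp_all add: padic_field_sel FactRing_def)
  show ?thesis
  proof (rule cringI)
    show "abelian_group (padic_field p)"
    proof (rule abelian_groupI)
      fix x assume x: "x \<in> carrier (padic_field p)"
      then show "\<exists>y\<in>carrier (padic_field p). y \<oplus>\<^bsub>padic_field p\<^esub> x = \<zero>\<^bsub>padic_field p\<^esub>"
        unfolding sel using Q.l_neg Q.a_inv_closed by blast
    qed (simp_all add: sel Q.a_ac)
    show "comm_monoid (padic_field p)"
      by (rule comm_monoidI) (simp_all add: sel Q.m_ac)
  qed (simp add: sel Q.l_distr)
qed

lemma carrier_padic_field: "carrier (padic_field p) = padic_class ` carrier (padic_cauchy_ring p)"
  by (auto simp: padic_field_sel A_RCOSETS_def' padic_class_def)

lemma padic_class_closed: "x \<in> carrier (padic_cauchy_ring p) \<Longrightarrow> padic_class x \<in> carrier (padic_field p)"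
  by (simp add: carrier_padic_field)

lemma padic_class_add:
  assumes "x \<in> carrier (padic_cauchy_ring p)" "y \<in> carrier (padic_cauchy_ring p)"
  shows "padic_class x \<oplus>\<^bsub>padic_field p\<^esub> padic_class y = padic_class (\<lambda>n. x n + y n)"
  using ring_hom_add[OF ideal.rcos_ring_hom[OF ideal_padic_null_ideal] assms]
  by (simp add: padic_field_sel FactRing_def padic_class_def padic_cauchy_ring_sel(2-))

lemma padic_class_mult:
  assumes "x \<in> carrier (padic_cauchy_ring p)" "y \<in> carrier (padic_cauchy_ring p)"
  shows "padic_class x \<otimes>\<^bsub>padic_field p\<^esub> padic_class y = padic_class (\<lambda>n. x n * y n)"
  using ring_hom_mult[OF ideal.rcos_ring_hom[OF ideal_padic_null_ideal] assms]
  by (simp add: padic_field_sel FactRing_def padic_class_def padic_cauchy_ring_sel(2-))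

lemma padic_class_one: "\<one>\<^bsub>padic_field p\<^esub> = padic_class (\<lambda>n. 1)"
  by (simp add: padic_field_sel padic_class_def padic_cauchy_ring_sel(2-))

lemma mem_padic_class: "y \<in> padic_class x \<longleftrightarrow> (\<lambda>n. y n - x n) \<in> padic_null_ideal p"
proof
  assume "y \<in> padic_class x"
  then obtain h where "h \<in> padic_null_ideal p" "y = (\<lambda>n. h n + x n)"
    by (auto simp: padic_class_def a_r_coset_def' padic_cauchy_ring_sel(2-))
  then show "(\<lambda>n. y n - x n) \<in> padic_null_ideal p" by simp
next
  assume h: "(\<lambda>n. y n - x n) \<in> padic_null_ideal p"
  then show "y \<in> padic_class x"
    unfolding padic_class_def a_r_coset_def' padic_cauchy_ring_sel(2-)
    by (intro UN_I[OF h]) simp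
qed

lemma padic_class_zero: "\<zero>\<^bsub>padic_field p\<^esub> = padic_class (\<lambda>n. 0)"
  by (auto simp: padic_field_sel mem_padic_class)

lemma padic_class_eq_zero_iff: "padic_class x = \<zero>\<^bsub>padic_field p\<^esub> \<longleftrightarrow> x \<in> padic_null_ideal p"
proof
  assume "padic_class x = \<zero>\<^bsub>padic_field p\<^esub>"
  moreover have "x \<in> padic_class x" by (simp add: mem_padic_class padic_null_ideal_def)
  ultimately show "x \<in> padic_null_ideal p" by (simp add: padic_field_sel)
next
  assume x: "x \<in> padic_null_ideal p"
  have "y \<in> padic_class x \<longleftrightarrow> y \<in> padic_null_ideal p" for y
    using null_seq_add[OF _ x, of "\<lambda>n. y n - x n"] null_seq_add[OF _ null_seq_minus[OF x], of y]
    by (auto simp: mem_padic_class)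
  then show "padic_class x = \<zero>\<^bsub>padic_field p\<^esub>" by (auto simp: padic_field_sel)
qed

lemma padic_class_minus:
  assumes "x \<in> carrier (padic_cauchy_ring p)"
  shows "\<ominus>\<^bsub>padic_field p\<^esub> padic_class x = padic_class (\<lambda>n. - x n)"
proof -
  interpret K: cring "padic_field p" by (rule cring_padic_field)
  show ?thesis
    using assms cauchy_minus[OF assms]
    by (intro K.minus_equality) (auto simp: padic_class_closed padic_class_add padic_class_zero)
qed

lemma padic_class_diff:
  assumes "x \<in> carrier (padic_cauchy_ring p)" "y \<in> carrier (padic_cauchy_ring p)"
  shows "padic_class x \<ominus>\<^bsub>padic_field p\<^esub> padic_class y = padic_class (\<lambda>n. x n - y n)"
  using assms cauchy_minus by (simp add: a_minus_def padic_class_minus padic_class_add)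

text \<open>Justifies the definite description in the absolute value: the limit exists by the
  reverse triangle inequality, and changing the representative by a null sequence does not affect
  it.\<close>

lemma absval_padic_class:
  assumes x: "x \<in> carrier (padic_cauchy_ring p)"
  shows "(\<lambda>n. padic_abs p (x n)) \<longlonglongrightarrow> absval (padic_field p) (padic_class x)"
proof -
  have "Cauchy (\<lambda>n. padic_abs p (x n))"
    unfolding Cauchy_def dist_real_def
    using cauchyD[OF x] padic_abs_reverse_triangle by (meson le_less_trans)
  then obtain r where r: "(\<lambda>n. padic_abs p (x n)) \<longlonglongrightarrow> r"
    by (auto simp: Cauchy_convergent_iff convergent_def)
  have "(\<lambda>n. padic_abs p (y n)) \<longlonglongrightarrow> r" if "y \<in> padic_class x" for y
  proof -
    have "(\<lambda>n. padic_abs p (y n - x n)) \<longlonglongrightarrow> 0"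
      using that by (simp add: mem_padic_class padic_null_ideal_def)
    then have "(\<lambda>n. padic_abs p (y n) - padic_abs p (x n)) \<longlonglongrightarrow> 0"
      by (rule Lim_null_comparison[rotated]) (simp add: padic_abs_reverse_triangle)
    from tendsto_add[OF this r] show ?thesis by simp
  qed
  moreover have "x \<in> padic_class x" by (simp add: mem_padic_class padic_null_ideal_def)
  ultimately have "absval (padic_field p) (padic_class x) = r"
    unfolding padic_field_sel(6) using r LIMSEQ_unique by (intro the_equality) blast+
  then show ?thesis using r by simp
qed

lemma absval_padic_const: "absval (padic_field p) (padic_class (\<lambda>n. q)) = padic_abs p q"
  using absval_padic_class[OF cauchy_const] LIMSEQ_unique tendsto_const by blast

lemma valued_ring_padic_field: "valued_ring (padic_field p)"
proof -
  interpret K: cring "padic_field p" by (rule cring_padic_field)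
  show ?thesis
  proof (unfold_locales)
    fix X assume "X \<in> carrier (padic_field p)"
    then obtain x where x: "x \<in> carrier (padic_cauchy_ring p)" "X = padic_class x"
      by (auto simp: carrier_padic_field)
    note lim = absval_padic_class[OF x(1)]
    show "0 \<le> absval (padic_field p) X"
      unfolding x(2) using lim by (rule LIMSEQ_le_const) (auto simp: padic_abs_nonneg)
    show "absval (padic_field p) X = 0 \<longleftrightarrow> X = \<zero>\<^bsub>padic_field p\<^esub>"
      unfolding x(2) padic_class_eq_zero_iff padic_null_ideal_def using lim LIMSEQ_unique by auto
    show "absval (padic_field p) (\<ominus>\<^bsub>padic_field p\<^esub> X) = absval (padic_field p) X"
      unfolding x(2) padic_class_minus[OF x(1)]
      using absval_padic_class[OF cauchy_minus[OF x(1)]] lim LIMSEQ_unique by (simp add: padic_abs_minus) blast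
    fix Y assume "Y \<in> carrier (padic_field p)"
    then obtain y where y: "y \<in> carrier (padic_cauchy_ring p)" "Y = padic_class y"
      by (auto simp: carrier_padic_field)
    note lim' = absval_padic_class[OF y(1)]
    show "absval (padic_field p) (X \<otimes>\<^bsub>padic_field p\<^esub> Y) = absval (padic_field p) X * absval (padic_field p) Y"
      unfolding x(2) y(2) padic_class_mult[OF x(1) y(1)]
      using absval_padic_class[OF cauchy_mult[OF x(1) y(1)]] tendsto_mult[OF lim lim']
      by (intro LIMSEQ_unique) (auto simp: padic_abs_mult)
    show "absval (padic_field p) (X \<oplus>\<^bsub>padic_field p\<^esub> Y) \<le> absval (padic_field p) X + absval (padic_field p) Y"
      unfolding x(2) y(2) padic_class_add[OF x(1) y(1)]
      using absval_padic_class[OF cauchy_add[OF x(1) y(1)]] tendsto_add[OF lim lim']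
      by (rule LIMSEQ_le) (auto simp: padic_abs_add_le)
  qed
qed

section \<open>Completeness and digits of the p-adic numbers\<close>

lemma field_dist_padic_class:
  assumes "x \<in> carrier (padic_cauchy_ring p)" "y \<in> carrier (padic_cauchy_ring p)"
  shows "(\<lambda>n. padic_abs p (x n - y n)) \<longlonglongrightarrow> field_dist (padic_field p) (padic_class x) (padic_class y)"
proof -
  have "(\<lambda>n. x n - y n) \<in> carrier (padic_cauchy_ring p)"
    using cauchy_add[OF assms(1) cauchy_minus[OF assms(2)]] by simp
  from absval_padic_class[OF this] show ?thesis
    using assms by (simp add: field_dist_def padic_class_closed padic_class_diff)
qed

lemma field_dist_padic_class_le:
  assumes "x \<in> carrier (padic_cauchy_ring p)" "y \<in> carrier (padic_cauchy_ring p)"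
    and "\<And>n. n \<ge> M \<Longrightarrow> padic_abs p (x n - y n) \<le> c"
  shows "field_dist (padic_field p) (padic_class x) (padic_class y) \<le> c"
  using field_dist_padic_class[OF assms(1,2)] by (rule LIMSEQ_le_const2) (use assms(3) in blast)

text \<open>Density of the rationals: the class of a Cauchy sequence is close to the constant at one
  of its late entries.\<close>

lemma padic_rational_approximation:
  assumes X: "X \<in> carrier (padic_field p)" and \<epsilon>: "\<epsilon> > 0"
  shows "\<exists>q. field_dist (padic_field p) X (padic_class (\<lambda>n. q)) \<le> \<epsilon>"
proof -
  obtain x where x: "x \<in> carrier (padic_cauchy_ring p)" "X = padic_class x"
    using X by (auto simp: carrier_padic_field)
  obtain M where M: "\<And>m n. m \<ge> M \<Longrightarrow> n \<ge> M \<Longrightarrow> padic_abs p (x m - x n) < \<epsilon>"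
    using cauchyD[OF x(1) \<epsilon>] by blast
  have "field_dist (padic_field p) X (padic_class (\<lambda>n. x M)) \<le> \<epsilon>"
    unfolding x(2) using M[of _ M] by (intro field_dist_padic_class_le[OF x(1) cauchy_const, of M]) (simp add: less_imp_le)
  then show ?thesis by blast
qed

text \<open>Replace the k-th member of a Cauchy sequence by a rational \<open>q k\<close> within 1 /
  (k + 1). The rationals \<open>q k\<close> form a Cauchy sequence themselves, and its class is the
  limit.\<close>

lemma mcomplete_padic_field: "Metric_space.mcomplete (carrier (padic_field p)) (field_dist (padic_field p))"
proof -
  interpret K: valued_ring "padic_field p" by (rule valued_ring_padic_field)
  let ?d = "field_dist (padic_field p)" and ?c = "\<lambda>q. padic_class (\<lambda>n. q)"
  have c: "?c q \<in> carrier (padic_field p)" for q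
    by (rule padic_class_closed[OF cauchy_const])
  show ?thesis
    unfolding K.metric.mcomplete_def
  proof (intro allI impI)
    fix \<sigma> assume \<sigma>: "K.metric.MCauchy \<sigma>"
    then have \<sigma>c: "\<sigma> k \<in> carrier (padic_field p)" for k
      by (auto simp: K.metric.MCauchy_def)
    have "\<exists>q. ?d (\<sigma> k) (?c q) \<le> 1 / (real k + 1)" for k
      by (rule padic_rational_approximation[OF \<sigma>c]) simp
    then obtain q where q: "\<And>k. ?d (\<sigma> k) (?c (q k)) \<le> 1 / (real k + 1)" by metis
    have small: "\<exists>N. \<forall>k\<ge>N. 1 / (real k + 1) < \<epsilon>" if "\<epsilon> > 0" for \<epsilon> :: real
    proof -
      obtain N :: nat where N: "1 / \<epsilon> < real N" using reals_Archimedean2 by blast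
      have "1 / (real k + 1) < \<epsilon>" if "k \<ge> N" for k
      proof -
        have "1 / \<epsilon> < real k + 1" using N that by simp
        then show ?thesis using \<open>\<epsilon> > 0\<close> by (simp add: field_simps)
      qed
      then show ?thesis by blast
    qed
    have q_dist: "padic_abs p (q k - q l) = ?d (?c (q k)) (?c (q l))" for k l
      using c by (simp add: field_dist_def padic_class_diff[OF cauchy_const cauchy_const] absval_padic_const)
    have q_cauchy: "q \<in> carrier (padic_cauchy_ring p)"
      unfolding padic_cauchy_ring_sel
    proof (intro CollectI allI impI)
      fix \<epsilon> :: real assume "\<epsilon> > 0"
      then have \<epsilon>: "\<epsilon> / 3 > 0" by simp
      obtain M where M: "\<And>k l. M \<le> k \<Longrightarrow> M \<le> l \<Longrightarrow> ?d (\<sigma> k) (\<sigma> l) < \<epsilon> / 3"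
        using \<sigma> \<epsilon> unfolding K.metric.MCauchy_def by blast
      obtain N where N: "\<And>k. k \<ge> N \<Longrightarrow> 1 / (real k + 1) < \<epsilon> / 3" using small[OF \<epsilon>] by blast
      have "padic_abs p (q k - q l) < \<epsilon>" if "k \<ge> max M N" "l \<ge> max M N" for k l
      proof -
        have "?d (?c (q k)) (?c (q l)) \<le> ?d (?c (q k)) (\<sigma> k) + ?d (\<sigma> k) (?c (q l))"
          using c \<sigma>c by (intro K.metric.triangle)
        also have "?d (\<sigma> k) (?c (q l)) \<le> ?d (\<sigma> k) (\<sigma> l) + ?d (\<sigma> l) (?c (q l))"
          using c \<sigma>c by (intro K.metric.triangle)
        finally show ?thesis
          using q[of k] q[of l] N[of k] N[of l] M[of k l] that K.metric.commute[of "\<sigma> k" "?c (q k)"]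
          unfolding q_dist by simp
      qed
      then show "\<exists>M. \<forall>m\<ge>M. \<forall>n\<ge>M. padic_abs p (q m - q n) < \<epsilon>" by blast
    qed
    have "limitin K.metric.mtopology \<sigma> (padic_class q) sequentially"
      unfolding K.metric.limitin_metric
    proof (intro conjI allI impI)
      show "padic_class q \<in> carrier (padic_field p)" by (rule padic_class_closed[OF q_cauchy])
      fix \<epsilon> :: real assume "\<epsilon> > 0"
      then have \<epsilon>: "\<epsilon> / 2 > 0" by simp
      obtain M where M: "\<And>k l. M \<le> k \<Longrightarrow> M \<le> l \<Longrightarrow> padic_abs p (q k - q l) < \<epsilon> / 2"
        using cauchyD[OF q_cauchy \<epsilon>] by blast
      obtain N where N: "\<And>k. k \<ge> N \<Longrightarrow> 1 / (real k + 1) < \<epsilon> / 2" using small[OF \<epsilon>] by blast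
      show "\<forall>\<^sub>F k in sequentially. \<sigma> k \<in> carrier (padic_field p) \<and> ?d (\<sigma> k) (padic_class q) < \<epsilon>"
        using eventually_ge_at_top[of "max M N"]
      proof eventually_elim
        case (elim k)
        have "?d (?c (q k)) (padic_class q) \<le> \<epsilon> / 2"
          using M[of k] elim by (intro field_dist_padic_class_le[OF cauchy_const q_cauchy, of M]) (simp add: less_imp_le)
        moreover have "?d (\<sigma> k) (padic_class q) \<le> ?d (\<sigma> k) (?c (q k)) + ?d (?c (q k)) (padic_class q)"
          using c \<sigma>c padic_class_closed[OF q_cauchy] by (intro K.metric.triangle)
        moreover have "?d (\<sigma> k) (?c (q k)) < \<epsilon> / 2" using q[of k] N[of k] elim by simp
        ultimately show ?case using \<sigma>c by simp
      qed
    qed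
    then show "\<exists>X. limitin K.metric.mtopology \<sigma> X sequentially" by blast
  qed
qed

text \<open>Once the entries exceed r / 2 in absolute value and differ by less than r / 2, the
  ultrametric inequality bounds each absolute value by any other, so all are equal.\<close>

lemma padic_abs_eventually_constant:
  assumes x: "x \<in> carrier (padic_cauchy_ring p)" and r: "absval (padic_field p) (padic_class x) = r" "r > 0"
  shows "\<exists>M. \<forall>n\<ge>M. padic_abs p (x n) = r"
proof -
  have lim: "(\<lambda>n. padic_abs p (x n)) \<longlonglongrightarrow> r"
    using absval_padic_class[OF x] r by simp
  then have "\<forall>\<^sub>F n in sequentially. r / 2 < padic_abs p (x n)"
    using r by (intro order_tendstoD(1)) auto
  then obtain M where M: "\<And>n. n \<ge> M \<Longrightarrow> r / 2 < padic_abs p (x n)"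
    by (auto simp: eventually_sequentially)
  have "r / 2 > 0" using r by simp
  then obtain N where N: "\<And>m n. m \<ge> N \<Longrightarrow> n \<ge> N \<Longrightarrow> padic_abs p (x m - x n) < r / 2"
    using cauchyD[OF x] by blast
  have le: "padic_abs p (x m) \<le> padic_abs p (x n)" if "m \<ge> max M N" "n \<ge> max M N" for m n
    using padic_abs_add_le_max[of "x m - x n" "x n"] M[of m] N[of m n] that by (auto simp: le_max_iff_disj)
  have "padic_abs p (x m) = r" if m: "m \<ge> max M N" for m
  proof -
    have "\<forall>\<^sub>F n in sequentially. padic_abs p (x n) = padic_abs p (x m)"
      using eventually_ge_at_top[of "max M N"] by eventually_elim (use le m in \<open>auto intro: antisym\<close>)
    then have "(\<lambda>n. padic_abs p (x n)) \<longlonglongrightarrow> padic_abs p (x m)"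
      by (rule tendsto_eventually)
    then show ?thesis using lim LIMSEQ_unique by blast
  qed
  then show ?thesis by blast
qed

text \<open>One late index decides. There the rational entries have exactly the absolute values of X
  and Y, so a rational digit exists; at all later indices both entries have moved by less than |Y| /
  p, and the ultrametric inequality preserves the estimate.\<close>

lemma padic_field_digit:
  assumes X: "X \<in> carrier (padic_field p)" and Y: "Y \<in> carrier (padic_field p)"
    and le: "absval (padic_field p) X \<le> absval (padic_field p) Y"
  shows "\<exists>i. \<bar>i\<bar> \<le> int p \<and> absval (padic_field p) (X \<ominus>\<^bsub>padic_field p\<^esub>
      padic_class (\<lambda>n. of_int i) \<otimes>\<^bsub>padic_field p\<^esub> Y) \<le> 1 / real p * absval (padic_field p) Y"
proof -
  interpret K: valued_ring "padic_field p" by (rule valued_ring_padic_field)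
  obtain x where x: "x \<in> carrier (padic_cauchy_ring p)" "X = padic_class x"
    using X by (auto simp: carrier_padic_field)
  obtain y where y: "y \<in> carrier (padic_cauchy_ring p)" "Y = padic_class y"
    using Y by (auto simp: carrier_padic_field)
  have diff: "(\<lambda>n. x n - of_int i * y n) \<in> carrier (padic_cauchy_ring p)" for i
    using cauchy_add[OF x(1) cauchy_minus[OF cauchy_mult[OF cauchy_const y(1)]]] by simp
  have class_diff: "X \<ominus>\<^bsub>padic_field p\<^esub> padic_class (\<lambda>n. of_int i) \<otimes>\<^bsub>padic_field p\<^esub> Y
      = padic_class (\<lambda>n. x n - of_int i * y n)" for i
    unfolding x(2) y(2) padic_class_mult[OF cauchy_const y(1)]
    by (rule padic_class_diff[OF x(1) cauchy_mult[OF cauchy_const y(1)]])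
  define r where "r = absval (padic_field p) Y"
  consider "absval (padic_field p) X = 0" | "absval (padic_field p) X > 0"
    using K.absval_nonneg[OF X] by linarith
  then show ?thesis
  proof cases
    \<comment> \<open>Treated apart because absolute values are known to become stationary only when
      their limit is positive; the digit 0 works.\<close>
    case 1
    then have "X = \<zero>\<^bsub>padic_field p\<^esub>" using K.absval_eq_0_iff[OF X] by simp
    moreover have "padic_class (\<lambda>n. of_int 0) = \<zero>\<^bsub>padic_field p\<^esub>"
      by (simp add: padic_class_zero)
    ultimately have "absval (padic_field p) (X \<ominus>\<^bsub>padic_field p\<^esub> padic_class (\<lambda>n. of_int 0) \<otimes>\<^bsub>padic_field p\<^esub> Y) = 0"
      using Y by (simp add: a_minus_def K.absval_zero)
    then show ?thesis
      using K.absval_nonneg[OF Y] by (intro exI[of _ 0]) simp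
  next
    case 2
    then have r: "r > 0" using le by (simp add: r_def)
    obtain L where L: "\<And>n. n \<ge> L \<Longrightarrow> padic_abs p (x n) = absval (padic_field p) X"
      using padic_abs_eventually_constant[OF x(1)] 2 x(2) by blast
    obtain M where M: "\<And>n. n \<ge> M \<Longrightarrow> padic_abs p (y n) = r"
      using padic_abs_eventually_constant[OF y(1)] r y(2) r_def by blast
    have rp: "r / real p > 0" using r p_ge_2 by simp
    obtain N where N: "\<And>m n. m \<ge> N \<Longrightarrow> n \<ge> N \<Longrightarrow> padic_abs p (x m - x n) < r / real p"
      using cauchyD[OF x(1) rp] by blast
    obtain O' where O: "\<And>m n. m \<ge> O' \<Longrightarrow> n \<ge> O' \<Longrightarrow> padic_abs p (y m - y n) < r / real p"
      using cauchyD[OF y(1) rp] by blast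
    define k where "k = max (max L M) (max N O')"
    have k: "k \<ge> L" "k \<ge> M" "k \<ge> N" "k \<ge> O'" by (auto simp: k_def)
    have "padic_abs p (x k) \<le> padic_abs p (y k)" "y k \<noteq> 0"
      using L[OF k(1)] M[OF k(2)] le r by (auto simp: r_def)
    then obtain i where i: "\<bar>i\<bar> \<le> int p" "padic_abs p (x k - of_int i * y k) \<le> r / real p"
      using padic_digit[of "x k" "y k"] M[OF k(2)] by auto
    have "padic_abs p (x n - of_int i * y n) \<le> r / real p" if n: "n \<ge> k" for n
    proof -
      have "padic_abs p (of_int i * (y k - y n)) \<le> 1 * padic_abs p (y k - y n)"
        unfolding padic_abs_mult using padic_abs_int_le_1 padic_abs_nonneg by (intro mult_right_mono)
      then have 1: "padic_abs p (of_int i * (y k - y n)) \<le> r / real p"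
        using O[of k n] k n by simp
      have 2: "padic_abs p (x n - x k) \<le> r / real p"
        using N[of n k] k n by simp
      have "x n - of_int i * y n = (x n - x k) + ((x k - of_int i * y k) + of_int i * (y k - y n))"
        by (simp add: algebra_simps)
      then show ?thesis
        using padic_abs_add_le_max[of "x n - x k" "(x k - of_int i * y k) + of_int i * (y k - y n)"]
          padic_abs_add_le_max[of "x k - of_int i * y k" "of_int i * (y k - y n)"] 1 2 i(2)
        by (smt (verit))
    qed
    then have "absval (padic_field p) (padic_class (\<lambda>n. x n - of_int i * y n)) \<le> r / real p"
      by (intro LIMSEQ_le_const2[OF absval_padic_class[OF diff]]) blast
    then show ?thesis
      using i(1) by (intro exI[of _ i]) (simp add: class_diff r_def)
  qed
qed

lemma digit_ring_padic_field:
  "digit_ring (padic_field p) (\<lambda>i. padic_class (\<lambda>n. of_int i)) (padic_class (\<lambda>n. of_nat p))"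
proof -
  interpret K: valued_ring "padic_field p" by (rule valued_ring_padic_field)
  have pow: "padic_class (\<lambda>n. q) [^]\<^bsub>padic_field p\<^esub> k = padic_class (\<lambda>n. q ^ k)" for q and k :: nat
    by (induction k) (simp_all add: padic_class_one padic_class_mult[OF cauchy_const cauchy_const] mult.commute)
  have beta: "absval (padic_field p) (padic_class (\<lambda>n. of_nat p)) = 1 / real p"
    by (simp add: absval_padic_const padic_abs_p)
  \<comment> \<open>For positive k the integer 1 - p ^ k is prime to p, so its absolute value is 1.
    This gives the monotonicity axiom.\<close>
  have one_minus: "absval (padic_field p) (\<one>\<^bsub>padic_field p\<^esub> \<ominus>\<^bsub>padic_field p\<^esub>
      padic_class (\<lambda>n. of_nat p) [^]\<^bsub>padic_field p\<^esub> k) = (if k = 0 then 0 else 1)" for k :: nat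
  proof -
    have "absval (padic_field p) (\<one>\<^bsub>padic_field p\<^esub> \<ominus>\<^bsub>padic_field p\<^esub>
      padic_class (\<lambda>n. of_nat p) [^]\<^bsub>padic_field p\<^esub> k) = padic_abs p (of_int (1 - int p ^ k))"
      by (simp add: pow padic_class_one padic_class_diff[OF cauchy_const cauchy_const] absval_padic_const)
    moreover have "padic_abs p (of_int (1 - int p ^ k)) = 1" if "k \<noteq> 0"
    proof (rule padic_abs_int_eq_1)
      have "int p dvd int p ^ k" using that by simp
      then show "\<not> int p dvd 1 - int p ^ k"
        using not_unit_p by (metis dvd_diff_commute dvd_add_right_iff diff_add_cancel)
    qed
    ultimately show ?thesis by simp
  qed
  show ?thesis
  proof unfold_locales
    show "K.metric.mcomplete" by (rule mcomplete_padic_field)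
    show "padic_class (\<lambda>n. of_int i) \<in> carrier (padic_field p)" for i
      by (rule padic_class_closed[OF cauchy_const])
    show "padic_class (\<lambda>n. of_nat p) \<in> carrier (padic_field p)"
      by (rule padic_class_closed[OF cauchy_const])
    show "padic_class (\<lambda>n. of_int (i + j)) =
        padic_class (\<lambda>n. of_int i) \<oplus>\<^bsub>padic_field p\<^esub> padic_class (\<lambda>n. of_int j)" for i j
      by (simp add: padic_class_add[OF cauchy_const cauchy_const])
    show "absval (padic_field p) (padic_class (\<lambda>n. of_int i)) \<le> \<bar>real_of_int i\<bar>" for i
      unfolding absval_padic_const
    proof (cases "i = 0")
      case False
      then have "1 \<le> \<bar>real_of_int i\<bar>" by linarith
      then show "padic_abs p (of_int i) \<le> \<bar>real_of_int i\<bar>"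
        using padic_abs_int_le_1[of i] by linarith
    qed simp
    show "1 \<le> \<bar>real_of_int i\<bar> * absval (padic_field p) (padic_class (\<lambda>n. of_int i))" if i: "i \<noteq> 0" for i
    proof -
      \<comment> \<open>The power of p that makes \<open>i\<close> small divides \<open>i\<close>,
        hence is at most the usual absolute value.\<close>
      have "int p ^ multiplicity (int p) i \<le> \<bar>i\<bar>"
        using i by (intro zdvd_imp_le) (auto simp: multiplicity_dvd)
      then have "real_of_int (int p ^ multiplicity (int p) i) \<le> real_of_int \<bar>i\<bar>"
        by (simp only: of_int_le_iff)
      then have "real p ^ multiplicity (int p) i \<le> real_of_int \<bar>i\<bar>"
        by simp
      then show ?thesis
        unfolding absval_padic_const padic_abs_int_eq[OF i] using p_ge_2 by (simp add: le_divide_eq)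
    qed
    show "0 < absval (padic_field p) (padic_class (\<lambda>n. of_nat p))"
      "absval (padic_field p) (padic_class (\<lambda>n. of_nat p)) \<le> 1 / 2"
      unfolding beta using p_ge_2 by (auto simp: field_simps)
    show "absval (padic_field p) (\<one>\<^bsub>padic_field p\<^esub> \<ominus>\<^bsub>padic_field p\<^esub>
          padic_class (\<lambda>n. of_nat p) [^]\<^bsub>padic_field p\<^esub> k)
        \<le> absval (padic_field p) (\<one>\<^bsub>padic_field p\<^esub> \<ominus>\<^bsub>padic_field p\<^esub>
          padic_class (\<lambda>n. of_nat p) [^]\<^bsub>padic_field p\<^esub> l)" if "k \<le> l" for k l :: nat
      unfolding one_minus using that by auto
    show "\<exists>B. \<forall>a\<in>carrier (padic_field p). \<forall>v\<in>carrier (padic_field p).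
        absval (padic_field p) a \<le> absval (padic_field p) v \<longrightarrow>
        (\<exists>i. \<bar>i\<bar> \<le> B \<and> absval (padic_field p) (a \<ominus>\<^bsub>padic_field p\<^esub>
          padic_class (\<lambda>n. of_int i) \<otimes>\<^bsub>padic_field p\<^esub> v)
          \<le> absval (padic_field p) (padic_class (\<lambda>n. of_nat p)) * absval (padic_field p) v)"
      unfolding beta using padic_field_digit by blast
  qed
qed

end

section \<open>The real numbers\<close>

lemma real_valued_field_sel:
  "carrier real_valued_field = UNIV" "monoid.mult real_valued_field = (*)" "one real_valued_field = 1"
  "zero real_valued_field = 0" "add real_valued_field = (+)" "absval real_valued_field = abs"
  by (simp_all add: real_valued_field_def)

text \<open>The value 1/2 of \<beta> matches the error of rounding to the nearest integer: the digit
  for a and v is the rounded quotient a / v.\<close>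

lemma digit_ring_real_valued_field: "digit_ring real_valued_field of_int (1 / 2)"
proof -
  have "abelian_group real_valued_field"
    by (rule abelian_groupI) (auto simp: real_valued_field_sel intro: exI[of _ "- _"])
  moreover have "comm_monoid real_valued_field"
    by (rule comm_monoidI) (auto simp: real_valued_field_sel)
  ultimately have "cring real_valued_field"
    by (rule cringI) (simp add: real_valued_field_sel algebra_simps)
  then interpret R: cring real_valued_field .
  have minus: "\<ominus>\<^bsub>real_valued_field\<^esub> x = - x" for x
    by (rule R.minus_equality) (simp_all add: real_valued_field_sel)
  have diff: "x \<ominus>\<^bsub>real_valued_field\<^esub> y = x - y" for x y
    by (simp add: a_minus_def minus real_valued_field_sel)
  interpret valued_ring real_valued_field
    by unfold_locales (auto simp: real_valued_field_sel minus abs_mult)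
  have pow: "x [^]\<^bsub>real_valued_field\<^esub> k = x ^ k" for x and k :: nat
    by (induction k) (simp_all add: real_valued_field_sel)
  have dist: "field_dist real_valued_field = dist"
    by (simp add: fun_eq_iff field_dist_def real_valued_field_sel diff dist_real_def)
  show ?thesis
  proof unfold_locales
    show "metric.mcomplete"
      unfolding dist real_valued_field_sel using complete_UNIV by (simp add: mcomplete_iff_complete)
    show "1 \<le> \<bar>real_of_int i\<bar> * absval real_valued_field (real_of_int i)" if "i \<noteq> 0" for i
    proof -
      have "1 \<le> \<bar>i\<bar>" using that by linarith
      then have "1 * 1 \<le> \<bar>i\<bar> * \<bar>i\<bar>" by (intro mult_mono) auto
      then have "real_of_int 1 \<le> real_of_int (\<bar>i\<bar> * \<bar>i\<bar>)" by (simp only: of_int_le_iff)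
      then show ?thesis by (simp add: real_valued_field_sel)
    qed
    show "absval real_valued_field (\<one>\<^bsub>real_valued_field\<^esub> \<ominus>\<^bsub>real_valued_field\<^esub> (1 / 2) [^]\<^bsub>real_valued_field\<^esub> k)
        \<le> absval real_valued_field (\<one>\<^bsub>real_valued_field\<^esub> \<ominus>\<^bsub>real_valued_field\<^esub> (1 / 2) [^]\<^bsub>real_valued_field\<^esub> l)"
      if "k \<le> l" for k l :: nat
    proof -
      have "(1 / 2 :: real) ^ l \<le> (1 / 2) ^ k" using that by (intro power_decreasing) auto
      moreover have "(1 / 2 :: real) ^ k \<le> 1" by (intro power_le_one) auto
      ultimately show ?thesis
        by (simp only: real_valued_field_sel diff pow)
    qed
    have "\<exists>i. \<bar>i\<bar> \<le> 2 \<and> \<bar>a - real_of_int i * v\<bar> \<le> 1 / 2 * \<bar>v\<bar>" if av: "\<bar>a\<bar> \<le> \<bar>v\<bar>" for a v :: real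
    proof (cases "v = 0")
      case True
      then show ?thesis using av by (intro exI[of _ 0]) auto
    next
      case False
      define t where "t = a / v"
      have t: "\<bar>t\<bar> \<le> 1" using av False by (simp add: t_def abs_divide divide_le_eq)
      have r: "\<bar>real_of_int (round t) - t\<bar> \<le> 1 / 2" by (rule of_int_round_abs_le)
      \<comment> \<open>From |t| \<le> 1 and a rounding error of at most 1/2 the digit is at most
        3/2 in absolute value; 2 is a convenient integer bound.\<close>
      have "\<bar>real_of_int (round t)\<bar> \<le> real_of_int 2" using t r by linarith
      then have "\<bar>round t\<bar> \<le> 2" by linarith
      moreover have "a - real_of_int (round t) * v = - (real_of_int (round t) - t) * v"
        using False by (simp add: t_def algebra_simps)
      then have "\<bar>a - real_of_int (round t) * v\<bar> = \<bar>real_of_int (round t) - t\<bar> * \<bar>v\<bar>"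
        by (simp only: abs_mult abs_minus_cancel)
      then have "\<bar>a - real_of_int (round t) * v\<bar> \<le> 1 / 2 * \<bar>v\<bar>"
        using r by (simp only: mult_right_mono abs_ge_zero)
      ultimately show ?thesis by blast
    qed
    then show "\<exists>B. \<forall>a\<in>carrier real_valued_field. \<forall>v\<in>carrier real_valued_field.
        absval real_valued_field a \<le> absval real_valued_field v \<longrightarrow>
        (\<exists>i. \<bar>i\<bar> \<le> B \<and> absval real_valued_field (a \<ominus>\<^bsub>real_valued_field\<^esub>
          real_of_int i \<otimes>\<^bsub>real_valued_field\<^esub> v) \<le> absval real_valued_field (1 / 2) * absval real_valued_field v)"
      by (intro exI[of _ 2]) (simp add: real_valued_field_sel diff)
  qed (auto simp: real_valued_field_sel)
qed

theorem mainTheorem13: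
  shows "(\<exists>(G :: (nat \<Rightarrow> real) monoid) T.
            topological_group G T \<and> comm_group G \<and> complete_group G T \<and>
            \<not> filter_basis (lie_quotient_kernels real_valued_field G T))
       \<and> (\<forall>p::nat. prime p \<longrightarrow>
            (\<exists>(G :: (nat \<Rightarrow> (nat \<Rightarrow> rat) set) monoid) T.
               topological_group G T \<and> comm_group G \<and> complete_group G T \<and>
               \<not> filter_basis (lie_quotient_kernels (padic_field p) G T)))"
  using digit_ring.seq_group_counterexample[OF digit_ring_real_valued_field]
    digit_ring.seq_group_counterexample[OF digit_ring_padic_field] by blast

end
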